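(* For all $m,n\ge 1$, the algebraic matroids $S(m,n)/\mathrm{diag}$ and $\mathcal{A}(n-1)$ are isomorphic.
   Context: Let $\mathbb{C}[\Sigma]=\mathbb{C}[\sigma_{ij}:1\le i\le j\le m]$ and $I_{n+1}$ the prime ideal of $(n+1)\times(n+1)$ minors of the generic symmetric $m\times m$ matrix $\Sigma$. $S(m,n)/\mathrm{diag}$ is the algebraic matroid of the field extension $K(\mathbb{C}[\Sigma]/I_{n+1})/\mathbb{C}(\sigma_{ii}:i\in[m])$ with ground set $\{\sigma_{ij}:1\le i<j\le m\}$ (a subset is independent iff it is algebraically independent over $\mathbb{C}(\sigma_{ii}:i\in[m])$); here $K(\cdot)$ is the field of fractions. This is the contraction of the symmetric minor matroid by the diagonal elements. The generic rigidity matroid $\mathcal{A}(d)$ on $m$ points: let $P$ be a $d\times m$ matrix of algebraically independent indeterminates with columns $\mathbf{p}_1,\dots,\mathbf{p}_m$, and $f_{ij}=\|\mathbf{p}_i-\mathbf{p}_j\|_2^2$ for $1\le i<j\le m$; $\mathcal{A}(d)$ is the algebraic matroid on $\{f_{ij}\}$ over $\mathbb{R}$. *)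

theory Defs
  imports
    Complex_Main
    "HOL-Library.Poly_Mapping"
    "HOL-Algebra.QuotRing"
    "HOL-Algebra.Generated_Fields"
    "Jordan_Normal_Form.Determinant"
    "Jordan_Normal_Form.DL_Submatrix"
begin

section \<open>Polynomial rings\<close>

type_synonym ('v, 'c) mpol = "('v \<Rightarrow>\<^sub>0 nat) \<Rightarrow>\<^sub>0 'c"

definition pvar :: "'v \<Rightarrow> ('v, 'c::comm_ring_1) mpol" where
  "pvar v = Poly_Mapping.single (Poly_Mapping.single v 1) 1"

definition pconst :: "'c \<Rightarrow> ('v, 'c::comm_ring_1) mpol" where
  "pconst c = Poly_Mapping.single 0 c"

definition mpol_ring :: "'v set \<Rightarrow> ('v, 'c::comm_ring_1) mpol ring" where
  "mpol_ring V = \<lparr>carrier = {p. \<forall>\<mu>\<in>Poly_Mapping.keys p. Poly_Mapping.keys \<mu> \<subseteq> V},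
     monoid.mult = (*), one = 1, zero = 0, add = (+)\<rparr>"


section \<open>Rings of fractions\<close>

definition nonzerodivisors :: "('a, 'b) ring_scheme \<Rightarrow> 'a set" where
  "nonzerodivisors A =
     {s \<in> carrier A. \<forall>a\<in>carrier A. s \<otimes>\<^bsub>A\<^esub> a = \<zero>\<^bsub>A\<^esub> \<longrightarrow> a = \<zero>\<^bsub>A\<^esub>}"

definition fraction :: "('a, 'b) ring_scheme \<Rightarrow> 'a \<Rightarrow> 'a \<Rightarrow> ('a \<times> 'a) set" where
  "fraction A a s =
     {(b, t). b \<in> carrier A \<and> t \<in> nonzerodivisors A \<and> a \<otimes>\<^bsub>A\<^esub> t = b \<otimes>\<^bsub>A\<^esub> s}"

text \<open>The denominators are the non-zero-divisors, so that the construction makes sense for every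
  commutative ring. If \<open>A\<close> is an integral domain they are the nonzero elements and this is
  the field of fractions of \<open>A\<close>, see \<open>fraction_ring_field\<close> below.\<close>

definition fraction_ring :: "('a, 'b) ring_scheme \<Rightarrow> ('a \<times> 'a) set ring" where
  "fraction_ring A =
     \<lparr>carrier = {fraction A a s | a s. a \<in> carrier A \<and> s \<in> nonzerodivisors A},
      monoid.mult = (\<lambda>X Y. \<Union>(a, s)\<in>X. \<Union>(b, t)\<in>Y. fraction A (a \<otimes>\<^bsub>A\<^esub> b) (s \<otimes>\<^bsub>A\<^esub> t)),
      one = fraction A \<one>\<^bsub>A\<^esub> \<one>\<^bsub>A\<^esub>,
      zero = fraction A \<zero>\<^bsub>A\<^esub> \<one>\<^bsub>A\<^esub>,
      add = (\<lambda>X Y. \<Union>(a, s)\<in>X. \<Union>(b, t)\<in>Y.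
               fraction A (a \<otimes>\<^bsub>A\<^esub> t \<oplus>\<^bsub>A\<^esub> b \<otimes>\<^bsub>A\<^esub> s) (s \<otimes>\<^bsub>A\<^esub> t))\<rparr>"

text \<open>The quotients of elements of the subring generated by \<open>H\<close>. In a field \<open>K\<close> this is
  the subfield generated by \<open>H\<close>, see \<open>fractions_in_eq_generate_field\<close> below.\<close>

definition fractions_in :: "('a, 'b) ring_scheme \<Rightarrow> 'a set \<Rightarrow> 'a set" where
  "fractions_in K H =
     {a \<otimes>\<^bsub>K\<^esub> inv\<^bsub>K\<^esub> b | a b. a \<in> generate_ring K H \<and> b \<in> generate_ring K H \<inter> Units K}"

lemma nonzerodivisors_domain:
  assumes "domain A"
  shows "nonzerodivisors A = carrier A - {\<zero>\<^bsub>A\<^esub>}"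
proof -
  interpret domain A by fact
  show ?thesis
    unfolding nonzerodivisors_def
    by (auto simp: integral_iff dest: bspec[OF _ one_closed])
qed

context domain
begin

lemma nzd: "nonzerodivisors R = carrier R - {\<zero>}"
  by (rule nonzerodivisors_domain) (rule domain_axioms)

lemma fraction_mem:
  "(b, t) \<in> fraction R a s \<longleftrightarrow> b \<in> carrier R \<and> t \<in> carrier R \<and> t \<noteq> \<zero> \<and> a \<otimes> t = b \<otimes> s"
  unfolding fraction_def nzd by auto

lemma fraction_eqI:
  assumes "a \<in> carrier R" "s \<in> carrier R" "s \<noteq> \<zero>" "b \<in> carrier R" "t \<in> carrier R" "t \<noteq> \<zero>"
    and eq: "a \<otimes> t = b \<otimes> s"
  shows "fraction R a s = fraction R b t"
proof -
  have "fraction R a s \<subseteq> fraction R b t"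
    if as: "a \<in> carrier R" "s \<in> carrier R" "s \<noteq> \<zero>" and bt: "b \<in> carrier R" "t \<in> carrier R"
      and eq: "a \<otimes> t = b \<otimes> s" for a s b t
  proof (clarsimp simp: fraction_mem)
    fix c u assume cu: "c \<in> carrier R" "u \<in> carrier R" "u \<noteq> \<zero>" "a \<otimes> u = c \<otimes> s"
    have "s \<otimes> (b \<otimes> u) = (b \<otimes> s) \<otimes> u" using as bt cu(1,2) by (simp add: m_ac)
    also have "\<dots> = (a \<otimes> t) \<otimes> u" by (simp add: eq)
    also have "\<dots> = (a \<otimes> u) \<otimes> t" using as bt cu(1,2) by (simp add: m_ac)
    also have "\<dots> = (c \<otimes> s) \<otimes> t" by (simp add: cu)
    also have "\<dots> = s \<otimes> (c \<otimes> t)" using as bt cu(1,2) by (simp add: m_ac)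
    finally show "b \<otimes> u = c \<otimes> t" using as bt cu by (simp add: m_lcancel)
  qed
  from this[of a s b t] this[of b t a s] show ?thesis using assms by auto
qed

lemma fraction_UN:
  assumes as: "a \<in> carrier R" "s \<in> carrier R" "s \<noteq> \<zero>"
    and cong: "\<And>a' s'. a' \<in> carrier R \<Longrightarrow> s' \<in> carrier R \<Longrightarrow> s' \<noteq> \<zero> \<Longrightarrow> a \<otimes> s' = a' \<otimes> s
      \<Longrightarrow> f a' s' = f a s"
  shows "(\<Union>(a', s')\<in>fraction R a s. f a' s') = f a s"
proof -
  have "(a, s) \<in> fraction R a s" using as by (simp add: fraction_mem)
  then have ne: "fraction R a s \<noteq> {}" by blast
  show ?thesis
  proof (rule SUP_eq_const[OF ne])
    fix p assume p: "p \<in> fraction R a s"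
    obtain a' s' where p': "p = (a', s')" by (cases p)
    have "f a' s' = f a s" using p unfolding p' fraction_mem by (intro cong) blast+
    then show "(case p of (a', s') \<Rightarrow> f a' s') = f a s" unfolding p' by simp
  qed
qed

lemma fraction_mult:
  assumes as: "a \<in> carrier R" "s \<in> carrier R" "s \<noteq> \<zero>"
    and bt: "b \<in> carrier R" "t \<in> carrier R" "t \<noteq> \<zero>"
  shows "fraction R a s \<otimes>\<^bsub>fraction_ring R\<^esub> fraction R b t = fraction R (a \<otimes> b) (s \<otimes> t)"
proof -
  have inner: "(\<Union>(b', t')\<in>fraction R b t. fraction R (a' \<otimes> b') (s' \<otimes> t'))
      = fraction R (a' \<otimes> b) (s' \<otimes> t)"
    if a's': "a' \<in> carrier R" "s' \<in> carrier R" "s' \<noteq> \<zero>" for a' s'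
  proof (rule fraction_UN[OF bt])
    fix b' t' assume b't': "b' \<in> carrier R" "t' \<in> carrier R" "t' \<noteq> \<zero>" and e: "b \<otimes> t' = b' \<otimes> t"
    have "(a' \<otimes> b') \<otimes> (s' \<otimes> t) = (a' \<otimes> s') \<otimes> (b' \<otimes> t)" using a's' b't' bt by (simp add: m_ac)
    also have "\<dots> = (a' \<otimes> s') \<otimes> (b \<otimes> t')" by (simp only: e)
    also have "\<dots> = (a' \<otimes> b) \<otimes> (s' \<otimes> t')" using a's' b't' bt by (simp add: m_ac)
    finally show "fraction R (a' \<otimes> b') (s' \<otimes> t') = fraction R (a' \<otimes> b) (s' \<otimes> t)"
      using a's' b't' bt by (intro fraction_eqI) (auto simp: integral_iff)
  qed
  have "fraction R a s \<otimes>\<^bsub>fraction_ring R\<^esub> fraction R b t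
      = (\<Union>(a', s')\<in>fraction R a s. fraction R (a' \<otimes> b) (s' \<otimes> t))"
    unfolding fraction_ring_def
  proof (simp, rule SUP_cong[OF refl])
    fix p assume "p \<in> fraction R a s"
    then obtain a' s' where "p = (a', s')" "a' \<in> carrier R" "s' \<in> carrier R" "s' \<noteq> \<zero>"
      by (cases p) (simp add: fraction_mem)
    then show "(case p of (a', s') \<Rightarrow> \<Union>(b', t')\<in>fraction R b t. fraction R (a' \<otimes> b') (s' \<otimes> t'))
        = (case p of (a', s') \<Rightarrow> fraction R (a' \<otimes> b) (s' \<otimes> t))"
      by (simp add: inner)
  qed
  also have "\<dots> = fraction R (a \<otimes> b) (s \<otimes> t)"
  proof (rule fraction_UN[OF as])
    fix a' s' assume a's': "a' \<in> carrier R" "s' \<in> carrier R" "s' \<noteq> \<zero>" and e: "a \<otimes> s' = a' \<otimes> s"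
    have "(a' \<otimes> b) \<otimes> (s \<otimes> t) = (b \<otimes> t) \<otimes> (a' \<otimes> s)" using a's' as bt by (simp add: m_ac)
    also have "\<dots> = (b \<otimes> t) \<otimes> (a \<otimes> s')" by (simp only: e)
    also have "\<dots> = (a \<otimes> b) \<otimes> (s' \<otimes> t)" using a's' as bt by (simp add: m_ac)
    finally show "fraction R (a' \<otimes> b) (s' \<otimes> t) = fraction R (a \<otimes> b) (s \<otimes> t)"
      using a's' as bt by (intro fraction_eqI) (auto simp: integral_iff)
  qed
  finally show ?thesis .
qed

lemma fraction_add:
  assumes as: "a \<in> carrier R" "s \<in> carrier R" "s \<noteq> \<zero>"
    and bt: "b \<in> carrier R" "t \<in> carrier R" "t \<noteq> \<zero>"
  shows "fraction R a s \<oplus>\<^bsub>fraction_ring R\<^esub> fraction R b t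
    = fraction R (a \<otimes> t \<oplus> b \<otimes> s) (s \<otimes> t)"
proof -
  have inner: "(\<Union>(b', t')\<in>fraction R b t. fraction R (a' \<otimes> t' \<oplus> b' \<otimes> s') (s' \<otimes> t'))
      = fraction R (a' \<otimes> t \<oplus> b \<otimes> s') (s' \<otimes> t)"
    if a's': "a' \<in> carrier R" "s' \<in> carrier R" "s' \<noteq> \<zero>" for a' s'
  proof (rule fraction_UN[OF bt])
    fix b' t' assume b't': "b' \<in> carrier R" "t' \<in> carrier R" "t' \<noteq> \<zero>" and e: "b \<otimes> t' = b' \<otimes> t"
    have "(a' \<otimes> t' \<oplus> b' \<otimes> s') \<otimes> (s' \<otimes> t) = a' \<otimes> t' \<otimes> s' \<otimes> t \<oplus> (s' \<otimes> s') \<otimes> (b' \<otimes> t)"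
      using a's' b't' bt by (simp add: m_ac l_distr r_distr)
    also have "\<dots> = a' \<otimes> t' \<otimes> s' \<otimes> t \<oplus> (s' \<otimes> s') \<otimes> (b \<otimes> t')" by (simp only: e)
    also have "\<dots> = (a' \<otimes> t \<oplus> b \<otimes> s') \<otimes> (s' \<otimes> t')"
      using a's' b't' bt by (simp add: m_ac l_distr r_distr)
    finally show "fraction R (a' \<otimes> t' \<oplus> b' \<otimes> s') (s' \<otimes> t') = fraction R (a' \<otimes> t \<oplus> b \<otimes> s') (s' \<otimes> t)"
      using a's' b't' bt by (intro fraction_eqI) (auto simp: integral_iff)
  qed
  have "fraction R a s \<oplus>\<^bsub>fraction_ring R\<^esub> fraction R b t
      = (\<Union>(a', s')\<in>fraction R a s. fraction R (a' \<otimes> t \<oplus> b \<otimes> s') (s' \<otimes> t))"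
    unfolding fraction_ring_def
  proof (simp, rule SUP_cong[OF refl])
    fix p assume "p \<in> fraction R a s"
    then obtain a' s' where "p = (a', s')" "a' \<in> carrier R" "s' \<in> carrier R" "s' \<noteq> \<zero>"
      by (cases p) (simp add: fraction_mem)
    then show "(case p of (a', s') \<Rightarrow> \<Union>(b', t')\<in>fraction R b t. fraction R (a' \<otimes> t' \<oplus> b' \<otimes> s') (s' \<otimes> t'))
        = (case p of (a', s') \<Rightarrow> fraction R (a' \<otimes> t \<oplus> b \<otimes> s') (s' \<otimes> t))"
      by (simp add: inner)
  qed
  also have "\<dots> = fraction R (a \<otimes> t \<oplus> b \<otimes> s) (s \<otimes> t)"
  proof (rule fraction_UN[OF as])
    fix a' s' assume a's': "a' \<in> carrier R" "s' \<in> carrier R" "s' \<noteq> \<zero>" and e: "a \<otimes> s' = a' \<otimes> s"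
    have "(a' \<otimes> t \<oplus> b \<otimes> s') \<otimes> (s \<otimes> t) = (t \<otimes> t) \<otimes> (a' \<otimes> s) \<oplus> b \<otimes> s \<otimes> s' \<otimes> t"
      using a's' as bt by (simp add: m_ac l_distr r_distr)
    also have "\<dots> = (t \<otimes> t) \<otimes> (a \<otimes> s') \<oplus> b \<otimes> s \<otimes> s' \<otimes> t" by (simp only: e)
    also have "\<dots> = (a \<otimes> t \<oplus> b \<otimes> s) \<otimes> (s' \<otimes> t)"
      using a's' as bt by (simp add: m_ac l_distr r_distr)
    finally show "fraction R (a' \<otimes> t \<oplus> b \<otimes> s') (s' \<otimes> t) = fraction R (a \<otimes> t \<oplus> b \<otimes> s) (s \<otimes> t)"
      using a's' as bt by (intro fraction_eqI) (auto simp: integral_iff)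
  qed
  finally show ?thesis .
qed

lemma fraction_ring_simps:
  "carrier (fraction_ring R) = {fraction R a s | a s. a \<in> carrier R \<and> s \<in> carrier R \<and> s \<noteq> \<zero>}"
  "\<one>\<^bsub>fraction_ring R\<^esub> = fraction R \<one> \<one>"
  "\<zero>\<^bsub>fraction_ring R\<^esub> = fraction R \<zero> \<one>"
  by (auto simp: fraction_ring_def nzd)

lemma fraction_ring_field: "field (fraction_ring R)"
proof (rule cring.cring_fieldI2)
  show "cring (fraction_ring R)"
  proof (rule cringI)
    show "abelian_group (fraction_ring R)"
    proof (rule abelian_groupI)
      fix x assume "x \<in> carrier (fraction_ring R)"
      then obtain a s where x: "x = fraction R a s" and as: "a \<in> carrier R" "s \<in> carrier R" "s \<noteq> \<zero>"
        by (auto simp: fraction_ring_simps)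
      have "\<ominus> a \<otimes> s \<oplus> a \<otimes> s = \<zero>" using as by (simp add: l_minus l_neg)
      moreover have "fraction R \<zero> (s \<otimes> s) = fraction R \<zero> \<one>"
        using as by (intro fraction_eqI) (simp_all add: integral_iff)
      ultimately have "fraction R (\<ominus> a) s \<oplus>\<^bsub>fraction_ring R\<^esub> x = fraction R \<zero> \<one>"
        unfolding x using as by (simp add: fraction_add)
      then show "\<exists>y\<in>carrier (fraction_ring R). y \<oplus>\<^bsub>fraction_ring R\<^esub> x = \<zero>\<^bsub>fraction_ring R\<^esub>"
        unfolding fraction_ring_simps using as a_inv_closed by blast
    next
      fix x y assume "x \<in> carrier (fraction_ring R)" "y \<in> carrier (fraction_ring R)"
      then obtain a s b t where x: "x = fraction R a s" "y = fraction R b t"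
        and c: "a \<in> carrier R" "s \<in> carrier R" "s \<noteq> \<zero>" "b \<in> carrier R" "t \<in> carrier R" "t \<noteq> \<zero>"
        by (auto simp: fraction_ring_simps)
      show "x \<oplus>\<^bsub>fraction_ring R\<^esub> y = y \<oplus>\<^bsub>fraction_ring R\<^esub> x"
        unfolding x using c by (simp add: fraction_add m_comm a_comm)
      have "s \<otimes> t \<noteq> \<zero>" "s \<otimes> t \<in> carrier R" "a \<otimes> t \<oplus> b \<otimes> s \<in> carrier R"
        using c by (auto simp: integral_iff)
      then show "x \<oplus>\<^bsub>fraction_ring R\<^esub> y \<in> carrier (fraction_ring R)"
        unfolding x fraction_add[OF c] fraction_ring_simps by blast
      fix z assume "z \<in> carrier (fraction_ring R)"
      then obtain d u where z: "z = fraction R d u"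
        and du: "d \<in> carrier R" "u \<in> carrier R" "u \<noteq> \<zero>"
        by (auto simp: fraction_ring_simps)
      show "x \<oplus>\<^bsub>fraction_ring R\<^esub> y \<oplus>\<^bsub>fraction_ring R\<^esub> z
        = x \<oplus>\<^bsub>fraction_ring R\<^esub> (y \<oplus>\<^bsub>fraction_ring R\<^esub> z)"
        unfolding x z using c du
        by (simp add: fraction_add integral_iff l_distr r_distr m_ac a_ac)
    next
      show "\<zero>\<^bsub>fraction_ring R\<^esub> \<in> carrier (fraction_ring R)"
        unfolding fraction_ring_simps using zero_closed one_closed one_not_zero by blast
    qed (auto simp: fraction_ring_simps fraction_add)
    show "comm_monoid (fraction_ring R)"
    proof (rule comm_monoidI)
      fix x y assume "x \<in> carrier (fraction_ring R)" "y \<in> carrier (fraction_ring R)"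
      then obtain a s b t where x: "x = fraction R a s" "y = fraction R b t"
        and c: "a \<in> carrier R" "s \<in> carrier R" "s \<noteq> \<zero>" "b \<in> carrier R" "t \<in> carrier R" "t \<noteq> \<zero>"
        by (auto simp: fraction_ring_simps)
      show "x \<otimes>\<^bsub>fraction_ring R\<^esub> y = y \<otimes>\<^bsub>fraction_ring R\<^esub> x"
        unfolding x using c by (simp add: fraction_mult m_comm)
      have "s \<otimes> t \<noteq> \<zero>" "s \<otimes> t \<in> carrier R" "a \<otimes> b \<in> carrier R"
        using c by (auto simp: integral_iff)
      then show "x \<otimes>\<^bsub>fraction_ring R\<^esub> y \<in> carrier (fraction_ring R)"
        unfolding x fraction_mult[OF c] fraction_ring_simps by blast
    next
      show "\<one>\<^bsub>fraction_ring R\<^esub> \<in> carrier (fraction_ring R)"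
        unfolding fraction_ring_simps using one_closed one_not_zero by blast
    qed (auto simp: fraction_ring_simps fraction_mult integral_iff m_assoc)
  next
    fix x y z assume "x \<in> carrier (fraction_ring R)" "y \<in> carrier (fraction_ring R)"
      "z \<in> carrier (fraction_ring R)"
    then obtain a s b t d u where x: "x = fraction R a s" "y = fraction R b t" "z = fraction R d u"
      and c: "a \<in> carrier R" "s \<in> carrier R" "s \<noteq> \<zero>" "b \<in> carrier R" "t \<in> carrier R" "t \<noteq> \<zero>"
        "d \<in> carrier R" "u \<in> carrier R" "u \<noteq> \<zero>"
      by (auto simp: fraction_ring_simps)
    have "fraction R ((a \<otimes> t \<oplus> b \<otimes> s) \<otimes> d) ((s \<otimes> t) \<otimes> u)
      = fraction R ((a \<otimes> d) \<otimes> (t \<otimes> u) \<oplus> (b \<otimes> d) \<otimes> (s \<otimes> u)) ((s \<otimes> u) \<otimes> (t \<otimes> u))"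
      using c by (intro fraction_eqI) (simp_all add: integral_iff l_distr r_distr m_ac)
    then show "(x \<oplus>\<^bsub>fraction_ring R\<^esub> y) \<otimes>\<^bsub>fraction_ring R\<^esub> z
      = x \<otimes>\<^bsub>fraction_ring R\<^esub> z \<oplus>\<^bsub>fraction_ring R\<^esub> y \<otimes>\<^bsub>fraction_ring R\<^esub> z"
      unfolding x using c by (simp add: fraction_mult fraction_add integral_iff)
  qed
  have "\<one> \<otimes> \<one> \<noteq> \<zero> \<otimes> \<one>" by simp
  then have "(\<one>, \<one>) \<notin> fraction R \<zero> \<one>" "(\<one>, \<one>) \<in> fraction R \<one> \<one>"
    by (auto simp: fraction_mem)
  then show "\<zero>\<^bsub>fraction_ring R\<^esub> \<noteq> \<one>\<^bsub>fraction_ring R\<^esub>"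
    by (auto simp: fraction_ring_simps)
next
  fix x assume "x \<in> carrier (fraction_ring R)" and nz: "x \<noteq> \<zero>\<^bsub>fraction_ring R\<^esub>"
  then obtain a s where x: "x = fraction R a s" and as: "a \<in> carrier R" "s \<in> carrier R" "s \<noteq> \<zero>"
    by (auto simp: fraction_ring_simps)
  have a: "a \<noteq> \<zero>"
  proof
    assume "a = \<zero>"
    then have "x = fraction R \<zero> \<one>" unfolding x using as by (intro fraction_eqI) simp_all
    then show False using nz by (simp add: fraction_ring_simps)
  qed
  have "fraction R (a \<otimes> s) (s \<otimes> a) = fraction R \<one> \<one>"
    using as a by (intro fraction_eqI) (simp_all add: integral_iff m_comm)
  then have "x \<otimes>\<^bsub>fraction_ring R\<^esub> fraction R s a = \<one>\<^bsub>fraction_ring R\<^esub>"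
    unfolding x using as a by (simp add: fraction_mult fraction_ring_simps)
  moreover have "fraction R s a \<in> carrier (fraction_ring R)"
    unfolding fraction_ring_simps using as a by blast
  ultimately show "\<exists>y\<in>carrier (fraction_ring R). x \<otimes>\<^bsub>fraction_ring R\<^esub> y = \<one>\<^bsub>fraction_ring R\<^esub>"
    by blast
qed

end

lemma (in field) fractions_in_eq_generate_field:
  assumes "H \<subseteq> carrier R"
  shows "fractions_in R H = generate_field R H"
proof
  let ?G = "generate_ring R H"
  have sub: "subring ?G R" using assms by (rule generate_ring_is_subring)
  note G = subringE[OF sub]
  show "fractions_in R H \<subseteq> generate_field R H"
  proof -
    have "x \<in> generate_field R H" if "x \<in> ?G" for x
      using that by induction (auto intro: generate_field.intros)
    then show ?thesis
      unfolding fractions_in_def field_Units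
      by (auto intro!: generate_field.eng_mult generate_field.m_inv)
  qed
  show "generate_field R H \<subseteq> fractions_in R H"
  proof
    fix x assume "x \<in> generate_field R H"
    then show "x \<in> fractions_in R H"
    proof induction
      case one
      have "\<one> = \<one> \<otimes> inv \<one>" by simp
      then show ?case unfolding fractions_in_def using G(3) by blast
    next
      case (incl h)
      then have "h = h \<otimes> inv \<one>" "h \<in> ?G" using assms by (auto intro: generate_ring.incl)
      then show ?case unfolding fractions_in_def using G(3) by blast
    next
      case (a_inv h)
      then obtain a b where h: "h = a \<otimes> inv b" "a \<in> ?G" "b \<in> ?G" "b \<in> Units R"
        unfolding fractions_in_def by blast
      then have "\<ominus> h = (\<ominus> a) \<otimes> inv b" using G(1) by (auto simp: l_minus)
      then show ?case unfolding fractions_in_def using h G(5) by blast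
    next
      case (m_inv h)
      then obtain a b where h: "h = a \<otimes> inv b" "a \<in> ?G" "b \<in> ?G" "b \<in> Units R"
        unfolding fractions_in_def by blast
      have c: "a \<in> carrier R" "b \<in> carrier R" "inv b \<in> carrier R" using h G(1) by auto
      have "a \<noteq> \<zero>" using m_inv h c by auto
      then have u: "a \<in> Units R" using c by (simp add: field_Units)
      then have "(a \<otimes> inv b) \<otimes> (b \<otimes> inv a) = \<one>"
        using h c by (metis Units_inv_closed Units_l_inv Units_r_inv l_one m_assoc m_closed)
      then have "inv h = b \<otimes> inv a" unfolding h(1) using u c
        by (intro comm_inv_char) auto
      then show ?case unfolding fractions_in_def using h u by blast
    next
      case (eng_add h h')
      then obtain a b a' b' where h: "h = a \<otimes> inv b" "a \<in> ?G" "b \<in> ?G" "b \<in> Units R"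
        and h': "h' = a' \<otimes> inv b'" "a' \<in> ?G" "b' \<in> ?G" "b' \<in> Units R"
        unfolding fractions_in_def by blast
      have c: "a \<in> carrier R" "a' \<in> carrier R" "b \<in> carrier R" "b' \<in> carrier R"
        "inv b \<in> carrier R" "inv b' \<in> carrier R" using h h' G(1) by auto
      have "(b \<otimes> b') \<otimes> (inv b \<otimes> inv b') = (b \<otimes> inv b) \<otimes> (b' \<otimes> inv b')"
        using c by (simp add: m_ac)
      then have i: "inv (b \<otimes> b') = inv b \<otimes> inv b'"
        using c h(4) h'(4) by (intro comm_inv_char) simp_all
      have "(a \<otimes> b' \<oplus> a' \<otimes> b) \<otimes> inv (b \<otimes> b')
        = (a \<otimes> inv b) \<otimes> (b' \<otimes> inv b') \<oplus> (a' \<otimes> inv b') \<otimes> (b \<otimes> inv b)"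
        unfolding i using c by (simp add: l_distr r_distr m_ac)
      also have "\<dots> = h \<oplus> h'" unfolding h(1) h'(1) using c h(4) h'(4) by simp
      finally have "h \<oplus> h' = (a \<otimes> b' \<oplus> a' \<otimes> b) \<otimes> inv (b \<otimes> b')" ..
      moreover have "a \<otimes> b' \<oplus> a' \<otimes> b \<in> ?G" "b \<otimes> b' \<in> ?G" "b \<otimes> b' \<in> Units R"
        using h(2-4) h'(2-4) by (simp_all add: G(6,7))
      ultimately show ?case unfolding fractions_in_def by blast
    next
      case (eng_mult h h')
      then obtain a b a' b' where h: "h = a \<otimes> inv b" "a \<in> ?G" "b \<in> ?G" "b \<in> Units R"
        and h': "h' = a' \<otimes> inv b'" "a' \<in> ?G" "b' \<in> ?G" "b' \<in> Units R"
        unfolding fractions_in_def by blast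
      have c: "a \<in> carrier R" "a' \<in> carrier R" "b \<in> carrier R" "b' \<in> carrier R"
        "inv b \<in> carrier R" "inv b' \<in> carrier R" using h h' G(1) by auto
      have "(b \<otimes> b') \<otimes> (inv b \<otimes> inv b') = (b \<otimes> inv b) \<otimes> (b' \<otimes> inv b')"
        using c by (simp add: m_ac)
      then have i: "inv (b \<otimes> b') = inv b \<otimes> inv b'"
        using c h(4) h'(4) by (intro comm_inv_char) simp_all
      have "h \<otimes> h' = (a \<otimes> a') \<otimes> inv (b \<otimes> b')"
        unfolding i h(1) h'(1) using c by (simp add: m_ac)
      moreover have "a \<otimes> a' \<in> ?G" "b \<otimes> b' \<in> ?G" "b \<otimes> b' \<in> Units R"
        using h(2-4) h'(2-4) by (simp_all add: G(6))
      ultimately show ?case unfolding fractions_in_def by blast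
    qed
  qed
qed


section \<open>Algebraic matroids\<close>

text \<open>A polynomial in the indeterminates \<open>J\<close> is given by the coefficients \<open>c \<mu>\<close> of finitely
  many monomials \<open>\<mu> \<in> M\<close>. Independence refers to the family \<open>x\<close>: a repeated value makes it
  dependent.\<close>

definition alg_independent ::
  "('a, 'b) ring_scheme \<Rightarrow> 'a set \<Rightarrow> ('e \<Rightarrow> 'a) \<Rightarrow> 'e set \<Rightarrow> bool" where
  "alg_independent K F x J \<longleftrightarrow>
     (\<forall>(M :: ('e \<Rightarrow>\<^sub>0 nat) set) c. finite M \<and> (\<forall>\<mu>\<in>M. Poly_Mapping.keys \<mu> \<subseteq> J) \<and> c \<in> M \<rightarrow> F \<and>
        (\<Oplus>\<^bsub>K\<^esub>\<mu>\<in>M. c \<mu> \<otimes>\<^bsub>K\<^esub>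
           (\<Otimes>\<^bsub>K\<^esub>e\<in>Poly_Mapping.keys \<mu>. x e [^]\<^bsub>K\<^esub> Poly_Mapping.lookup \<mu> e)) = \<zero>\<^bsub>K\<^esub>
        \<longrightarrow> (\<forall>\<mu>\<in>M. c \<mu> = \<zero>\<^bsub>K\<^esub>))"

text \<open>A matroid is represented by its ground set and its collection of independent sets.\<close>

type_synonym 'e matroid = "'e set \<times> 'e set set"

definition algebraic_matroid ::
  "('a, 'b) ring_scheme \<Rightarrow> 'a set \<Rightarrow> ('e \<Rightarrow> 'a) \<Rightarrow> 'e set \<Rightarrow> 'e matroid" where
  "algebraic_matroid K F x E = (E, {X. X \<subseteq> E \<and> alg_independent K F x X})"

definition matroid_isomorphic :: "'e matroid \<Rightarrow> 'f matroid \<Rightarrow> bool" where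
  "matroid_isomorphic M N \<longleftrightarrow>
     (\<exists>\<phi>. bij_betw \<phi> (fst M) (fst N) \<and> (\<forall>X\<subseteq>fst M. X \<in> snd M \<longleftrightarrow> \<phi> ` X \<in> snd N))"


section \<open>The symmetric minor matroid modulo the diagonal\<close>

text \<open>The index set \<open>{1, \<dots>, m}\<close> is shifted to \<open>{0, \<dots>, m - 1}\<close> throughout.\<close>

definition sym_ring :: "nat \<Rightarrow> (nat \<times> nat, complex) mpol ring" where
  "sym_ring m = mpol_ring {(i, j). i \<le> j \<and> j < m}"

definition sym_matrix :: "nat \<Rightarrow> (nat \<times> nat, complex) mpol mat" where
  "sym_matrix m = mat m m (\<lambda>(i, j). pvar (min i j, max i j))"

definition minor_ideal :: "nat \<Rightarrow> nat \<Rightarrow> (nat \<times> nat, complex) mpol set" where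
  "minor_ideal m k = Idl\<^bsub>sym_ring m\<^esub>
     {det (submatrix (sym_matrix m) I J) | I J.
        I \<subseteq> {..<m} \<and> J \<subseteq> {..<m} \<and> card I = k \<and> card J = k}"

definition sym_quotient :: "nat \<Rightarrow> nat \<Rightarrow> (nat \<times> nat, complex) mpol set ring" where
  "sym_quotient m n = sym_ring m Quot minor_ideal m (n + 1)"

definition sym_field :: "nat \<Rightarrow> nat \<Rightarrow>
    ((nat \<times> nat, complex) mpol set \<times> (nat \<times> nat, complex) mpol set) set ring" where
  "sym_field m n = fraction_ring (sym_quotient m n)"

definition to_sym_field :: "nat \<Rightarrow> nat \<Rightarrow> (nat \<times> nat, complex) mpol \<Rightarrow>
    ((nat \<times> nat, complex) mpol set \<times> (nat \<times> nat, complex) mpol set) set" where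
  "to_sym_field m n p =
     fraction (sym_quotient m n) (minor_ideal m (n + 1) +>\<^bsub>sym_ring m\<^esub> p) \<one>\<^bsub>sym_quotient m n\<^esub>"

definition diag_subfield :: "nat \<Rightarrow> nat \<Rightarrow>
    ((nat \<times> nat, complex) mpol set \<times> (nat \<times> nat, complex) mpol set) set set" where
  "diag_subfield m n = fractions_in (sym_field m n)
     (range (\<lambda>z. to_sym_field m n (pconst z)) \<union> (\<lambda>i. to_sym_field m n (pvar (i, i))) ` {..<m})"

definition sym_minor_matroid_mod_diag :: "nat \<Rightarrow> nat \<Rightarrow> (nat \<times> nat) matroid" where
  "sym_minor_matroid_mod_diag m n = algebraic_matroid (sym_field m n) (diag_subfield m n)
     (\<lambda>e. to_sym_field m n (pvar e)) {(i, j). i < j \<and> j < m}"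


section \<open>The generic rigidity matroid\<close>

text \<open>The indeterminate \<open>(k, i)\<close> is the \<open>k\<close>-th coordinate of the \<open>i\<close>-th point.\<close>

definition sq_dist_poly :: "nat \<Rightarrow> nat \<times> nat \<Rightarrow> (nat \<times> nat, real) mpol" where
  "sq_dist_poly d = (\<lambda>(i, j). \<Sum>k<d. (pvar (k, i) - pvar (k, j))\<^sup>2)"

definition rigidity_matroid :: "nat \<Rightarrow> nat \<Rightarrow> (nat \<times> nat) matroid" where
  "rigidity_matroid d m = algebraic_matroid (mpol_ring ({..<d} \<times> {..<m})) (range pconst)
     (sq_dist_poly d) {(i, j). i < j \<and> j < m}"

end

theory Submission
  imports Defs "HOL-Library.Product_Lexorder"
begin

text \<open>Let \<open>I\<close> be the ideal of minors of size \<open>n + 1\<close>. A polynomial lies in the radical of \<open>I\<close> if and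
  only if it vanishes on all Gram matrices of \<open>m\<close> vectors in \<open>\<complex>\<^sup>n\<close>: modulo a prime containing
  \<open>I\<close>, the generic symmetric matrix \<open>\<Sigma>\<close> satisfies \<open>\<Delta> \<Sigma> = Y\<^sup>T B Y\<close> for a nonzero principal minor \<open>\<Delta>\<close>
  of size \<open>r \<le> n\<close> and its symmetric adjugate \<open>B\<close>. Passing to powers does not
  affect dependence, so a set \<open>J\<close> is independent in \<open>S(m,n)/diag\<close> if and only if the polynomials
  \<open>\<langle>x\<^sub>i, x\<^sub>i\<rangle>\<close> for all \<open>i\<close> and \<open>\<langle>x\<^sub>i, x\<^sub>j\<rangle>\<close> for \<open>(i, j) \<in> J\<close> are algebraically independent.
  By the Jacobian criterion, this and the independence of the squared distances in dimension \<open>n - 1\<close>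
  both mean that a differential is surjective at a generic real point. At \<open>x\<^sub>i = \<lambda>\<^sub>i (p\<^sub>i, 1)\<close> the two
  differentials differ by an invertible linear change, which is the coning argument of rigidity theory.\<close>

text \<open>Working with the radical of I shapes the algebra: the quotient by I is handled as a
  general commutative ring whose fractions have non-zero-divisors as denominators, and everything is
  reduced to the question which polynomials in the diagonal variables and those of J lie in I. If f
  vanishes on Gram matrices, some f ^ k lies in I; it is nonzero together with f and involves no new
  variable. The coefficients cause no trouble because n >= 1 lets a Gram matrix have any diagonal,
  so no nonzero polynomial in the diagonal variables lies in I. The Jacobian criterion rests on
  one-variable real calculus along lines, whereas the symmetric side is complex. Gram polynomials
  take real values at real points, so the real and imaginary parts of the coefficients of a complex
  relation are again relations. Coning divides by the last coordinates of the points; for this, one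
  direction of the criterion allows to prescribe a polynomial h that must not vanish at the generic
  point.\<close>

abbreviation keys where "keys \<equiv> Poly_Mapping.keys"
abbreviation lookup where "lookup \<equiv> Poly_Mapping.lookup"

subsection \<open>Evaluation of polynomials\<close>

definition mon_eval :: "('v \<Rightarrow> 'd::comm_semiring_1) \<Rightarrow> ('v \<Rightarrow>\<^sub>0 nat) \<Rightarrow> 'd" where
  "mon_eval a \<mu> = (\<Prod>v\<in>keys \<mu>. a v ^ lookup \<mu> v)"

text \<open>The map \<open>h\<close> on coefficients makes one operator serve as evaluation at a
  point (\<open>h\<close> the identity), as substitution of polynomials (\<open>h = pconst\<close>)
  and as evaluation in an arbitrary commutative algebra.\<close>

definition meval ::
  "('c::zero \<Rightarrow> 'd::comm_semiring_1) \<Rightarrow> ('v \<Rightarrow> 'd) \<Rightarrow> ('v, 'c) mpol \<Rightarrow> 'd" where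
  "meval h a p = (\<Sum>\<mu>\<in>keys p. h (lookup p \<mu>) * mon_eval a \<mu>)"

abbreviation peval :: "('v \<Rightarrow> 'c::comm_semiring_1) \<Rightarrow> ('v, 'c) mpol \<Rightarrow> 'c" where
  "peval \<equiv> meval (\<lambda>c. c)"

lemma mon_eval_superset:
  assumes "finite E" "keys \<mu> \<subseteq> E"
  shows "mon_eval a \<mu> = (\<Prod>v\<in>E. a v ^ lookup \<mu> v)"
  unfolding mon_eval_def
  by (rule prod.mono_neutral_left) (use assms in \<open>auto simp: in_keys_iff\<close>)

lemma mon_eval_0 [simp]: "mon_eval a 0 = 1"
  by (simp add: mon_eval_def)

lemma mon_eval_single [simp]: "mon_eval a (Poly_Mapping.single v k) = a v ^ k"
  by (simp add: mon_eval_superset[of "{v}"])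

lemma mon_eval_add: "mon_eval a (\<mu> + \<nu>) = mon_eval a \<mu> * mon_eval a \<nu>"
proof -
  let ?E = "keys \<mu> \<union> keys \<nu>"
  have "keys (\<mu> + \<nu>) \<subseteq> ?E" by (rule keys_add)
  then show ?thesis
    by (simp add: mon_eval_superset[of ?E] lookup_add power_add prod.distrib)
qed

lemma mon_eval_cong: "(\<And>v. v \<in> keys \<mu> \<Longrightarrow> a v = b v) \<Longrightarrow> mon_eval a \<mu> = mon_eval b \<mu>"
  by (simp add: mon_eval_def)

lemma keys_plus_nat: "keys (\<mu> + \<nu>) = keys \<mu> \<union> keys (\<nu> :: 'v \<Rightarrow>\<^sub>0 nat)"
  by (auto simp: in_keys_iff lookup_add)

lemma poly_mapping_sum_single: "p = (\<Sum>\<mu>\<in>keys p. Poly_Mapping.single \<mu> (lookup p \<mu>))"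
proof (rule poly_mapping_eqI)
  fix \<nu>
  show "lookup p \<nu> = lookup (\<Sum>\<mu>\<in>keys p. Poly_Mapping.single \<mu> (lookup p \<mu>)) \<nu>"
    by (simp add: lookup_sum lookup_single when_def not_in_keys_iff_lookup_eq_zero[symmetric])
qed

lemma comm_ring_hom_pconst: "comm_ring_hom pconst"
  by standard (simp_all add: pconst_def single_add mult_single)

lemma comm_ring_hom_ident: "comm_ring_hom (\<lambda>c :: 'c :: comm_ring_1. c)"
  by standard simp_all

context comm_ring_hom
begin

lemma meval_superset:
  assumes "finite M" "keys p \<subseteq> M"
  shows "meval hom a p = (\<Sum>\<mu>\<in>M. hom (lookup p \<mu>) * mon_eval a \<mu>)"
  unfolding meval_def
  by (rule sum.mono_neutral_left) (use assms in \<open>auto simp: in_keys_iff\<close>)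

lemma meval_single: "meval hom a (Poly_Mapping.single \<mu> c) = hom c * mon_eval a \<mu>"
  by (subst meval_superset[of "{\<mu>}"]) (auto split: if_splits)

lemma meval_0: "meval hom a 0 = 0"
  by (simp add: meval_def)

lemma meval_add: "meval hom a (p + q) = meval hom a p + meval hom a q"
proof -
  let ?M = "keys p \<union> keys q"
  have "keys (p + q) \<subseteq> ?M" by (rule keys_add)
  then show ?thesis
    by (simp add: meval_superset[of ?M] lookup_add hom_add algebra_simps sum.distrib)
qed

lemma meval_sum: "meval hom a (sum f A) = (\<Sum>x\<in>A. meval hom a (f x))"
  by (induction A rule: infinite_finite_induct) (simp_all add: meval_0 meval_add)

lemma meval_mult: "meval hom a (p * q) = meval hom a p * meval hom a q"
proof -
  have "p * q = (\<Sum>\<mu>\<in>keys p. \<Sum>\<nu>\<in>keys q. Poly_Mapping.single (\<mu> + \<nu>) (lookup p \<mu> * lookup q \<nu>))"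
    by (subst (1) poly_mapping_sum_single[of p], subst (1) poly_mapping_sum_single[of q])
      (simp add: sum_product mult_single)
  then have "meval hom a (p * q)
      = (\<Sum>\<mu>\<in>keys p. \<Sum>\<nu>\<in>keys q. (hom (lookup p \<mu>) * mon_eval a \<mu>) * (hom (lookup q \<nu>) * mon_eval a \<nu>))"
    by (simp add: meval_sum meval_single mon_eval_add hom_mult algebra_simps)
  then show ?thesis by (simp add: meval_def sum_product)
qed

lemma comm_ring_hom_meval: "comm_ring_hom (meval hom a)"
proof
  show "meval hom a 1 = 1" using meval_single[of a 0 1] by simp
qed (simp_all add: meval_add meval_mult meval_0)

lemma meval_pvar: "meval hom a (pvar v) = a v"
  by (simp add: pvar_def meval_single)

lemma meval_pconst: "meval hom a (pconst c) = hom c"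
  by (simp add: pconst_def meval_single)

lemma hom_mon_eval: "hom (mon_eval b \<mu>) = mon_eval (\<lambda>v. hom (b v)) \<mu>"
  by (simp add: mon_eval_def hom_prod hom_power)

lemma hom_meval: "hom (meval h b p) = meval (\<lambda>c. hom (h c)) (\<lambda>v. hom (b v)) p"
  by (simp add: meval_def hom_sum hom_mult hom_mon_eval)

end

lemmas comm_ring_hom_peval = comm_ring_hom.comm_ring_hom_meval[OF comm_ring_hom_ident]
lemmas peval_pvar = comm_ring_hom.meval_pvar[OF comm_ring_hom_ident]
lemmas peval_pconst = comm_ring_hom.meval_pconst[OF comm_ring_hom_ident]
lemmas peval_single = comm_ring_hom.meval_single[OF comm_ring_hom_ident]
lemmas peval_0 = comm_ring_hom.meval_0[OF comm_ring_hom_ident]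
lemmas peval_add = comm_ring_hom.meval_add[OF comm_ring_hom_ident]
lemmas peval_mult = comm_ring_hom.meval_mult[OF comm_ring_hom_ident]
lemmas peval_sum = comm_ring_hom.meval_sum[OF comm_ring_hom_ident]

lemma
  fixes p :: "('v, 'c::comm_ring_1) mpol"
  shows peval_diff: "peval x (p - q) = peval x p - peval x q"
    and peval_power: "peval x (p ^ k) = peval x p ^ k"
    and peval_prod: "peval x (prod f A) = (\<Prod>y\<in>A. peval x (f y))"
proof -
  interpret comm_ring_hom "peval x" by (rule comm_ring_hom_peval)
  show "peval x (p - q) = peval x p - peval x q"
    "peval x (p ^ k) = peval x p ^ k" "peval x (prod f A) = (\<Prod>y\<in>A. peval x (f y))"
    by (rule hom_minus hom_power hom_prod)+
qed

lemma meval_cong: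
  assumes "\<And>\<mu> v. \<mu> \<in> keys p \<Longrightarrow> v \<in> keys \<mu> \<Longrightarrow> a v = b v"
  shows "meval h a p = meval h b p"
  unfolding meval_def using assms by (intro sum.cong refl arg_cong2[of _ _ _ _ "(*)"] mon_eval_cong) auto

lemma mon_eval_pvar: "mon_eval pvar \<mu> = Poly_Mapping.single \<mu> 1"
proof -
  have "(\<Prod>v\<in>E. (pvar v :: ('a, 'b) mpol) ^ lookup \<mu> v)
      = Poly_Mapping.single (\<Sum>v\<in>E. Poly_Mapping.single v (lookup \<mu> v)) 1" if "finite E" for E
    using that
  proof (induction E)
    case (insert v E)
    have "(pvar v :: ('a, 'b) mpol) ^ k = Poly_Mapping.single (Poly_Mapping.single v k) 1" for k
      by (induction k) (simp_all add: pvar_def mult_single single_add[symmetric])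
    then show ?case using insert by (simp add: mult_single)
  qed simp
  then show ?thesis
    unfolding mon_eval_def using poly_mapping_sum_single[of \<mu>] by simp
qed

lemma meval_pconst_pvar: "meval pconst pvar p = p"
  by (subst (2) poly_mapping_sum_single[of p])
    (simp add: meval_def mon_eval_pvar pconst_def mult_single)

subsection \<open>Polynomials in a set of variables\<close>

definition polys :: "'v set \<Rightarrow> ('v, 'c::zero) mpol set" where
  "polys V = {p. \<forall>\<mu>\<in>keys p. keys \<mu> \<subseteq> V}"

lemma polys_mono: "V \<subseteq> W \<Longrightarrow> polys V \<subseteq> polys W"
  by (auto simp: polys_def)

lemma polys_0 [simp]: "0 \<in> polys V" and polys_1 [simp]: "1 \<in> polys V"
  by (auto simp: polys_def)

lemma polys_single: "keys \<mu> \<subseteq> V \<Longrightarrow> Poly_Mapping.single \<mu> c \<in> polys V"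
  by (auto simp: polys_def)

lemma polys_pconst [simp]: "pconst c \<in> polys V"
  by (auto simp: pconst_def intro: polys_single)

lemma polys_pvar: "v \<in> V \<Longrightarrow> pvar v \<in> polys V"
  by (auto simp: pvar_def intro: polys_single)

lemma polys_add: "p \<in> polys V \<Longrightarrow> q \<in> polys V \<Longrightarrow> p + q \<in> polys V"
  using keys_add[of p q] by (fastforce simp: polys_def)

lemma polys_uminus: "(p :: ('v, 'c::comm_ring_1) mpol) \<in> polys V \<Longrightarrow> - p \<in> polys V"
  by (auto simp: polys_def in_keys_iff)

lemma polys_diff: "(p :: ('v, 'c::comm_ring_1) mpol) \<in> polys V \<Longrightarrow> q \<in> polys V \<Longrightarrow> p - q \<in> polys V"
  using polys_add[of p V "- q"] polys_uminus[of q V] by simp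

lemma polys_mult: "p \<in> polys V \<Longrightarrow> q \<in> polys V \<Longrightarrow> p * q \<in> polys V"
proof (unfold polys_def, clarify)
  fix \<mu> v assume pq: "\<forall>\<mu>\<in>keys p. keys \<mu> \<subseteq> V" "\<forall>\<mu>\<in>keys q. keys \<mu> \<subseteq> V"
    and "\<mu> \<in> keys (p * q)" and v: "v \<in> keys \<mu>"
  then obtain \<mu>1 \<mu>2 where "\<mu> = \<mu>1 + \<mu>2" "\<mu>1 \<in> keys p" "\<mu>2 \<in> keys q"
    using keys_mult[of p q] by blast
  then show "v \<in> V" using v pq by (auto simp: keys_plus_nat)
qed

lemma polys_sum: "(\<And>x. x \<in> A \<Longrightarrow> f x \<in> polys V) \<Longrightarrow> sum f A \<in> polys V"
  by (induction A rule: infinite_finite_induct) (auto intro: polys_add)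

lemma polys_prod: "(\<And>x. x \<in> A \<Longrightarrow> f x \<in> polys V) \<Longrightarrow> prod f A \<in> polys V"
  by (induction A rule: infinite_finite_induct) (auto intro: polys_mult)

lemma polys_power: "p \<in> polys V \<Longrightarrow> p ^ k \<in> polys V"
  by (induction k) (auto intro: polys_mult)

lemma polys_mon_eval: "(\<And>v. v \<in> keys \<mu> \<Longrightarrow> b v \<in> polys V) \<Longrightarrow> mon_eval b \<mu> \<in> polys V"
  unfolding mon_eval_def by (intro polys_prod polys_power)

lemma polys_meval:
  assumes "p \<in> polys W" "\<And>v. v \<in> W \<Longrightarrow> b v \<in> polys V"
  shows "meval pconst b p \<in> polys V"
proof -
  have "v \<in> W" if "\<mu> \<in> keys p" "v \<in> keys \<mu>" for \<mu> v using assms(1) that by (auto simp: polys_def)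
  then show ?thesis
    unfolding meval_def by (intro polys_sum polys_mult polys_pconst polys_mon_eval assms(2))
qed

lemma meval_cong_polys: "p \<in> polys V \<Longrightarrow> (\<And>v. v \<in> V \<Longrightarrow> a v = b v) \<Longrightarrow> meval h a p = meval h b p"
  by (rule meval_cong) (auto simp: polys_def)

lemma finite_indets: "finite (\<Union>\<mu>\<in>keys p. keys \<mu>)" and polys_indets: "p \<in> polys (\<Union>\<mu>\<in>keys p. keys \<mu>)"
  by (auto simp: polys_def)

section \<open>Points of an infinite grid at which a polynomial does not vanish\<close>

text \<open>Induction on the variables. The exponents are an abstract function \<open>E\<close> on
  an index set \<open>M\<close>, because the step keeps only some of the terms and forgets one
  variable; the last hypothesis says that the remaining exponent vectors are distinct.\<close>

lemma monomial_sum_nonvanishing: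
  fixes c :: "'m \<Rightarrow> 'c::idom" and E :: "'m \<Rightarrow> 'v \<Rightarrow> nat"
  assumes "finite V" "infinite A" "finite M" "M \<noteq> {}" "\<And>\<mu>. \<mu> \<in> M \<Longrightarrow> c \<mu> \<noteq> 0"
    and "\<And>\<mu> \<nu>. \<mu> \<in> M \<Longrightarrow> \<nu> \<in> M \<Longrightarrow> (\<And>v. v \<in> V \<Longrightarrow> E \<mu> v = E \<nu> v) \<Longrightarrow> \<mu> = \<nu>"
  shows "\<exists>a. (\<forall>v. a v \<in> A) \<and> (\<Sum>\<mu>\<in>M. c \<mu> * (\<Prod>v\<in>V. a v ^ E \<mu> v)) \<noteq> 0"
  using assms(1,3-)
proof (induction V arbitrary: M rule: finite_induct)
  case empty
  then obtain \<mu> where "M = {\<mu>}" by (metis all_not_in_conv insertI1 subsetI subset_singletonD emptyE)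
  moreover obtain x where "x \<in> A" using assms(2) by (metis finite.emptyI ex_in_conv)
  ultimately show ?case using empty by (intro exI[of _ "\<lambda>_. x"]) auto
next
  case (insert w V)
  obtain \<mu>0 where \<mu>0: "\<mu>0 \<in> M" using insert.prems by auto
  \<comment> \<open>The terms in \<open>?N\<close> make up the coefficient of one power of the
    variable \<open>w\<close>. A point \<open>a\<close> where it is nonzero gives a nonzero
    univariate polynomial \<open>q\<close>, and some \<open>t\<close> in the infinite set
    \<open>A\<close> avoids its roots.\<close>
  let ?N = "{\<mu>\<in>M. E \<mu> w = E \<mu>0 w}"
  have "\<exists>a. (\<forall>v. a v \<in> A) \<and> (\<Sum>\<mu>\<in>?N. c \<mu> * (\<Prod>v\<in>V. a v ^ E \<mu> v)) \<noteq> 0"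
  proof (rule insert.IH)
    fix \<mu> \<nu> assume "\<mu> \<in> ?N" "\<nu> \<in> ?N" "\<And>v. v \<in> V \<Longrightarrow> E \<mu> v = E \<nu> v"
    then show "\<mu> = \<nu>" by (intro insert.prems(4)) auto
  qed (use insert.prems \<mu>0 in auto)
  then obtain a where a: "\<forall>v. a v \<in> A" "(\<Sum>\<mu>\<in>?N. c \<mu> * (\<Prod>v\<in>V. a v ^ E \<mu> v)) \<noteq> 0" by blast
  define q where "q = (\<Sum>\<mu>\<in>M. monom (c \<mu> * (\<Prod>v\<in>V. a v ^ E \<mu> v)) (E \<mu> w))"
  have "coeff q (E \<mu>0 w) = (\<Sum>\<mu>\<in>?N. c \<mu> * (\<Prod>v\<in>V. a v ^ E \<mu> v))"
    unfolding q_def coeff_sum by (simp add: sum.inter_filter insert.prems)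
  then have "q \<noteq> 0" using a(2) by auto
  then have "finite {x. poly q x = 0}" by (rule poly_roots_finite)
  then obtain t where t: "t \<in> A" "poly q t \<noteq> 0"
    using assms(2) by (metis (mono_tags) finite_subset mem_Collect_eq subsetI)
  have "(\<Sum>\<mu>\<in>M. c \<mu> * (\<Prod>v\<in>insert w V. (a(w := t)) v ^ E \<mu> v)) = poly q t"
    unfolding q_def poly_sum
  proof (rule sum.cong[OF refl])
    fix \<mu>
    have "(\<Prod>v\<in>V. (a(w := t)) v ^ E \<mu> v) = (\<Prod>v\<in>V. a v ^ E \<mu> v)"
      by (rule prod.cong) (use insert.hyps in auto)
    then show "c \<mu> * (\<Prod>v\<in>insert w V. (a(w := t)) v ^ E \<mu> v)
        = poly (monom (c \<mu> * (\<Prod>v\<in>V. a v ^ E \<mu> v)) (E \<mu> w)) t"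
      using insert.hyps by (simp add: poly_monom mult_ac)
  qed
  then show ?case using a(1) t by (intro exI[of _ "a(w := t)"]) auto
qed

lemma peval_nonvanishing:
  fixes p :: "('v, 'c::idom) mpol"
  assumes "p \<noteq> 0" "infinite A"
  obtains a where "\<And>v. a v \<in> A" "peval a p \<noteq> 0"
proof -
  let ?V = "\<Union>\<mu>\<in>keys p. keys \<mu>"
  have "\<exists>a. (\<forall>v. a v \<in> A) \<and> (\<Sum>\<mu>\<in>keys p. lookup p \<mu> * (\<Prod>v\<in>?V. a v ^ lookup \<mu> v)) \<noteq> 0"
  proof (rule monomial_sum_nonvanishing)
    fix \<mu> \<nu> assume "\<mu> \<in> keys p" "\<nu> \<in> keys p" and eq: "\<And>v. v \<in> ?V \<Longrightarrow> lookup \<mu> v = lookup \<nu> v"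
    then show "\<mu> = \<nu>" by (intro poly_mapping_eqI) (metis UN_I in_keys_iff)
  qed (use assms in \<open>auto simp: in_keys_iff finite_indets\<close>)
  moreover have "mon_eval a \<mu> = (\<Prod>v\<in>?V. a v ^ lookup \<mu> v)" if "\<mu> \<in> keys p" for a :: "'v \<Rightarrow> 'c" and \<mu>
    by (rule mon_eval_superset) (use that in \<open>auto simp: finite_indets\<close>)
  ultimately show ?thesis using that by (auto simp: meval_def)
qed

text \<open>The grid is arbitrary so that identities can be tested at points with nonzero
  coordinates, where division is possible, or at the real points of a complex space.\<close>

lemma polynomial_eq_0I:
  fixes p :: "('v, 'c::idom) mpol"
  assumes "infinite A" "\<And>a. (\<And>v. a v \<in> A) \<Longrightarrow> peval a p = 0"
  shows "p = 0"
  using peval_nonvanishing assms by metis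

subsection \<open>Formal partial derivatives\<close>

text \<open>The subtraction of exponents is truncated, but where it truncates, the exponent of
  \<open>v\<close> is 0 and so is the coefficient.\<close>

definition pd :: "'v \<Rightarrow> ('v, 'c::comm_ring_1) mpol \<Rightarrow> ('v, 'c) mpol" where
  "pd v p = (\<Sum>\<mu>\<in>keys p.
     Poly_Mapping.single (\<mu> - Poly_Mapping.single v 1) (of_nat (lookup \<mu> v) * lookup p \<mu>))"

definition tdeg :: "('v \<Rightarrow>\<^sub>0 nat) \<Rightarrow> nat" where
  "tdeg \<mu> = (\<Sum>v\<in>keys \<mu>. lookup \<mu> v)"

lemma tdeg_superset: "finite E \<Longrightarrow> keys \<mu> \<subseteq> E \<Longrightarrow> tdeg \<mu> = (\<Sum>v\<in>E. lookup \<mu> v)"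
  unfolding tdeg_def by (rule sum.mono_neutral_left) (auto simp: in_keys_iff)

lemma tdeg_add_single: "tdeg (\<mu> + Poly_Mapping.single v k) = tdeg \<mu> + k"
proof -
  let ?E = "insert v (keys \<mu>)"
  have "keys (\<mu> + Poly_Mapping.single v k) \<subseteq> ?E"
    by (auto simp: keys_plus_nat split: if_splits)
  then have "tdeg (\<mu> + Poly_Mapping.single v k) = (\<Sum>u\<in>?E. lookup \<mu> u + (if u = v then k else 0))"
    by (subst tdeg_superset[of ?E]) (auto simp: lookup_add lookup_single when_def intro!: sum.cong)
  also have "\<dots> = tdeg \<mu> + k"
    by (subst tdeg_superset[of ?E \<mu>]) (auto simp: sum.distrib)
  finally show ?thesis .
qed

lemma minus_single_eq_iff:
  assumes "lookup \<mu> v > 0"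
  shows "\<mu> - Poly_Mapping.single v 1 = \<nu> \<longleftrightarrow> \<mu> = \<nu> + Poly_Mapping.single v (1::nat)"
proof
  assume eq: "\<mu> - Poly_Mapping.single v 1 = \<nu>"
  show "\<mu> = \<nu> + Poly_Mapping.single v 1"
    unfolding eq[symmetric]
    by (rule poly_mapping_eqI) (use assms in \<open>auto simp: lookup_add lookup_minus lookup_single when_def\<close>)
qed simp

lemma lookup_pd:
  "lookup (pd v p) \<nu> = of_nat (lookup \<nu> v + 1) * lookup p (\<nu> + Poly_Mapping.single v 1)"
proof -
  let ?s = "Poly_Mapping.single v (1::nat)"
  have "lookup (pd v p) \<nu> = (\<Sum>\<mu>\<in>keys p. of_nat (lookup \<mu> v) * lookup p \<mu> when \<mu> - ?s = \<nu>)"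
    by (simp add: pd_def lookup_sum lookup_single)
  also have "\<dots> = (\<Sum>\<mu>\<in>keys p. if \<mu> = \<nu> + ?s then of_nat (lookup \<mu> v) * lookup p \<mu> else 0)"
  proof (rule sum.cong[OF refl])
    fix \<mu>
    show "(of_nat (lookup \<mu> v) * lookup p \<mu> when \<mu> - ?s = \<nu>)
        = (if \<mu> = \<nu> + ?s then of_nat (lookup \<mu> v) * lookup p \<mu> else 0)"
    proof (cases "lookup \<mu> v = 0")
      case False
      then show ?thesis using minus_single_eq_iff[of \<mu> v \<nu>] by (simp add: when_def)
    qed (auto simp: when_def lookup_add)
  qed
  also have "\<dots> = of_nat (lookup \<nu> v + 1) * lookup p (\<nu> + ?s)"
    by (auto simp: lookup_add in_keys_iff)
  finally show ?thesis .
qed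

lemma keys_pd: "\<nu> \<in> keys (pd v p) \<Longrightarrow> \<nu> + Poly_Mapping.single v 1 \<in> keys p"
  by (auto simp: in_keys_iff lookup_pd)

lemma polys_pd: "p \<in> polys V \<Longrightarrow> pd v p \<in> polys V"
  by (fastforce simp: polys_def keys_plus_nat dest: keys_pd)

lemma tdeg_keys_pd:
  "(\<And>\<mu>. \<mu> \<in> keys p \<Longrightarrow> tdeg \<mu> < Suc d) \<Longrightarrow> \<nu> \<in> keys (pd v p) \<Longrightarrow> tdeg \<nu> < d"
  using keys_pd[of \<nu> v p] tdeg_add_single[of \<nu> v 1] by fastforce

text \<open>In characteristic 0 the exponent in front of a term is nonzero, and distinct monomials
  that contain \<open>v\<close> have distinct derivatives, so nothing can cancel.\<close>

lemma pd_eq_0D: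
  fixes p :: "('v, 'c::{idom, ring_char_0}) mpol"
  assumes "pd v p = 0" "\<mu> \<in> keys p"
  shows "lookup \<mu> v = 0"
proof (rule ccontr)
  let ?s = "Poly_Mapping.single v (1::nat)"
  assume nz: "lookup \<mu> v \<noteq> 0"
  then have "\<mu> = (\<mu> - ?s) + ?s" using minus_single_eq_iff[of \<mu> v] by blast
  then have "lookup (pd v p) (\<mu> - ?s) = of_nat (lookup (\<mu> - ?s) v + 1) * lookup p \<mu>"
    by (simp add: lookup_pd)
  moreover have "lookup p \<mu> \<noteq> 0" using assms(2) by (simp add: in_keys_iff)
  moreover have "of_nat (lookup (\<mu> - ?s) v + 1) \<noteq> (0 :: 'c)"
    by (simp only: of_nat_eq_0_iff)
  ultimately show False using assms(1) by (metis lookup_zero mult_eq_0_iff)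
qed

section \<open>The chain rule for polynomials along curves\<close>

lemma peval_pd:
  fixes A :: "('v, 'c::comm_ring_1) mpol"
  assumes "finite E" "A \<in> polys E" "e \<in> E"
  shows "peval x (pd e A) = (\<Sum>\<mu>\<in>keys A. lookup A \<mu> * (of_nat (lookup \<mu> e) * x e ^ (lookup \<mu> e - 1)
           * (\<Prod>v\<in>E - {e}. x v ^ lookup \<mu> v)))"
proof -
  let ?s = "Poly_Mapping.single e (1::nat)"
  have *: "mon_eval x (\<mu> - ?s) = x e ^ (lookup \<mu> e - 1) * (\<Prod>v\<in>E - {e}. x v ^ lookup \<mu> v)"
    if "\<mu> \<in> keys A" for \<mu>
  proof -
    have "keys (\<mu> - ?s) \<subseteq> keys \<mu>" by (auto simp: in_keys_iff lookup_minus)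
    also have "\<dots> \<subseteq> E" using assms(2) that by (auto simp: polys_def)
    finally have "keys (\<mu> - ?s) \<subseteq> E" .
    then have "mon_eval x (\<mu> - ?s) = (\<Prod>v\<in>E. x v ^ lookup (\<mu> - ?s) v)"
      using assms(1) by (rule mon_eval_superset[rotated])
    also have "\<dots> = x e ^ (lookup \<mu> e - 1) * (\<Prod>v\<in>E - {e}. x v ^ lookup (\<mu> - ?s) v)"
      using assms(1,3) by (simp add: prod.remove lookup_minus)
    also have "(\<Prod>v\<in>E - {e}. x v ^ lookup (\<mu> - ?s) v) = (\<Prod>v\<in>E - {e}. x v ^ lookup \<mu> v)"
      by (rule prod.cong) (auto simp: lookup_minus lookup_single when_def)
    finally show ?thesis .
  qed
  show ?thesis
    unfolding pd_def peval_sum peval_single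
    by (rule sum.cong[OF refl]) (simp only: *, simp add: algebra_simps)
qed

lemma DERIV_prod_power:
  fixes c :: "'e \<Rightarrow> real \<Rightarrow> real"
  assumes "\<And>e. e \<in> E \<Longrightarrow> (c e has_real_derivative c' e) (at t)"
  shows "((\<lambda>t. \<Prod>e\<in>E. c e t ^ k e) has_real_derivative
    (\<Sum>e\<in>E. (real (k e) * c e t ^ (k e - 1) * (\<Prod>v\<in>E - {e}. c v t ^ k v)) * c' e)) (at t)"
proof -
  have "((\<lambda>t. c e t ^ k e) has_real_derivative (real (k e) * c e t ^ (k e - 1) * c' e)) (at t)"
    if "e \<in> E" for e
    using DERIV_power[OF assms[OF that], of "k e"] by (simp add: mult_ac)
  then have "((\<lambda>t. \<Prod>e\<in>E. c e t ^ k e) has_real_derivative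
    (\<Sum>e\<in>E. (real (k e) * c e t ^ (k e - 1) * c' e) * (\<Prod>v\<in>E - {e}. c v t ^ k v))) (at t)"
    by (rule has_field_derivative_prod)
  then show ?thesis by (simp add: mult_ac)
qed

text \<open>Stated for arbitrary differentiable curves: straight lines give the differential of a
  polynomial, and the values of the \<open>G e\<close> along a line give the derivative of an
  algebraic relation between them.\<close>

lemma DERIV_peval:
  fixes c :: "'e \<Rightarrow> real \<Rightarrow> real"
  assumes "finite E" "A \<in> polys E" "\<And>e. e \<in> E \<Longrightarrow> (c e has_real_derivative c' e) (at t)"
  shows "((\<lambda>t. peval (\<lambda>e. c e t) A) has_real_derivative
    (\<Sum>e\<in>E. peval (\<lambda>e. c e t) (pd e A) * c' e)) (at t)"
proof -
  have "peval x A = (\<Sum>\<mu>\<in>keys A. lookup A \<mu> * (\<Prod>v\<in>E. x v ^ lookup \<mu> v))" for x :: "'e \<Rightarrow> real"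
    unfolding meval_def
    by (intro sum.cong refl arg_cong2[of _ _ _ _ "(*)"] mon_eval_superset)
      (use assms in \<open>auto simp: polys_def\<close>)
  moreover have "(\<Sum>e\<in>E. peval (\<lambda>e. c e t) (pd e A) * c' e)
    = (\<Sum>\<mu>\<in>keys A. lookup A \<mu> * (\<Sum>e\<in>E. (real (lookup \<mu> e) * c e t ^ (lookup \<mu> e - 1)
        * (\<Prod>v\<in>E - {e}. c v t ^ lookup \<mu> v)) * c' e))"
    by (simp add: peval_pd[OF assms(1,2)] sum_distrib_left sum_distrib_right mult.assoc)
      (rule sum.swap)
  ultimately show ?thesis
    by (simp only:) (intro DERIV_sum DERIV_cmult DERIV_prod_power assms(3))
qed

subsection \<open>Linear systems\<close>

text \<open>Gaussian elimination, one equation at a time. It serves twice: to find a relation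
  between too many polynomials, and to solve inhomogeneous systems.\<close>

lemma underdetermined_system:
  fixes a :: "'b \<Rightarrow> 'a \<Rightarrow> 'c::field"
  assumes "finite B" "finite A" "card B < card A"
  shows "\<exists>c. (\<exists>x\<in>A. c x \<noteq> 0) \<and> (\<forall>y\<in>B. (\<Sum>x\<in>A. a y x * c x) = 0)"
  using assms
proof (induction B arbitrary: A a rule: finite_induct)
  case empty
  then show ?case by (intro exI[of _ "\<lambda>_. 1"]) (auto simp: card_gt_0_iff)
next
  case (insert y B)
  show ?case
  proof (cases "\<forall>x\<in>A. a y x = 0")
    case True
    obtain c where c: "\<exists>x\<in>A. c x \<noteq> 0" "\<forall>y\<in>B. (\<Sum>x\<in>A. a y x * c x) = 0"
      using insert.IH[of A a] insert.prems insert.hyps by auto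
    moreover have "(\<Sum>x\<in>A. a y x * c x) = 0" using True by (intro sum.neutral) simp
    ultimately show ?thesis by blast
  next
    case False
    then obtain x0 where x0: "x0 \<in> A" "a y x0 \<noteq> 0" by blast
    \<comment> \<open>\<open>?a\<close> is the system that remains after the equation
      \<open>y\<close> has been solved for the unknown \<open>x0\<close>; the value of
      \<open>c'\<close> at \<open>x0\<close> is the back substitution.\<close>
    let ?A = "A - {x0}" and ?a = "\<lambda>z x. a z x - a z x0 * (a y x / a y x0)"
    have "card B < card ?A" using insert.prems insert.hyps x0 by simp
    then obtain c where c: "\<exists>x\<in>?A. c x \<noteq> 0" "\<forall>z\<in>B. (\<Sum>x\<in>?A. ?a z x * c x) = 0"
      using insert.IH[of ?A ?a] insert.prems by auto
    define s where "s = (\<Sum>x\<in>?A. a y x * c x)"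
    define c' where "c' = c(x0 := - s / a y x0)"
    have eq: "(\<Sum>x\<in>A. a z x * c' x) = a z x0 * (- s / a y x0) + (\<Sum>x\<in>?A. a z x * c x)" for z
    proof -
      have "(\<Sum>x\<in>?A. a z x * c' x) = (\<Sum>x\<in>?A. a z x * c x)"
        by (rule sum.cong) (auto simp: c'_def)
      then show ?thesis using x0 insert.prems by (simp add: sum.remove c'_def)
    qed
    have "(\<Sum>x\<in>A. a z x * c' x) = 0" if "z \<in> insert y B" for z
    proof (cases "z = y")
      case True
      then show ?thesis using x0 by (simp add: eq s_def)
    next
      case False
      then have "0 = (\<Sum>x\<in>?A. ?a z x * c x)" using that c(2) by simp
      also have "\<dots> = (\<Sum>x\<in>?A. a z x * c x - a z x0 / a y x0 * (a y x * c x))"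
        by (rule sum.cong) (auto simp: algebra_simps)
      also have "\<dots> = (\<Sum>x\<in>?A. a z x * c x) - a z x0 / a y x0 * s"
        by (simp add: sum_subtractf s_def sum_distrib_left)
      finally show ?thesis unfolding eq by simp
    qed
    moreover have "\<exists>x\<in>A. c' x \<noteq> 0" using c(1) by (auto simp: c'_def)
    ultimately show ?thesis by blast
  qed
qed

text \<open>The right-hand side becomes the column of an extra unknown \<open>None\<close>. There
  are then more unknowns than equations, and in a nontrivial solution that unknown is nonzero by
  injectivity, so one can divide by it.\<close>

lemma injective_imp_surjective_system:
  fixes a :: "'b \<Rightarrow> 'a \<Rightarrow> 'c::field"
  assumes fin: "finite B" "finite A" and card: "card B \<le> card A"
    and inj: "\<And>c. \<forall>y\<in>B. (\<Sum>x\<in>A. a y x * c x) = 0 \<Longrightarrow> \<forall>x\<in>A. c x = 0"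
  shows "\<exists>c. \<forall>y\<in>B. (\<Sum>x\<in>A. a y x * c x) = z y"
proof -
  let ?a = "\<lambda>y. case_option (- z y) (a y)"
  have "card B < card (insert None (Some ` A))" using fin card by (simp add: card_image)
  then obtain c where c: "\<exists>x\<in>insert None (Some ` A). c x \<noteq> 0"
      "\<forall>y\<in>B. (\<Sum>x\<in>insert None (Some ` A). ?a y x * c x) = 0"
    using underdetermined_system[of B "insert None (Some ` A)" ?a] fin by auto
  have eq: "(\<Sum>x\<in>A. a y x * c (Some x)) = z y * c None" if "y \<in> B" for y
    using c(2) that fin by (simp add: sum.reindex)
  have "c None \<noteq> 0"
  proof
    assume "c None = 0"
    then have "\<forall>x\<in>A. c (Some x) = 0" using eq by (intro inj) simp
    then show False using c(1) \<open>c None = 0\<close> by auto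
  qed
  then have "(\<Sum>x\<in>A. a y x * (c (Some x) / c None)) = z y" if "y \<in> B" for y
    using eq[OF that] by (simp add: sum_divide_distrib[symmetric])
  then show ?thesis by (intro exI[of _ "\<lambda>x. c (Some x) / c None"]) blast
qed

text \<open>At a coordinate where the absolute value of \<open>c\<close> is maximal, the deviations
  from the identity matrix contribute at most the fraction \<open>card J / (card J + 1)\<close> of
  this maximum. As that is less than 1, the maximum is 0.\<close>

lemma near_identity_kernel_trivial:
  fixes c :: "'e \<Rightarrow> real"
  assumes "finite J"
    and near: "\<And>e e'. e \<in> J \<Longrightarrow> e' \<in> J \<Longrightarrow>
      \<bar>M e e' - (if e = e' then 1 else 0)\<bar> < 1 / (real (card J) + 1)"
    and ker: "\<And>e'. e' \<in> J \<Longrightarrow> (\<Sum>e\<in>J. c e * M e e') = 0"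
    and "e \<in> J"
  shows "c e = 0"
proof -
  let ?\<delta> = "\<lambda>e e'. if e = e' then 1 else (0::real)"
  have "Max ((\<lambda>e. \<bar>c e\<bar>) ` J) \<in> (\<lambda>e. \<bar>c e\<bar>) ` J" using assms by (intro Max_in) auto
  then obtain e' where e': "e' \<in> J" "\<bar>c e'\<bar> = Max ((\<lambda>e. \<bar>c e\<bar>) ` J)" by auto
  have le: "\<bar>c e\<bar> \<le> \<bar>c e'\<bar>" if "e \<in> J" for e using that assms(1) e'(2) by simp
  have "(\<Sum>e\<in>J. c e * (M e e' - ?\<delta> e e')) = - (\<Sum>e\<in>J. c e * ?\<delta> e e')"
    using ker[OF e'(1)] by (simp add: right_diff_distrib sum_subtractf)
  also have "(\<Sum>e\<in>J. c e * ?\<delta> e e') = c e'"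
    using assms(1) e'(1) by (simp add: if_distrib[of "(*) _"] cong: if_cong)
  finally have "\<bar>c e'\<bar> = \<bar>\<Sum>e\<in>J. c e * (M e e' - ?\<delta> e e')\<bar>" by simp
  also have "\<dots> \<le> (\<Sum>e\<in>J. \<bar>c e * (M e e' - ?\<delta> e e')\<bar>)" by (rule sum_abs)
  also have "\<dots> \<le> (\<Sum>e\<in>J. \<bar>c e'\<bar> * (1 / (real (card J) + 1)))"
    unfolding abs_mult by (intro sum_mono mult_mono le less_imp_le[OF near] e'(1)) simp_all
  also have "\<dots> = \<bar>c e'\<bar> * (real (card J) / (real (card J) + 1))" by simp
  finally have "\<bar>c e'\<bar> * (1 - real (card J) / (real (card J) + 1)) \<le> 0" by (simp add: algebra_simps)
  moreover have "1 - real (card J) / (real (card J) + 1) > 0" by (simp add: field_simps)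
  ultimately have "\<bar>c e'\<bar> \<le> 0" by (simp add: mult_le_0_iff)
  then show ?thesis using le[OF assms(4)] by simp
qed

subsection \<open>Algebraic independence of polynomials\<close>

definition poly_indep :: "('e \<Rightarrow> ('v, 'c::comm_ring_1) mpol) \<Rightarrow> 'e set \<Rightarrow> bool" where
  "poly_indep G J \<longleftrightarrow> (\<forall>A\<in>polys J. meval pconst G A = 0 \<longrightarrow> A = 0)"

lemma peval_meval: "peval x (meval pconst G A) = peval (\<lambda>e. peval x (G e)) A"
  unfolding comm_ring_hom.hom_meval[OF comm_ring_hom_peval] peval_pconst ..

lemma meval_eq_0_iff:
  fixes A :: "('e, 'c::{idom, ring_char_0}) mpol"
  shows "meval pconst G A = 0 \<longleftrightarrow> (\<forall>x. peval (\<lambda>e. peval x (G e)) A = 0)"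
proof
  assume "\<forall>x. peval (\<lambda>e. peval x (G e)) A = 0"
  then show "meval pconst G A = 0"
    by (intro polynomial_eq_0I[of UNIV]) (simp_all add: peval_meval infinite_UNIV_char_0)
qed (simp add: peval_meval[symmetric] meval_def[of _ _ 0])

section \<open>Counting monomials: at most as many independent polynomials as variables\<close>

text \<open>Exponents are bounded in each variable separately rather than in total, so that the
  number of monomials is an exact power.\<close>

definition box :: "'v set \<Rightarrow> nat \<Rightarrow> ('v \<Rightarrow>\<^sub>0 nat) set" where
  "box V k = {\<mu>. keys \<mu> \<subseteq> V \<and> (\<forall>v. lookup \<mu> v \<le> k)}"

lemma card_box:
  assumes "finite V"
  shows "finite (box V k)" "card (box V k) = Suc k ^ card V"
proof -
  have "bij_betw (\<lambda>\<mu>. restrict (lookup \<mu>) V) (box V k) (PiE V (\<lambda>_. {..k}))"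
  proof (rule bij_betwI')
    fix \<mu> \<nu> :: "'a \<Rightarrow>\<^sub>0 nat" assume \<mu>: "\<mu> \<in> box V k" "\<nu> \<in> box V k"
    show "(restrict (lookup \<mu>) V = restrict (lookup \<nu>) V) = (\<mu> = \<nu>)"
    proof
      assume eq: "restrict (lookup \<mu>) V = restrict (lookup \<nu>) V"
      show "\<mu> = \<nu>"
      proof (rule poly_mapping_eqI)
        fix v
        show "lookup \<mu> v = lookup \<nu> v"
        proof (cases "v \<in> V")
          case True
          then show ?thesis using fun_cong[OF eq, of v] by simp
        next
          case False
          then have "v \<notin> keys \<mu>" "v \<notin> keys \<nu>" using \<mu> by (auto simp: box_def)
          then show ?thesis by (simp add: in_keys_iff)
        qed
      qed
    qed simp
  next
    fix f assume f: "f \<in> PiE V (\<lambda>_. {..k})"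
    have fin: "finite {v. (if v \<in> V then f v else 0) \<noteq> 0}"
      by (rule finite_subset[OF _ assms]) auto
    let ?\<mu> = "Abs_poly_mapping (\<lambda>v. if v \<in> V then f v else 0)"
    have "lookup ?\<mu> = (\<lambda>v. if v \<in> V then f v else 0)" using fin by simp
    then have "?\<mu> \<in> box V k" "f = restrict (lookup ?\<mu>) V"
      using f by (auto simp: box_def in_keys_iff PiE_def Pi_def extensional_def restrict_def split: if_splits)
    then show "\<exists>\<mu>\<in>box V k. f = restrict (lookup \<mu>) V" by blast
  qed (auto simp: box_def)
  then show "finite (box V k)" "card (box V k) = Suc k ^ card V"
    using assms by (auto simp: bij_betw_finite bij_betw_same_card card_PiE finite_PiE)
qed

definition bdeg :: "nat \<Rightarrow> ('v, 'c::zero) mpol \<Rightarrow> bool" where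
  "bdeg k p \<longleftrightarrow> (\<forall>\<mu>\<in>keys p. \<forall>v. lookup \<mu> v \<le> k)"

lemma bdeg_mult: "bdeg k p \<Longrightarrow> bdeg l q \<Longrightarrow> bdeg (k + l) (p * q)"
  unfolding bdeg_def
proof (intro ballI allI)
  fix \<mu> v assume pq: "\<forall>\<mu>\<in>keys p. \<forall>v. lookup \<mu> v \<le> k" "\<forall>\<mu>\<in>keys q. \<forall>v. lookup \<mu> v \<le> l"
    and "\<mu> \<in> keys (p * q)"
  then obtain \<mu>1 \<mu>2 where "\<mu> = \<mu>1 + \<mu>2" "\<mu>1 \<in> keys p" "\<mu>2 \<in> keys q"
    using keys_mult[of p q] by blast
  then show "lookup \<mu> v \<le> k + l" using pq by (simp add: lookup_add add_mono)
qed

lemma bdeg_1: "bdeg 0 1"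
  by (simp add: bdeg_def)

lemma bdeg_power: "bdeg k p \<Longrightarrow> bdeg (l * k) (p ^ l)"
  by (induction l) (auto intro: bdeg_mult bdeg_1)

lemma bdeg_prod: "finite E \<Longrightarrow> (\<And>e. e \<in> E \<Longrightarrow> bdeg (k e) (p e)) \<Longrightarrow> bdeg (\<Sum>e\<in>E. k e) (\<Prod>e\<in>E. p e)"
  by (induction E rule: finite_induct) (auto intro: bdeg_mult bdeg_1)

lemma bdeg_mono: "bdeg k p \<Longrightarrow> k \<le> l \<Longrightarrow> bdeg l p"
  unfolding bdeg_def by (meson order_trans)

lemma lookup_le_tdeg: "lookup \<mu> v \<le> tdeg \<mu>"
  unfolding tdeg_def by (cases "v \<in> keys \<mu>") (auto intro: member_le_sum simp: in_keys_iff)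

lemma bdeg_exists: "\<exists>k. bdeg k p"
proof -
  have "lookup \<mu> v \<le> (\<Sum>\<mu>\<in>keys p. tdeg \<mu>)" if "\<mu> \<in> keys p" for \<mu> v
    using lookup_le_tdeg[of \<mu> v] member_le_sum[of \<mu> "keys p" tdeg] that by fastforce
  then show ?thesis by (auto simp: bdeg_def)
qed

lemma lookup_pconst_mult: "lookup (pconst c * p) \<mu> = c * lookup p \<mu>"
  unfolding pconst_def mult_map_scale_conv_mult[symmetric]
  by (simp add: Poly_Mapping.map.rep_eq when_def)

text \<open>Dimension count: the \<open>D ^ card J\<close> monomials in the \<open>G e\<close> with exponents below \<open>D\<close> live in a
  space of dimension \<open>O (D ^ card V)\<close>.\<close>

lemma poly_indep_card_le:
  fixes G :: "'e \<Rightarrow> ('v, 'c::field) mpol"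
  assumes V: "finite V" and J: "finite J" and G: "\<And>e. e \<in> J \<Longrightarrow> G e \<in> polys V"
    and indep: "poly_indep G J"
  shows "card J \<le> card V"
proof (rule ccontr)
  assume less: "\<not> card J \<le> card V"
  have "\<forall>e. \<exists>k. bdeg k (G e)" using bdeg_exists by blast
  then obtain \<delta>' where \<delta>': "\<forall>e. bdeg (\<delta>' e) (G e)" by (rule choice[THEN exE])
  define \<delta> where "\<delta> = (\<Sum>e\<in>J. \<delta>' e)"
  have \<delta>: "bdeg \<delta> (G e)" if "e \<in> J" for e
    by (rule bdeg_mono[OF \<delta>'[THEN spec]]) (use that J in \<open>simp add: \<delta>_def member_le_sum\<close>)
  \<comment> \<open>\<open>K\<close> bounds the exponents in a product of powers of the
    \<open>G e\<close> with exponents up to \<open>b\<close>. Since \<open>K + 1\<close> is at most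
    \<open>(card J * \<delta> + 1) * (b + 1)\<close>, this choice of \<open>b\<close> leaves room
    for at most \<open>b * (b + 1) ^ card V\<close> target monomials, which is less than
    \<open>(b + 1) ^ (card V + 1)\<close>.\<close>
  define b where "b = (card J * \<delta> + 1) ^ card V"
  define K where "K = card J * (b * \<delta>)"
  have "K + 1 \<le> (card J * \<delta> + 1) * (b + 1)" by (simp add: K_def algebra_simps)
  then have "(K + 1) ^ card V \<le> ((card J * \<delta> + 1) * (b + 1)) ^ card V" by (rule power_mono) simp
  also have "\<dots> = b * (b + 1) ^ card V" unfolding power_mult_distrib b_def[symmetric] ..
  also have "\<dots> < (b + 1) * (b + 1) ^ card V" by simp
  also have "\<dots> = (b + 1) ^ Suc (card V)" by simp
  also have "\<dots> \<le> (b + 1) ^ card J" using less by (intro power_increasing) auto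
  finally have "card (box V K) < card (box J b)" using V J by (simp add: card_box)
  then obtain c where c: "\<exists>\<mu>\<in>box J b. c \<mu> \<noteq> 0"
      "\<forall>\<nu>\<in>box V K. (\<Sum>\<mu>\<in>box J b. lookup (mon_eval G \<mu>) \<nu> * c \<mu>) = 0"
    using underdetermined_system[of "box V K" "box J b" "\<lambda>\<nu> \<mu>. lookup (mon_eval G \<mu>) \<nu>"] V J
    by (auto simp: card_box)
  define A where "A = (\<Sum>\<mu>\<in>box J b. Poly_Mapping.single \<mu> (c \<mu>))"
  have fin: "finite (box J b)" using J by (rule card_box)
  have lookup_A: "lookup A \<mu> = (if \<mu> \<in> box J b then c \<mu> else 0)" for \<mu>
    using fin by (simp add: A_def lookup_sum lookup_single when_def)
  have A: "A \<in> polys J" unfolding A_def by (intro polys_sum polys_single) (auto simp: box_def)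
  interpret comm_ring_hom "pconst :: 'c \<Rightarrow> ('v, 'c) mpol" by (rule comm_ring_hom_pconst)
  have in_box: "\<nu> \<in> box V K" if \<mu>: "\<mu> \<in> box J b" and \<nu>: "\<nu> \<in> keys (mon_eval G \<mu>)" for \<mu> \<nu>
  proof -
    have "bdeg (\<Sum>e\<in>J. lookup \<mu> e * \<delta>) (\<Prod>e\<in>J. G e ^ lookup \<mu> e)"
      using J by (intro bdeg_prod bdeg_power \<delta>)
    moreover have "(\<Sum>e\<in>J. lookup \<mu> e * \<delta>) \<le> (\<Sum>e\<in>J. b * \<delta>)"
      using \<mu> by (intro sum_mono mult_right_mono) (auto simp: box_def)
    moreover have "mon_eval G \<mu> = (\<Prod>e\<in>J. G e ^ lookup \<mu> e)"
      using \<mu> J by (intro mon_eval_superset) (auto simp: box_def)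
    ultimately have "bdeg K (mon_eval G \<mu>)" by (simp add: K_def bdeg_mono)
    moreover have "mon_eval G \<mu> \<in> polys V"
      using \<mu> by (intro polys_mon_eval G) (auto simp: box_def)
    ultimately show ?thesis using \<nu> by (auto simp: box_def bdeg_def polys_def)
  qed
  have "meval pconst G A = (\<Sum>\<mu>\<in>box J b. pconst (c \<mu>) * mon_eval G \<mu>)"
    unfolding A_def by (simp add: meval_sum meval_single)
  moreover have "lookup (\<Sum>\<mu>\<in>box J b. pconst (c \<mu>) * mon_eval G \<mu>) \<nu> = 0" for \<nu>
  proof (cases "\<nu> \<in> box V K")
    case True
    then show ?thesis using c(2) by (simp add: lookup_sum lookup_pconst_mult mult.commute)
  next
    case False
    then have "lookup (mon_eval G \<mu>) \<nu> = 0" if "\<mu> \<in> box J b" for \<mu>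
      using in_box that by (auto simp: in_keys_iff)
    then show ?thesis by (simp add: lookup_sum lookup_pconst_mult)
  qed
  ultimately have "meval pconst G A = 0" by (intro poly_mapping_eqI) simp
  then have "A = 0" using indep A by (auto simp: poly_indep_def)
  then show False using c(1) lookup_A by (metis lookup_zero)
qed

subsection \<open>The Jacobian criterion\<close>

definition jac :: "'v set \<Rightarrow> ('v, real) mpol \<Rightarrow> ('v \<Rightarrow> real) \<Rightarrow> ('v \<Rightarrow> real) \<Rightarrow> real" where
  "jac V g x v = (\<Sum>u\<in>V. peval x (pd u g) * v u)"

text \<open>Full row rank of the Jacobian matrix at \<open>x\<close>, expressed without
  matrices.\<close>

definition jac_surj :: "'v set \<Rightarrow> ('e \<Rightarrow> ('v, real) mpol) \<Rightarrow> ('v \<Rightarrow> real) \<Rightarrow> 'e set \<Rightarrow> bool" where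
  "jac_surj V G x J \<longleftrightarrow> (\<forall>y. \<exists>v. \<forall>e\<in>J. jac V (G e) x v = y e)"

lemma DERIV_line:
  assumes "finite V" "g \<in> polys V"
  shows "((\<lambda>t. peval (\<lambda>u. x u + t * v u) g) has_real_derivative jac V g (\<lambda>u. x u + t * v u) v) (at t)"
  unfolding jac_def by (intro DERIV_peval assms) (auto intro!: derivative_eq_intros)

lemma isCont_peval_line: "isCont (\<lambda>t. peval (\<lambda>u. x u + t * v u) (g :: ('v, real) mpol)) t"
  by (rule DERIV_isCont, rule DERIV_line[OF finite_indets polys_indets])

lemma DERIV_relation_line:
  assumes "finite V" "finite J" "\<And>e. e \<in> J \<Longrightarrow> G e \<in> polys V" "A \<in> polys J"
  shows "((\<lambda>t. peval (\<lambda>e. peval (\<lambda>u. x u + t * v u) (G e)) A) has_real_derivative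
    (\<Sum>e\<in>J. peval (\<lambda>e. peval x (G e)) (pd e A) * jac V (G e) x v)) (at 0)"
  using DERIV_peval[OF assms(2,4), of "\<lambda>e t. peval (\<lambda>u. x u + t * v u) (G e)"
      "\<lambda>e. jac V (G e) x v" 0] DERIV_line[OF assms(1,3), of _ x v 0]
  by simp

lemma peval_constant: "keys A \<subseteq> {0} \<Longrightarrow> peval a A = lookup A 0"
  by (cases "A = 0") (auto simp: meval_def subset_singleton_iff)

text \<open>The derivative of a relation \<open>A\<close> along a line is a linear combination of
  the differentials of the \<open>G e\<close>, with the partial derivatives of \<open>A\<close> as
  coefficients. Where the differentials are independent these coefficients vanish, so every partial
  derivative is a relation of smaller degree, and the descent ends at a constant.\<close>

theorem jac_surj_imp_poly_indep:
  fixes G :: "'e \<Rightarrow> ('v, real) mpol"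
  assumes V: "finite V" and J: "finite J" and G: "\<And>e. e \<in> J \<Longrightarrow> G e \<in> polys V"
    and surj: "jac_surj V G x0 J"
  shows "poly_indep G J"
proof -
  let ?\<delta> = "\<lambda>e e'. if e = e' then 1 else (0::real)" and ?\<epsilon> = "1 / (real (card J) + 1)"
  have "\<forall>e'. \<exists>w. \<forall>e\<in>J. jac V (G e) x0 w = ?\<delta> e e'"
    using surj[unfolded jac_surj_def, THEN spec, of "\<lambda>e. ?\<delta> e e'" for e'] by blast
  then obtain w where "\<forall>e'. \<forall>e\<in>J. jac V (G e) x0 (w e') = ?\<delta> e e'" by (rule choice[THEN exE])
  then have w: "jac V (G e) x0 (w e') = ?\<delta> e e'" if "e \<in> J" for e e' using that by blast
  \<comment> \<open>At the points of \<open>U\<close> the directions \<open>w\<close>, which are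
    dual to the differentials at \<open>x0\<close>, are still nearly dual. Relations are only
    required to hold on \<open>U\<close>; this set is open along every line through its points,
    which is all that a derivative along a line sees.\<close>
  define U where "U = {x. \<forall>e\<in>J. \<forall>e'\<in>J. \<bar>jac V (G e) x (w e') - ?\<delta> e e'\<bar> < ?\<epsilon>}"
  have x0: "x0 \<in> U" by (simp add: U_def w)
  have U_open: "\<forall>\<^sub>F t in nhds 0. (\<lambda>u. x u + t * v u) \<in> U" if x: "x \<in> U" for x v
  proof -
    have "\<forall>\<^sub>F t in nhds 0. \<bar>jac V (G e) (\<lambda>u. x u + t * v u) (w e') - ?\<delta> e e'\<bar> < ?\<epsilon>"
      if "e \<in> J" "e' \<in> J" for e e'
    proof -
      let ?g = "\<lambda>t. \<bar>jac V (G e) (\<lambda>u. x u + t * v u) (w e') - ?\<delta> e e'\<bar>"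
      have "isCont ?g 0"
        unfolding jac_def by (intro continuous_intros isCont_peval_line)
      then have "(?g \<longlongrightarrow> ?g 0) (nhds 0)"
        unfolding isCont_def by (rule tendsto_at_iff_tendsto_nhds[THEN iffD1])
      moreover have "?g 0 < ?\<epsilon>" using x that by (simp add: U_def)
      ultimately show ?thesis by (rule order_tendstoD)
    qed
    then show ?thesis unfolding U_def mem_Collect_eq
      by (intro eventually_ball_finite J ballI)
  qed
  have "A = 0" if "A \<in> polys J" "\<And>\<mu>. \<mu> \<in> keys A \<Longrightarrow> tdeg \<mu> < d"
    "\<And>x. x \<in> U \<Longrightarrow> peval (\<lambda>e. peval x (G e)) A = 0" for A d
    using that
  proof (induction d arbitrary: A)
    case 0
    then have "keys A = {}" by (metis equals0I not_less0)
    then show ?case by simp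
  next
    case (Suc d)
    have pd0: "peval (\<lambda>e. peval x (G e)) (pd e A) = 0" if x: "x \<in> U" and e: "e \<in> J" for x e
    proof (rule near_identity_kernel_trivial[where M = "\<lambda>e e'. jac V (G e) x (w e')" and e = e,
          OF J _ _ e])
      fix e' assume "e' \<in> J"
      have "\<forall>\<^sub>F t in nhds 0. peval (\<lambda>e. peval (\<lambda>u. x u + t * w e' u) (G e)) A = 0"
        using U_open[OF x, of "w e'"] by (rule eventually_mono) (rule Suc.prems)
      then have "((\<lambda>t. peval (\<lambda>e. peval (\<lambda>u. x u + t * w e' u) (G e)) A) has_real_derivative 0) (at 0)"
        by (subst DERIV_cong_ev[OF refl _ refl, of _ "\<lambda>_. 0"]) simp_all
      then show "(\<Sum>e\<in>J. peval (\<lambda>e. peval x (G e)) (pd e A) * jac V (G e) x (w e')) = 0"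
        using DERIV_relation_line[OF V J G Suc.prems(1), where x = x and v = "w e'"] by (rule DERIV_unique[rotated])
    qed (use x in \<open>simp add: U_def\<close>)
    have "pd e A = 0" if "e \<in> J" for e
      by (rule Suc.IH) (use Suc.prems pd0 that in \<open>auto intro: polys_pd tdeg_keys_pd\<close>)
    then have "lookup \<mu> e = 0" if "\<mu> \<in> keys A" for \<mu> e
    proof (cases "e \<in> J")
      case False
      then have "e \<notin> keys \<mu>" using Suc.prems(1) that by (auto simp: polys_def)
      then show ?thesis by (simp add: in_keys_iff)
    qed (use pd_eq_0D[of e A \<mu>] \<open>\<And>e. e \<in> J \<Longrightarrow> pd e A = 0\<close> that in simp)
    then have "keys A \<subseteq> {0}" by (auto intro: poly_mapping_eqI)
    moreover have "lookup A 0 = 0"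
      using Suc.prems(3)[OF x0] peval_constant[OF \<open>keys A \<subseteq> {0}\<close>] by metis
    then have "0 \<notin> keys A" by (simp add: in_keys_iff)
    ultimately have "keys A = {}" by blast
    then show ?case by simp
  qed
  then show ?thesis
    unfolding poly_indep_def meval_eq_0_iff
    by (metis finite_keys finite_nat_set_iff_bounded finite_imageI imageI)
qed

text \<open>A renaming of indices. It shows that enlarging the family by variables can start from
  the empty set of variables.\<close>

lemma poly_indep_case_sum:
  fixes G :: "'e \<Rightarrow> ('v, 'c::comm_ring_1) mpol"
  assumes "poly_indep G J"
  shows "poly_indep (case_sum G pvar) (Inl ` J)"
  unfolding poly_indep_def
proof (intro ballI impI)
  fix A :: "('e + 'v, 'c) mpol"
  assume A: "A \<in> polys (Inl ` J)" "meval pconst (case_sum G pvar) A = 0"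
  define A' :: "('e, 'c) mpol" where "A' = meval pconst (case_sum pvar (\<lambda>_. 0)) A"
  have subst: "meval pconst b A' = meval pconst (case_sum b b') A"
    for b :: "'e \<Rightarrow> ('w, 'c) mpol" and b'
  proof -
    interpret c: comm_ring_hom "pconst :: 'c \<Rightarrow> ('w, 'c) mpol" by (rule comm_ring_hom_pconst)
    interpret h: comm_ring_hom "meval (pconst :: 'c \<Rightarrow> ('w, 'c) mpol) b" by (rule c.comm_ring_hom_meval)
    have "meval pconst b A' = meval pconst (\<lambda>v. meval pconst b (case_sum pvar (\<lambda>_. 0) v)) A"
      unfolding A'_def h.hom_meval by (simp add: c.meval_pconst)
    also have "\<dots> = meval pconst (case_sum b b') A"
      by (rule meval_cong_polys[OF A(1)]) (auto simp: c.meval_pvar)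
    finally show ?thesis .
  qed
  have "A' \<in> polys J"
    unfolding A'_def by (rule polys_meval[OF A(1)]) (auto intro: polys_pvar)
  moreover have "meval pconst G A' = 0" using subst A(2) by metis
  ultimately have "A' = 0" using assms by (auto simp: poly_indep_def)
  moreover have "meval pconst (\<lambda>e. pvar (Inl e)) A' = A"
    unfolding subst[of _ "\<lambda>v. pvar (Inr v)"]
    by (subst (2) meval_pconst_pvar[of A, symmetric]) (intro meval_cong, auto split: sum.splits)
  ultimately show "A = 0" by (simp add: meval_def)
qed

text \<open>Enlarge the family by a maximal set \<open>X\<close> of variables that keeps it
  independent. Every other variable \<open>k\<close> satisfies a relation \<open>A k\<close> whose
  derivative in \<open>k\<close> is nonzero at a generic point. A vector annihilated by the
  differentials of the enlarged family must then be 0, and since the family has at most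
  \<open>card V\<close> members, injectivity of the joint differential gives surjectivity.\<close>

theorem poly_indep_imp_jac_surj:
  fixes G :: "'e \<Rightarrow> ('v::linorder, real) mpol"
  assumes V: "finite V" and J: "finite J" and G: "\<And>e. e \<in> J \<Longrightarrow> G e \<in> polys V"
    and indep: "poly_indep G J" and h: "h \<noteq> 0"
  shows "\<exists>x. peval x h \<noteq> 0 \<and> jac_surj V G x J"
proof -
  let ?\<Phi> = "case_sum G pvar" and ?J = "\<lambda>X. Inl ` J \<union> Inr ` X"
  have \<Phi>: "?\<Phi> e \<in> polys V" if "e \<in> ?J V" for e using that G by (auto intro: polys_pvar)
  define S where "S = {X. X \<subseteq> V \<and> poly_indep ?\<Phi> (?J X)}"
  have "finite S" using V by (simp add: S_def)
  moreover have "{} \<in> S" using poly_indep_case_sum[OF indep] by (simp add: S_def)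
  ultimately have "\<exists>X\<in>S. \<forall>Y\<in>S. X \<le> Y \<longrightarrow> X = Y"
    by (intro finite_has_maximal) auto
  then obtain X where "X \<in> S" and "\<forall>Y\<in>S. X \<le> Y \<longrightarrow> X = Y" by blast
  then have XV: "X \<subseteq> V" and indepX: "poly_indep ?\<Phi> (?J X)"
    and max: "\<And>Y. Y \<subseteq> V \<Longrightarrow> poly_indep ?\<Phi> (?J Y) \<Longrightarrow> X \<subseteq> Y \<Longrightarrow> X = Y"
    unfolding S_def by auto
  have fin: "finite (?J Y)" if "Y \<subseteq> V" for Y using J finite_subset[OF that V] by simp
  have card: "card (?J X) \<le> card V"
    by (rule poly_indep_card_le[OF V fin \<Phi> indepX]) (use XV in auto)
  have "\<exists>A. A \<in> polys (?J (insert k X)) \<and> meval pconst ?\<Phi> A = 0 \<and> meval pconst ?\<Phi> (pd (Inr k) A) \<noteq> 0"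
    if k: "k \<in> V - X" for k
  proof -
    \<comment> \<open>A relation of least degree is chosen. Its derivative in \<open>k\<close> is
      nonzero, since otherwise the relation would not involve \<open>k\<close>; it has smaller
      degree and therefore is not a relation.\<close>
    let ?P = "\<lambda>d A. A \<in> polys (?J (insert k X)) \<and> meval pconst ?\<Phi> A = 0 \<and> A \<noteq> 0
      \<and> (\<forall>\<mu>\<in>keys A. tdeg \<mu> < d)"
    have "\<not> poly_indep ?\<Phi> (?J (insert k X))" using max[of "insert k X"] XV k by auto
    then obtain A0 where A0: "A0 \<in> polys (?J (insert k X))" "meval pconst ?\<Phi> A0 = 0" "A0 \<noteq> 0"
      unfolding poly_indep_def by blast
    have "finite (tdeg ` keys A0)" by simp
    then obtain d0 where "\<forall>\<mu>\<in>keys A0. tdeg \<mu> < d0" using finite_nat_set_iff_bounded by (metis imageI)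
    then have "\<exists>d. \<exists>A. ?P d A" using A0 by blast
    define d where "d = (LEAST d. \<exists>A. ?P d A)"
    have "\<exists>A. ?P d A" unfolding d_def using \<open>\<exists>d. \<exists>A. ?P d A\<close> by (rule LeastI_ex)
    then obtain A where A: "?P d A" by blast
    have least: "d \<le> d'" if "?P d' B" for d' B unfolding d_def by (rule Least_le) (use that in blast)
    have "d \<noteq> 0" using A by (metis keys_eq_empty all_not_in_conv not_less_zero)
    then obtain d' where d': "d = Suc d'" by (cases d) auto
    have nz: "pd (Inr k) A \<noteq> 0"
    proof
      assume "pd (Inr k) A = 0"
      then have "Inr k \<notin> keys \<mu>" if "\<mu> \<in> keys A" for \<mu>
        using pd_eq_0D[of "Inr k" A \<mu>] that by (simp add: in_keys_iff)
      moreover have "keys \<mu> \<subseteq> insert (Inr k) (?J X)" if "\<mu> \<in> keys A" for \<mu>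
        using A that by (auto simp: polys_def)
      ultimately have "A \<in> polys (?J X)" unfolding polys_def by blast
      then show False using A indepX by (auto simp: poly_indep_def)
    qed
    have tdeg: "\<forall>\<mu>\<in>keys (pd (Inr k) A). tdeg \<mu> < d'"
      using A tdeg_keys_pd[of A d'] d' by blast
    have polys: "pd (Inr k) A \<in> polys (?J (insert k X))" using A by (intro polys_pd) simp
    have "meval pconst ?\<Phi> (pd (Inr k) A) \<noteq> 0"
    proof
      assume "meval pconst ?\<Phi> (pd (Inr k) A) = 0"
      then have "d \<le> d'" by (intro least[of "pd (Inr k) A" d'] conjI nz tdeg polys)
      then show False using d' by simp
    qed
    then show ?thesis using A by (intro exI[of _ A]) simp
  qed
  then have "\<forall>k\<in>V - X. \<exists>A. A \<in> polys (?J (insert k X)) \<and> meval pconst ?\<Phi> A = 0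
      \<and> meval pconst ?\<Phi> (pd (Inr k) A) \<noteq> 0" by blast
  then obtain A where "\<forall>k\<in>V - X. A k \<in> polys (?J (insert k X)) \<and> meval pconst ?\<Phi> (A k) = 0
      \<and> meval pconst ?\<Phi> (pd (Inr k) (A k)) \<noteq> 0" by (rule bchoice[THEN exE])
  then have A: "A k \<in> polys (?J (insert k X))" "meval pconst ?\<Phi> (A k) = 0"
      "meval pconst ?\<Phi> (pd (Inr k) (A k)) \<noteq> 0" if "k \<in> V - X" for k using that by simp_all
  \<comment> \<open>A point where \<open>H\<close> is nonzero serves all \<open>k\<close> at once
    and respects the prescribed condition \<open>h\<close>.\<close>
  define H where "H = h * (\<Prod>k\<in>V - X. meval pconst ?\<Phi> (pd (Inr k) (A k)))"
  have "H \<noteq> 0" unfolding H_def using h A(3) V by simp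
  then obtain x where x: "peval x H \<noteq> 0"
    by (rule peval_nonvanishing[of H UNIV]) (simp_all add: infinite_UNIV_char_0)
  have Ax: "peval x (meval pconst ?\<Phi> (pd (Inr k) (A k))) \<noteq> 0"
    if "k \<in> V - X" for k
    using x that V unfolding H_def peval_mult peval_prod by auto
  have hx: "peval x h \<noteq> 0" using x unfolding H_def peval_mult by auto
  have jac_var: "jac V (pvar u) x v = v u" if "u \<in> V" for u v
  proof -
    have "((\<lambda>t. peval (\<lambda>u. x u + t * v u) (pvar u)) has_real_derivative v u) (at 0)"
      unfolding peval_pvar by (auto intro!: derivative_eq_intros)
    moreover have "((\<lambda>t. peval (\<lambda>u. x u + t * v u) (pvar u)) has_real_derivative jac V (pvar u) x v) (at 0)"
      using DERIV_line[OF V polys_pvar[OF that], of x v 0] by simp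
    ultimately show ?thesis by (rule DERIV_unique[rotated])
  qed
  have "\<exists>v. \<forall>e\<in>?J X. (\<Sum>u\<in>V. peval x (pd u (?\<Phi> e)) * v u) = y e" for y
  proof (rule injective_imp_surjective_system[OF _ V card])
    fix v assume v: "\<forall>e\<in>?J X. (\<Sum>u\<in>V. peval x (pd u (?\<Phi> e)) * v u) = 0"
    then have jac0: "jac V (?\<Phi> e) x v = 0" if "e \<in> ?J X" for e
      unfolding jac_def using that by blast
    show "\<forall>k\<in>V. v k = 0"
    proof
      fix k assume k: "k \<in> V"
      show "v k = 0"
      proof (cases "k \<in> X")
        case True
        then show ?thesis using jac0[of "Inr k"] jac_var[OF k] by auto
      next
        case False
        let ?I = "?J (insert k X)"
        have kX: "k \<in> V - X" using k False by blast
        have I: "?I = insert (Inr k) (?J X)" and notin: "Inr k \<notin> ?J X" using False by auto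
        have "peval (\<lambda>e. peval z (?\<Phi> e)) (A k) = 0" for z
          using A(2)[OF kX] by (simp only: meval_eq_0_iff)
        then have "((\<lambda>t. peval (\<lambda>e. peval (\<lambda>u. x u + t * v u) (?\<Phi> e)) (A k)) has_real_derivative 0) (at 0)"
          by simp
        moreover have "((\<lambda>t. peval (\<lambda>e. peval (\<lambda>u. x u + t * v u) (?\<Phi> e)) (A k)) has_real_derivative
          (\<Sum>e\<in>?I. peval (\<lambda>e. peval x (?\<Phi> e)) (pd e (A k)) * jac V (?\<Phi> e) x v)) (at 0)"
        proof (rule DERIV_relation_line[OF V])
          show "finite ?I" by (rule fin) (use XV k in auto)
          show "?\<Phi> e \<in> polys V" if "e \<in> ?I" for e by (rule \<Phi>) (use that XV k in auto)
          show "A k \<in> polys ?I" by (rule A(1)[OF kX])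
        qed
        ultimately have "(\<Sum>e\<in>?I. peval (\<lambda>e. peval x (?\<Phi> e)) (pd e (A k)) * jac V (?\<Phi> e) x v) = 0"
          by (rule DERIV_unique[rotated])
        \<comment> \<open>All other members of the family have a differential annihilating
          \<open>v\<close>, so only the term of the variable \<open>k\<close> is left.\<close>
        also have "(\<Sum>e\<in>?I. peval (\<lambda>e. peval x (?\<Phi> e)) (pd e (A k)) * jac V (?\<Phi> e) x v)
          = peval (\<lambda>e. peval x (?\<Phi> e)) (pd (Inr k) (A k)) * v k"
          unfolding I using notin fin[OF XV] jac0 jac_var[OF k] by simp
        finally show ?thesis using Ax[OF kX] by (simp add: peval_meval)
      qed
    qed
  qed (rule fin[OF XV])
  then have surj: "\<exists>v. \<forall>e\<in>?J X. jac V (?\<Phi> e) x v = y e" for y unfolding jac_def .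
  have "jac_surj V G x J"
    unfolding jac_surj_def
  proof
    fix y :: "'e \<Rightarrow> real"
    obtain v where "\<forall>e\<in>?J X. jac V (?\<Phi> e) x v = case_sum y (\<lambda>_. 0) e" using surj by blast
    from bspec[OF this, of "Inl e" for e] show "\<exists>v. \<forall>e\<in>J. jac V (G e) x v = y e"
      by (intro exI[of _ v]) simp
  qed
  then show ?thesis using hx by blast
qed

subsection \<open>Gram entries and squared distances\<close>

definition gram_poly :: "nat \<Rightarrow> nat \<times> nat \<Rightarrow> (nat \<times> nat, 'c::comm_ring_1) mpol" where
  "gram_poly n = (\<lambda>(i, j). \<Sum>k<n. pvar (k, i) * pvar (k, j))"

definition diag :: "nat \<Rightarrow> (nat \<times> nat) set" where
  "diag m = (\<lambda>i. (i, i)) ` {..<m}"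

lemma polys_gram_poly: "i < m \<Longrightarrow> j < m \<Longrightarrow> gram_poly n (i, j) \<in> polys ({..<n} \<times> {..<m})"
  unfolding gram_poly_def by (auto intro!: polys_sum polys_mult polys_pvar)

lemma polys_sq_dist_poly: "i < m \<Longrightarrow> j < m \<Longrightarrow> sq_dist_poly d (i, j) \<in> polys ({..<d} \<times> {..<m})"
  unfolding sq_dist_poly_def by (auto intro!: polys_sum polys_power polys_diff polys_pvar)

lemma peval_gram_poly: "peval x (gram_poly n (i, j)) = (\<Sum>k<n. x (k, i) * x (k, j))"
  by (simp add: gram_poly_def peval_sum peval_mult peval_pvar)

lemma peval_sq_dist_poly: "peval x (sq_dist_poly d (i, j)) = (\<Sum>k<d. (x (k, i) - x (k, j))\<^sup>2)"
  by (simp add: sq_dist_poly_def peval_sum peval_power peval_diff peval_pvar)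

text \<open>Two computations of the derivative of one function along a line are compared, which
  avoids the formal partial derivatives of the polynomial.\<close>

lemma jac_gram_poly:
  assumes "i < m" "j < m"
  shows "jac ({..<n} \<times> {..<m}) (gram_poly n (i, j)) x v
    = (\<Sum>k<n. x (k, i) * v (k, j) + v (k, i) * x (k, j))"
proof (rule DERIV_unique)
  let ?f = "\<lambda>t. peval (\<lambda>u. x u + t * v u) (gram_poly n (i, j))"
  show "(?f has_real_derivative jac ({..<n} \<times> {..<m}) (gram_poly n (i, j)) x v) (at 0)"
    using DERIV_line[OF _ polys_gram_poly[OF assms], of n x v 0] by simp
  show "(?f has_real_derivative (\<Sum>k<n. x (k, i) * v (k, j) + v (k, i) * x (k, j))) (at 0)"
    unfolding peval_gram_poly by (auto intro!: derivative_eq_intros sum.cong)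
qed

lemma jac_sq_dist_poly:
  assumes "i < m" "j < m"
  shows "jac ({..<d} \<times> {..<m}) (sq_dist_poly d (i, j)) x v
    = (\<Sum>k<d. 2 * (x (k, i) - x (k, j)) * (v (k, i) - v (k, j)))"
proof (rule DERIV_unique)
  let ?f = "\<lambda>t. peval (\<lambda>u. x u + t * v u) (sq_dist_poly d (i, j))"
  show "(?f has_real_derivative jac ({..<d} \<times> {..<m}) (sq_dist_poly d (i, j)) x v) (at 0)"
    using DERIV_line[OF _ polys_sq_dist_poly[OF assms], of d x v 0] by simp
  show "(?f has_real_derivative (\<Sum>k<d. 2 * (x (k, i) - x (k, j)) * (v (k, i) - v (k, j)))) (at 0)"
    unfolding peval_sq_dist_poly by (auto intro!: derivative_eq_intros sum.cong)
qed

text \<open>Write \<open>x\<^sub>i = (p\<^sub>i, 1)\<close> and \<open>v\<^sub>i = (w\<^sub>i, s\<^sub>i)\<close>. The derivative of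
  \<open>\<langle>x\<^sub>i, x\<^sub>j\<rangle> - (\<langle>x\<^sub>i, x\<^sub>i\<rangle> + \<langle>x\<^sub>j, x\<^sub>j\<rangle>) / 2\<close> in direction \<open>v\<close> does not involve \<open>s\<close> and is
  \<open>-1/2\<close> times that of the squared distance of \<open>p\<^sub>i\<close> and \<open>p\<^sub>j\<close>, and \<open>s\<^sub>i\<close> can be used to
  prescribe the derivative of \<open>\<langle>x\<^sub>i, x\<^sub>i\<rangle>\<close>.\<close>

lemma jac_surj_gramI:
  assumes J: "J \<subseteq> {(i, j). i < j \<and> j < m}"
    and surj: "jac_surj ({..<d} \<times> {..<m}) (sq_dist_poly d) p J"
  shows "jac_surj ({..<Suc d} \<times> {..<m}) (gram_poly (Suc d))
    (\<lambda>(k, i). if k < d then p (k, i) else 1) (diag m \<union> J)"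
  unfolding jac_surj_def
proof
  fix y :: "nat \<times> nat \<Rightarrow> real"
  let ?x = "\<lambda>(k, i). if k < d then p (k, i) else 1"
  \<comment> \<open>The squared distance of two points is
    \<open><x_i, x_i> + <x_j, x_j> - 2 <x_i, x_j>\<close>, because the last coordinates cancel;
    hence the prescribed values. The definition of \<open>s\<close> then solves the diagonal
    equation \<open>y (i, i) = 2 * (<p_i, w_i> + s i)\<close>.\<close>
  obtain w where w: "\<forall>e\<in>J. jac ({..<d} \<times> {..<m}) (sq_dist_poly d e) p w
      = (\<lambda>(i, j). y (i, i) + y (j, j) - 2 * y (i, j)) e"
    using surj unfolding jac_surj_def by blast
  define s where "s i = y (i, i) / 2 - (\<Sum>k<d. p (k, i) * w (k, i))" for i
  let ?v = "\<lambda>(k, i). if k < d then w (k, i) else s i"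
  have jac: "jac ({..<Suc d} \<times> {..<m}) (gram_poly (Suc d) (i, j)) ?x ?v
      = (\<Sum>k<d. p (k, i) * w (k, j) + w (k, i) * p (k, j)) + s i + s j" if "i < m" "j < m" for i j
    unfolding jac_gram_poly[OF that] by simp
  have "jac ({..<Suc d} \<times> {..<m}) (gram_poly (Suc d) e) ?x ?v = y e" if e: "e \<in> diag m \<union> J" for e
  proof (cases "e \<in> diag m")
    case True
    then obtain i where i: "e = (i, i)" "i < m" by (auto simp: diag_def)
    have "(\<Sum>k<d. p (k, i) * w (k, i) + w (k, i) * p (k, i)) = 2 * (\<Sum>k<d. p (k, i) * w (k, i))"
      by (simp add: sum_distrib_left mult.commute)
    then show ?thesis unfolding i(1) by (subst jac[OF i(2) i(2)]) (simp add: s_def)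
  next
    case False
    then obtain i j where e: "e = (i, j)" "e \<in> J" "i < m" "j < m" using e J by (cases e) fastforce
    have "(\<Sum>k<d. 2 * (p (k, i) - p (k, j)) * (w (k, i) - w (k, j)))
        = y (i, i) + y (j, j) - 2 * y (i, j)"
      using w e jac_sq_dist_poly[OF e(3,4)] by auto
    moreover have "(\<Sum>k<d. 2 * (p (k, i) - p (k, j)) * (w (k, i) - w (k, j)))
        = 2 * (\<Sum>k<d. p (k, i) * w (k, i)) + 2 * (\<Sum>k<d. p (k, j) * w (k, j))
          - 2 * (\<Sum>k<d. p (k, i) * w (k, j) + w (k, i) * p (k, j))"
      unfolding sum_distrib_left sum.distrib[symmetric] sum_subtractf[symmetric]
      by (rule sum.cong) (auto simp: algebra_simps)
    ultimately show ?thesis unfolding e(1) by (subst jac[OF e(3,4)]) (simp add: s_def)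
  qed
  then show "\<exists>v. \<forall>e\<in>diag m \<union> J. jac ({..<Suc d} \<times> {..<m}) (gram_poly (Suc d) e) ?x v = y e"
    by blast
qed

text \<open>The points are scaled to last coordinate 1. By bilinearity the differential of a Gram
  entry at \<open>x\<close> is the one at the scaled points times
  \<open>x (d, i) * x (d, j)\<close>. Prescribing 0 on the diagonal expresses the last coordinates
  of the direction by the others.\<close>

lemma jac_surj_sq_distI:
  assumes J: "J \<subseteq> {(i, j). i < j \<and> j < m}"
    and surj: "jac_surj ({..<Suc d} \<times> {..<m}) (gram_poly (Suc d)) x (diag m \<union> J)"
    and nz: "\<And>i. i < m \<Longrightarrow> x (d, i) \<noteq> 0"
  shows "jac_surj ({..<d} \<times> {..<m}) (sq_dist_poly d) (\<lambda>(k, i). x (k, i) / x (d, i)) J"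
  unfolding jac_surj_def
proof
  fix z :: "nat \<times> nat \<Rightarrow> real"
  \<comment> \<open>With the diagonal Gram entries held fixed, the differential of an off-diagonal
    entry is \<open>- 1 / 2\<close> times that of the squared distance; the product of last
    coordinates accounts for the scaling.\<close>
  obtain v where v: "\<forall>e\<in>diag m \<union> J. jac ({..<Suc d} \<times> {..<m}) (gram_poly (Suc d) e) x v
      = (\<lambda>(i, j). if i = j then 0 else - (x (d, i) * x (d, j) * z (i, j)) / 2) e"
    using surj unfolding jac_surj_def by blast
  define p w where "p = (\<lambda>(k, i). x (k, i) / x (d, i))" and "w = (\<lambda>(k, i). v (k, i) / x (d, i))"
  have jac: "jac ({..<Suc d} \<times> {..<m}) (gram_poly (Suc d) (i, j)) x v
      = x (d, i) * x (d, j) * ((\<Sum>k<d. p (k, i) * w (k, j) + w (k, i) * p (k, j)) + w (d, i) + w (d, j))"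
    if ij: "i < m" "j < m" for i j
    unfolding jac_gram_poly[OF that] using nz[OF ij(1)] nz[OF ij(2)]
    by (simp add: p_def w_def distrib_left sum_distrib_left mult_ac)
  have diag: "(\<Sum>k<d. p (k, i) * w (k, i)) + w (d, i) = 0" if i: "i < m" for i
  proof -
    have "(i, i) \<in> diag m \<union> J" using i by (auto simp: diag_def)
    then have "jac ({..<Suc d} \<times> {..<m}) (gram_poly (Suc d) (i, i)) x v = 0" using v by fastforce
    then have "(\<Sum>k<d. p (k, i) * w (k, i) + w (k, i) * p (k, i)) + w (d, i) + w (d, i) = 0"
      unfolding jac[OF i i] using nz[OF i] by simp
    moreover have "(\<Sum>k<d. p (k, i) * w (k, i) + w (k, i) * p (k, i)) = 2 * (\<Sum>k<d. p (k, i) * w (k, i))"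
      by (simp add: sum_distrib_left mult.commute)
    ultimately show ?thesis by simp
  qed
  have "jac ({..<d} \<times> {..<m}) (sq_dist_poly d e) p w = z e" if e: "e \<in> J" for e
  proof -
    obtain i j where ij: "e = (i, j)" "i < m" "j < m" "i \<noteq> j" using e J by (cases e) fastforce
    define r where "r = (\<Sum>k<d. p (k, i) * w (k, j) + w (k, i) * p (k, j)) + w (d, i) + w (d, j)"
    have "x (d, i) * x (d, j) * r = - (x (d, i) * x (d, j) * z (i, j)) / 2"
      using v e ij unfolding r_def jac[OF ij(2,3), symmetric] by auto
    then have "(x (d, i) * x (d, j)) * (2 * r) = (x (d, i) * x (d, j)) * (- z (i, j))" by simp
    then have eq: "2 * r = - z (i, j)"
      using nz[OF ij(2)] nz[OF ij(3)] by (metis mult_left_cancel mult_eq_0_iff)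
    have "(\<Sum>k<d. 2 * (p (k, i) - p (k, j)) * (w (k, i) - w (k, j)))
        = 2 * (\<Sum>k<d. p (k, i) * w (k, i)) + 2 * (\<Sum>k<d. p (k, j) * w (k, j))
          - 2 * (\<Sum>k<d. p (k, i) * w (k, j) + w (k, i) * p (k, j))"
      unfolding sum_distrib_left sum.distrib[symmetric] sum_subtractf[symmetric]
      by (rule sum.cong) (auto simp: algebra_simps)
    then show ?thesis
      unfolding ij(1) jac_sq_dist_poly[OF ij(2,3)] using eq diag[OF ij(2)] diag[OF ij(3)]
      by (simp add: r_def)
  qed
  then show "\<exists>v. \<forall>e\<in>J. jac ({..<d} \<times> {..<m}) (sq_dist_poly d e) (\<lambda>(k, i). x (k, i) / x (d, i)) v = z e"
    unfolding p_def by blast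
qed

theorem poly_indep_gram_iff_sq_dist:
  assumes J: "J \<subseteq> {(i, j). i < j \<and> j < m}"
  shows "poly_indep (gram_poly (Suc d) :: _ \<Rightarrow> (nat \<times> nat, real) mpol) (diag m \<union> J)
    \<longleftrightarrow> poly_indep (sq_dist_poly d) J"
proof -
  have "J \<subseteq> {..<m} \<times> {..<m}" using J by auto
  then have finJ: "finite J" by (rule finite_subset) simp
  then have fin: "finite (diag m \<union> J)" by (simp add: diag_def)
  have gram: "gram_poly (Suc d) e \<in> polys ({..<Suc d} \<times> {..<m})" if "e \<in> diag m \<union> J" for e
    using that \<open>J \<subseteq> {..<m} \<times> {..<m}\<close> by (cases e) (auto simp: diag_def intro!: polys_gram_poly)
  have dist: "sq_dist_poly d e \<in> polys ({..<d} \<times> {..<m})" if "e \<in> J" for e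
    using that \<open>J \<subseteq> {..<m} \<times> {..<m}\<close> by (cases e) (auto intro!: polys_sq_dist_poly)
  show ?thesis
  proof
    \<comment> \<open>The generic point must have nonzero last coordinates, since these become
      denominators.\<close>
    let ?h = "\<Prod>i<m. pvar (d, i) :: (nat \<times> nat, real) mpol"
    assume "poly_indep (gram_poly (Suc d) :: _ \<Rightarrow> (nat \<times> nat, real) mpol) (diag m \<union> J)"
    moreover have "?h \<noteq> 0"
    proof
      assume "?h = 0"
      then have "peval (\<lambda>_. 1) ?h = 0" by (simp only: peval_0)
      then show False by (simp add: peval_prod peval_pvar)
    qed
    ultimately have "\<exists>x. peval x ?h \<noteq> 0
        \<and> jac_surj ({..<Suc d} \<times> {..<m}) (gram_poly (Suc d)) x (diag m \<union> J)"
      by (intro poly_indep_imp_jac_surj[OF _ fin gram]) simp_all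
    then obtain x where hx: "peval x ?h \<noteq> 0"
      and x: "jac_surj ({..<Suc d} \<times> {..<m}) (gram_poly (Suc d)) x (diag m \<union> J)" by blast
    have "x (d, i) \<noteq> 0" if "i < m" for i using hx that by (simp add: peval_prod peval_pvar)
    from jac_surj_imp_poly_indep[OF _ finJ dist jac_surj_sq_distI[OF J x this]]
    show "poly_indep (sq_dist_poly d) J" by simp
  next
    assume "poly_indep (sq_dist_poly d) J"
    then have "\<exists>p. peval p 1 \<noteq> 0 \<and> jac_surj ({..<d} \<times> {..<m}) (sq_dist_poly d) p J"
      by (intro poly_indep_imp_jac_surj[OF _ finJ dist]) simp_all
    then obtain p where "jac_surj ({..<d} \<times> {..<m}) (sq_dist_poly d) p J" by blast
    from jac_surj_imp_poly_indep[OF _ fin gram jac_surj_gramI[OF J this]]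
    show "poly_indep (gram_poly (Suc d) :: _ \<Rightarrow> (nat \<times> nat, real) mpol) (diag m \<union> J)" by simp
  qed
qed

subsection \<open>The polynomial ring as an algebraic structure\<close>

lemma mpol_ring_simps [simp]:
  "carrier (mpol_ring V) = polys V"
  "\<one>\<^bsub>mpol_ring V\<^esub> = 1" "\<zero>\<^bsub>mpol_ring V\<^esub> = 0"
  "p \<otimes>\<^bsub>mpol_ring V\<^esub> q = p * q" "p \<oplus>\<^bsub>mpol_ring V\<^esub> q = p + q"
  by (simp_all add: mpol_ring_def polys_def)

lemma cring_mpol_ring: "cring (mpol_ring V :: ('v, 'c::comm_ring_1) mpol ring)"
proof (rule cringI)
  show "abelian_group (mpol_ring V :: ('v, 'c) mpol ring)"
  proof (rule abelian_groupI)
    fix p :: "('v, 'c) mpol" assume "p \<in> carrier (mpol_ring V)"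
    then show "\<exists>q\<in>carrier (mpol_ring V). q \<oplus>\<^bsub>mpol_ring V\<^esub> p = \<zero>\<^bsub>mpol_ring V\<^esub>"
      by (intro bexI[of _ "- p"]) (auto intro: polys_uminus)
  qed (auto simp: algebra_simps intro: polys_add)
  show "comm_monoid (mpol_ring V :: ('v, 'c) mpol ring)"
    by (rule comm_monoidI) (auto simp: algebra_simps intro: polys_mult)
qed (simp add: algebra_simps)

lemma mpol_ring_nat_pow: "p [^]\<^bsub>mpol_ring V\<^esub> (k::nat) = p ^ k"
  by (induction k) (simp_all add: mult.commute nat_pow_def)

lemma mpol_ring_finsum:
  fixes f :: "'a \<Rightarrow> ('v, 'c::comm_ring_1) mpol"
  assumes "\<And>x. x \<in> A \<Longrightarrow> f x \<in> polys V"
  shows "(\<Oplus>\<^bsub>mpol_ring V\<^esub>x\<in>A. f x) = (\<Sum>x\<in>A. f x)"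
proof -
  interpret cring "mpol_ring V :: ('v, 'c) mpol ring" by (rule cring_mpol_ring)
  show ?thesis using assms
  proof (induction A rule: infinite_finite_induct)
    case (insert x A)
    then show ?case by (subst finsum_insert) auto
  qed (simp_all add: finsum_infinite)
qed

lemma mpol_ring_finprod:
  fixes f :: "'a \<Rightarrow> ('v, 'c::comm_ring_1) mpol"
  assumes "\<And>x. x \<in> A \<Longrightarrow> f x \<in> polys V"
  shows "(\<Otimes>\<^bsub>mpol_ring V\<^esub>x\<in>A. f x) = (\<Prod>x\<in>A. f x)"
proof -
  interpret cring "mpol_ring V :: ('v, 'c) mpol ring" by (rule cring_mpol_ring)
  show ?thesis using assms
  proof (induction A rule: infinite_finite_induct)
    case (insert x A)
    then show ?case by (subst finprod_insert) auto
  qed simp_all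
qed

lemma pconst_eq_0_iff: "pconst c = 0 \<longleftrightarrow> c = 0"
  unfolding pconst_def by (metis lookup_single_eq lookup_zero single_zero)

lemma alg_independent_mpol_ring:
  fixes G :: "'e \<Rightarrow> ('v, 'c::comm_ring_1) mpol"
  assumes G: "\<And>e. e \<in> J \<Longrightarrow> G e \<in> polys V"
  shows "alg_independent (mpol_ring V) (range pconst) G J \<longleftrightarrow> poly_indep G J"
proof -
  have sum: "(\<Oplus>\<^bsub>mpol_ring V\<^esub>\<mu>\<in>M. c \<mu> \<otimes>\<^bsub>mpol_ring V\<^esub>
      (\<Otimes>\<^bsub>mpol_ring V\<^esub>e\<in>keys \<mu>. G e [^]\<^bsub>mpol_ring V\<^esub> lookup \<mu> e))
    = (\<Sum>\<mu>\<in>M. c \<mu> * mon_eval G \<mu>)"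
    if M: "\<And>\<mu>. \<mu> \<in> M \<Longrightarrow> keys \<mu> \<subseteq> J" and c: "c \<in> M \<rightarrow> range pconst"
    for M :: "('e \<Rightarrow>\<^sub>0 nat) set" and c :: "_ \<Rightarrow> ('v, 'c) mpol"
  proof -
    have G': "G e ^ k \<in> polys V" if "\<mu> \<in> M" "e \<in> keys \<mu>" for \<mu> e k
      using M[OF that(1)] that(2) by (intro polys_power G) auto
    have "c \<mu> \<in> polys V" if "\<mu> \<in> M" for \<mu> using c that by (auto simp: Pi_iff dest!: bspec)
    then have "(\<Oplus>\<^bsub>mpol_ring V\<^esub>\<mu>\<in>M. c \<mu> * mon_eval G \<mu>) = (\<Sum>\<mu>\<in>M. c \<mu> * mon_eval G \<mu>)"
      using M by (intro mpol_ring_finsum polys_mult polys_mon_eval G) auto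
    moreover have "(\<Otimes>\<^bsub>mpol_ring V\<^esub>e\<in>keys \<mu>. G e ^ lookup \<mu> e) = mon_eval G \<mu>" if "\<mu> \<in> M" for \<mu>
      unfolding mon_eval_def using that by (intro mpol_ring_finprod G')
    moreover have "(\<Oplus>\<^bsub>mpol_ring V\<^esub>\<mu>\<in>M. c \<mu> * (\<Otimes>\<^bsub>mpol_ring V\<^esub>e\<in>keys \<mu>. G e ^ lookup \<mu> e))
        = (\<Oplus>\<^bsub>mpol_ring V\<^esub>\<mu>\<in>M. c \<mu> * mon_eval G \<mu>)"
    proof (rule abelian_monoid.finsum_cong')
      show "abelian_monoid (mpol_ring V :: ('v, 'c) mpol ring)"
        using cring_mpol_ring by (meson abelian_group.axioms(1) cring.axioms(1) ring.axioms(1))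
      show "(\<lambda>\<mu>. c \<mu> * mon_eval G \<mu>) \<in> M \<rightarrow> carrier (mpol_ring V)"
        using M \<open>\<And>\<mu>. \<mu> \<in> M \<Longrightarrow> c \<mu> \<in> polys V\<close> by (auto intro!: polys_mult polys_mon_eval G)
    qed (simp_all add: calculation)
    ultimately show ?thesis by (simp add: mpol_ring_nat_pow)
  qed
  show ?thesis
  proof
    assume ind: "alg_independent (mpol_ring V) (range pconst) G J"
    show "poly_indep G J"
      unfolding poly_indep_def
    proof (intro ballI impI)
      fix A assume A: "A \<in> polys J" "meval pconst G A = 0"
      let ?c = "\<lambda>\<mu>. pconst (lookup A \<mu>) :: ('v, 'c) mpol"
      have "finite (keys A) \<and> (\<forall>\<mu>\<in>keys A. keys \<mu> \<subseteq> J) \<and> ?c \<in> keys A \<rightarrow> range pconst \<and>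
        (\<Oplus>\<^bsub>mpol_ring V\<^esub>\<mu>\<in>keys A. ?c \<mu> \<otimes>\<^bsub>mpol_ring V\<^esub>
          (\<Otimes>\<^bsub>mpol_ring V\<^esub>e\<in>keys \<mu>. G e [^]\<^bsub>mpol_ring V\<^esub> lookup \<mu> e)) = \<zero>\<^bsub>mpol_ring V\<^esub>"
        using A by (subst sum) (auto simp: polys_def meval_def)
      from mp[OF spec[OF spec[OF ind[unfolded alg_independent_def]]] this]
      have "\<forall>\<mu>\<in>keys A. ?c \<mu> = 0" by simp
      then have "lookup A \<mu> = 0" for \<mu>
        by (cases "\<mu> \<in> keys A") (auto simp: pconst_eq_0_iff in_keys_iff)
      then show "A = 0" by (intro poly_mapping_eqI) simp
    qed
  next
    assume ind: "poly_indep G J"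
    show "alg_independent (mpol_ring V) (range pconst) G J"
      unfolding alg_independent_def
    proof (intro allI impI, elim conjE)
      fix M :: "('e \<Rightarrow>\<^sub>0 nat) set" and c :: "_ \<Rightarrow> ('v, 'c) mpol"
      assume M: "finite M" "\<forall>\<mu>\<in>M. keys \<mu> \<subseteq> J" and c: "c \<in> M \<rightarrow> range pconst"
        and 0: "(\<Oplus>\<^bsub>mpol_ring V\<^esub>\<mu>\<in>M. c \<mu> \<otimes>\<^bsub>mpol_ring V\<^esub>
            (\<Otimes>\<^bsub>mpol_ring V\<^esub>e\<in>keys \<mu>. G e [^]\<^bsub>mpol_ring V\<^esub> lookup \<mu> e)) = \<zero>\<^bsub>mpol_ring V\<^esub>"
      have "\<forall>\<mu>\<in>M. \<exists>a. c \<mu> = pconst a" using c by auto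
      then obtain a where a: "\<forall>\<mu>\<in>M. c \<mu> = pconst (a \<mu>)" by (rule bchoice[THEN exE])
      define A where "A = (\<Sum>\<mu>\<in>M. Poly_Mapping.single \<mu> (a \<mu>))"
      have "A \<in> polys J" unfolding A_def using M by (intro polys_sum polys_single) auto
      moreover have "meval pconst G A = (\<Sum>\<mu>\<in>M. c \<mu> * mon_eval G \<mu>)"
        unfolding A_def comm_ring_hom.meval_sum[OF comm_ring_hom_pconst]
          comm_ring_hom.meval_single[OF comm_ring_hom_pconst]
        by (rule sum.cong) (simp_all add: a)
      moreover have "(\<Sum>\<mu>\<in>M. c \<mu> * mon_eval G \<mu>) = 0" using 0 sum[of M c] M c by simp
      ultimately have "A = 0" using ind by (simp add: poly_indep_def)
      moreover have "lookup A \<mu> = a \<mu>" if "\<mu> \<in> M" for \<mu>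
        using that M(1) by (simp add: A_def lookup_sum lookup_single when_def)
      ultimately show "\<forall>\<mu>\<in>M. c \<mu> = \<zero>\<^bsub>mpol_ring V\<^esub>"
        using a by (auto simp: pconst_eq_0_iff)
    qed
  qed
qed

subsection \<open>Prime ideals\<close>

text \<open>Ideals of a whole type, so that Zorn's lemma and determinants over type classes apply
  without carriers. Ideals of a polynomial ring in a given set of variables are pulled back to the
  type along \<open>retract\<close>.\<close>

definition ring_ideal :: "'r::comm_ring_1 set \<Rightarrow> bool" where
  "ring_ideal I \<longleftrightarrow> 0 \<in> I \<and> (\<forall>a\<in>I. \<forall>b\<in>I. a + b \<in> I) \<and> (\<forall>a\<in>I. \<forall>r. r * a \<in> I)"

definition ring_prime :: "'r::comm_ring_1 set \<Rightarrow> bool" where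
  "ring_prime Q \<longleftrightarrow> ring_ideal Q \<and> 1 \<notin> Q \<and> (\<forall>a b. a * b \<in> Q \<longrightarrow> a \<in> Q \<or> b \<in> Q)"

lemma ring_idealD:
  assumes "ring_ideal I"
  shows "0 \<in> I" "a \<in> I \<Longrightarrow> b \<in> I \<Longrightarrow> a + b \<in> I" "a \<in> I \<Longrightarrow> r * a \<in> I" "a \<in> I \<Longrightarrow> a * r \<in> I"
    "a \<in> I \<Longrightarrow> - a \<in> I" "a \<in> I \<Longrightarrow> b \<in> I \<Longrightarrow> a - b \<in> I"
proof -
  show 0: "0 \<in> I" and add: "a \<in> I \<Longrightarrow> b \<in> I \<Longrightarrow> a + b \<in> I"
    and mult: "a \<in> I \<Longrightarrow> r * a \<in> I" for a b r
    using assms by (auto simp: ring_ideal_def)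
  show "a \<in> I \<Longrightarrow> a * r \<in> I" using mult[of a r] by (simp add: mult.commute)
  show neg: "a \<in> I \<Longrightarrow> - a \<in> I" for a using mult[of a "- 1"] by simp
  show "a \<in> I \<Longrightarrow> b \<in> I \<Longrightarrow> a - b \<in> I" using add[of a "- b"] neg[of b] by simp
qed

lemma ring_ideal_sum: "ring_ideal I \<Longrightarrow> (\<And>x. x \<in> A \<Longrightarrow> f x \<in> I) \<Longrightarrow> sum f A \<in> I"
  by (induction A rule: infinite_finite_induct) (auto intro: ring_idealD)

lemma ring_ideal_Union_chain:
  assumes "C \<noteq> {}" "subset.chain {K. ring_ideal K} C"
  shows "ring_ideal (\<Union>C)"
proof -
  have C: "ring_ideal K" if "K \<in> C" for K using assms(2) that by (auto simp: subset.chain_def)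
  have add: "a + b \<in> \<Union>C" if KL: "a \<in> K" "b \<in> L" "K \<in> C" "L \<in> C" for a b K L
  proof -
    have "K \<subseteq> L \<or> L \<subseteq> K" using assms(2) KL by (auto simp: subset.chain_def)
    then obtain M where "M \<in> C" "a \<in> M" "b \<in> M" using KL by blast
    then show ?thesis using ring_idealD(2)[OF C] by blast
  qed
  show ?thesis
    unfolding ring_ideal_def
  proof (intro conjI ballI allI)
    obtain K where "K \<in> C" using assms(1) by blast
    then show "0 \<in> \<Union>C" using ring_idealD(1)[OF C] by blast
  next
    fix a r assume "a \<in> \<Union>C"
    then obtain K where "K \<in> C" "a \<in> K" by blast
    then show "r * a \<in> \<Union>C" using ring_idealD(3)[OF C] by blast
  qed (use add in blast)
qed

text \<open>An ideal that is maximal among those containing \<open>I\<close> but no power of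
  \<open>f\<close> is prime.\<close>

lemma ex_prime_avoiding:
  fixes f :: "'r::comm_ring_1"
  assumes I: "ring_ideal I" and f: "\<And>k. f ^ k \<notin> I"
  shows "\<exists>Q. ring_prime Q \<and> I \<subseteq> Q \<and> f \<notin> Q"
proof -
  define S where "S = {K. ring_ideal K \<and> I \<subseteq> K \<and> (\<forall>k. f ^ k \<notin> K)}"
  have "\<exists>M\<in>S. \<forall>X\<in>S. M \<subseteq> X \<longrightarrow> X = M"
  proof (rule subset_Zorn_nonempty)
    show "S \<noteq> {}" using I f by (auto simp: S_def)
    fix C assume C: "C \<noteq> {}" "subset.chain S C"
    then have "subset.chain {K. ring_ideal K} C" by (auto simp: subset.chain_def S_def)
    with C(1) have "ring_ideal (\<Union>C)" by (rule ring_ideal_Union_chain)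
    moreover have "C \<subseteq> S" using C(2) by (auto simp: subset.chain_def)
    ultimately show "\<Union>C \<in> S" using C(1) unfolding S_def by blast
  qed
  then obtain Q where Q: "Q \<in> S" and max: "\<And>X. X \<in> S \<Longrightarrow> Q \<subseteq> X \<Longrightarrow> X = Q" by blast
  have idQ: "ring_ideal Q" and IQ: "I \<subseteq> Q" and fQ: "f ^ k \<notin> Q" for k using Q by (auto simp: S_def)
  \<comment> \<open>By maximality, adjoining an outside element \<open>a\<close> to \<open>Q\<close>
    brings in a power of \<open>f\<close>. If \<open>a * b\<close> lay in \<open>Q\<close> for two
    outside elements, the product of the two powers would lie in \<open>Q\<close> as well.\<close>
  have ext: "\<exists>k q r. q \<in> Q \<and> f ^ k = q + r * a" if a: "a \<notin> Q" for a
  proof (rule ccontr)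
    assume neg: "\<nexists>k q r. q \<in> Q \<and> f ^ k = q + r * a"
    let ?X = "{q + r * a | q r. q \<in> Q}"
    have "ring_ideal ?X"
      unfolding ring_ideal_def
    proof (intro conjI ballI allI)
      show "0 \<in> ?X" using ring_idealD(1)[OF idQ] by (intro CollectI exI[of _ 0]) simp
    next
      fix x y assume "x \<in> ?X" "y \<in> ?X"
      then obtain q r q' r' where "x = q + r * a" "y = q' + r' * a" "q \<in> Q" "q' \<in> Q" by blast
      then show "x + y \<in> ?X" using ring_idealD(2)[OF idQ]
        by (intro CollectI exI[of _ "q + q'"] exI[of _ "r + r'"]) (simp add: algebra_simps)
    next
      fix x s assume "x \<in> ?X"
      then obtain q r where "x = q + r * a" "q \<in> Q" by blast
      then show "s * x \<in> ?X" using ring_idealD(3)[OF idQ]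
        by (intro CollectI exI[of _ "s * q"] exI[of _ "s * r"]) (simp add: algebra_simps)
    qed
    moreover have sub: "Q \<subseteq> ?X"
    proof
      fix q assume "q \<in> Q"
      then show "q \<in> ?X" by (intro CollectI exI[of _ q] exI[of _ 0]) simp
    qed
    ultimately have "?X \<in> S" using neg IQ unfolding S_def by blast
    then have "?X = Q" using sub by (rule max)
    moreover have "a \<in> ?X" using ring_idealD(1)[OF idQ] by (intro CollectI exI[of _ 0] exI[of _ 1]) simp
    ultimately show False using a by simp
  qed
  have "a \<in> Q \<or> b \<in> Q" if ab: "a * b \<in> Q" for a b
  proof (rule ccontr)
    assume "\<not> (a \<in> Q \<or> b \<in> Q)"
    then obtain k q r k' q' r' where *: "q \<in> Q" "f ^ k = q + r * a" "q' \<in> Q" "f ^ k' = q' + r' * b"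
      using ext[of a] ext[of b] by blast
    have "f ^ (k + k') = q * (q' + r' * b) + (r * a) * q' + (r * r') * (a * b)"
      unfolding power_add *(2,4) by (simp add: algebra_simps)
    also have "\<dots> \<in> Q"
      by (rule ring_idealD(2)[OF idQ ring_idealD(2)[OF idQ]])
        (rule ring_idealD(3)[OF idQ] ring_idealD(4)[OF idQ], rule * ab)+
    finally show False using fQ by blast
  qed
  moreover have "1 \<notin> Q" using fQ[of 0] by simp
  moreover have "f \<notin> Q" using fQ[of 1] by simp
  ultimately show ?thesis using idQ IQ unfolding ring_prime_def by blast
qed

lemma prod_diff_in_ideal:
  assumes "ring_ideal Q" "\<And>v. v \<in> E \<Longrightarrow> a v - b v \<in> Q"
  shows "prod a E - prod b E \<in> Q"
  using assms(2)
proof (induction E rule: infinite_finite_induct)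
  case (insert x E)
  have "prod a (insert x E) - prod b (insert x E) = a x * (prod a E - prod b E) + (a x - b x) * prod b E"
    using insert.hyps by (simp add: algebra_simps)
  also have "\<dots> \<in> Q"
    using insert.IH insert.prems
    by (intro ring_idealD(2)[OF assms(1) ring_idealD(3)[OF assms(1)] ring_idealD(4)[OF assms(1)]]) auto
  finally show ?case .
qed (use ring_idealD(1)[OF assms(1)] in auto)

lemma power_diff_in_ideal:
  assumes "ring_ideal Q" "a - b \<in> Q"
  shows "a ^ k - b ^ k \<in> Q"
  using prod_diff_in_ideal[OF assms(1), of "{..<k}" "\<lambda>_. a" "\<lambda>_. b"] assms(2) by simp

lemma mon_eval_diff_in_ideal:
  assumes "ring_ideal Q" "\<And>v. v \<in> keys \<mu> \<Longrightarrow> a v - b v \<in> Q"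
  shows "mon_eval a \<mu> - mon_eval b \<mu> \<in> Q"
  unfolding mon_eval_def using assms by (intro prod_diff_in_ideal power_diff_in_ideal)

subsection \<open>Schur complements\<close>

text \<open>Rows and columns are listed by functions, in any order and with repetitions, so that
  bordering a minor by further rows and columns is mere concatenation.\<close>

definition minor :: "(nat \<Rightarrow> nat \<Rightarrow> 'r::comm_ring_1) \<Rightarrow> nat \<Rightarrow> (nat \<Rightarrow> nat) \<Rightarrow> (nat \<Rightarrow> nat) \<Rightarrow> 'r" where
  "minor S k \<alpha> \<beta> = det (mat k k (\<lambda>(a, b). S (\<alpha> a) (\<beta> b)))"

definition adj_entry :: "(nat \<Rightarrow> nat \<Rightarrow> 'r::comm_ring_1) \<Rightarrow> nat \<Rightarrow> (nat \<Rightarrow> nat) \<Rightarrow> nat \<Rightarrow> nat \<Rightarrow> 'r" where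
  "adj_entry S r \<alpha> a b = adj_mat (mat r r (\<lambda>(a, b). S (\<alpha> a) (\<alpha> b))) $$ (a, b)"

text \<open>The Schur complement of the principal block on \<open>\<alpha>\<close>, multiplied by
  the determinant of that block: the adjugate takes the place of the inverse, and no division
  occurs.\<close>

definition schur_entry :: "(nat \<Rightarrow> nat \<Rightarrow> 'r::comm_ring_1) \<Rightarrow> nat \<Rightarrow> (nat \<Rightarrow> nat) \<Rightarrow> nat \<Rightarrow> nat \<Rightarrow> 'r" where
  "schur_entry S r \<alpha> i j = minor S r \<alpha> \<alpha> * S i j
     - (\<Sum>a<r. \<Sum>b<r. S i (\<alpha> a) * adj_entry S r \<alpha> a b * S (\<alpha> b) j)"

lemma index_mult_mat_sum:
  assumes "A \<in> carrier_mat n k" "B \<in> carrier_mat k m" "i < n" "j < m"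
  shows "(A * B) $$ (i, j) = (\<Sum>a<k. A $$ (i, a) * B $$ (a, j))"
  using assms by (simp add: scalar_prod_def atLeast0LessThan)

text \<open>The block matrix \<open>[[A, B], [C, D]]\<close> times
  \<open>[[1, - adj A * B], [0, det A]]\<close> is \<open>[[A, 0], [C, E]]\<close>, where
  \<open>E\<close> consists of Schur entries. The claim compares determinants.\<close>

lemma minor_schur:
  fixes S :: "nat \<Rightarrow> nat \<Rightarrow> 'r::idom"
  shows "minor S (r + k) (\<lambda>a. if a < r then \<alpha> a else \<beta> (a - r)) (\<lambda>a. if a < r then \<alpha> a else \<gamma> (a - r))
      * minor S r \<alpha> \<alpha> ^ k = minor S r \<alpha> \<alpha> * minor (schur_entry S r \<alpha>) k \<beta> \<gamma>"
proof -
  define A where "A = mat r r (\<lambda>(a, b). S (\<alpha> a) (\<alpha> b))"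
  define B where "B = mat r k (\<lambda>(a, b). S (\<alpha> a) (\<gamma> b))"
  define C where "C = mat k r (\<lambda>(a, b). S (\<beta> a) (\<alpha> b))"
  define D where "D = mat k k (\<lambda>(a, b). S (\<beta> a) (\<gamma> b))"
  define E where "E = mat k k (\<lambda>(a, b). schur_entry S r \<alpha> (\<beta> a) (\<gamma> b))"
  have carr: "A \<in> carrier_mat r r" "B \<in> carrier_mat r k" "C \<in> carrier_mat k r" "D \<in> carrier_mat k k"
    "E \<in> carrier_mat k k" by (auto simp: A_def B_def C_def D_def E_def)
  note adj = adj_mat[OF carr(1)]
  have adjB: "adj_mat A * B \<in> carrier_mat r k" using adj(1) carr(2) by simp
  let ?M = "four_block_mat A B C D"
  let ?N = "four_block_mat (1\<^sub>m r) (- (adj_mat A * B)) (0\<^sub>m k r) (det A \<cdot>\<^sub>m 1\<^sub>m k)"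
  have M: "?M \<in> carrier_mat (r + k) (r + k)" and N: "?N \<in> carrier_mat (r + k) (r + k)"
    using carr by auto
  have upper: "A * - (adj_mat A * B) + B * (det A \<cdot>\<^sub>m 1\<^sub>m k) = 0\<^sub>m r k"
  proof -
    have "A * (adj_mat A * B) = (A * adj_mat A) * B"
      using carr adj(1) by (simp add: assoc_mult_mat[of A r r "adj_mat A" r B k])
    also have "\<dots> = det A \<cdot>\<^sub>m B"
      unfolding adj(2) using carr by (simp add: mult_smult_assoc_mat[of _ r r])
    finally have "A * (adj_mat A * B) = det A \<cdot>\<^sub>m B" .
    moreover have "B * (det A \<cdot>\<^sub>m 1\<^sub>m k) = det A \<cdot>\<^sub>m B"
      using carr by (subst mult_smult_distrib[of _ r k _ k]) auto
    moreover have "A * - (adj_mat A * B) = - (A * (adj_mat A * B))"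
      by (rule uminus_mult_right_mat) (use carr adj(1) in simp)
    ultimately have "A * - (adj_mat A * B) + B * (det A \<cdot>\<^sub>m 1\<^sub>m k) = - (det A \<cdot>\<^sub>m B) + det A \<cdot>\<^sub>m B"
      by (simp only:)
    also have "\<dots> = 0\<^sub>m r k" by (rule uminus_l_inv_mat) (use carr in simp)
    finally show ?thesis .
  qed
  have lower: "C * - (adj_mat A * B) + D * (det A \<cdot>\<^sub>m 1\<^sub>m k) = E"
  proof (rule eq_matI)
    fix i j assume "i < dim_row E" "j < dim_col E"
    then have ij: "i < k" "j < k" using carr(5) by auto
    have CB: "(C * - (adj_mat A * B)) $$ (i, j) = - (C * (adj_mat A * B)) $$ (i, j)"
      using carr adj(1) ij by (subst uminus_mult_right_mat) simp_all
    have "(C * (adj_mat A * B)) $$ (i, j) = (\<Sum>a<r. C $$ (i, a) * (adj_mat A * B) $$ (a, j))"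
      by (rule index_mult_mat_sum[OF carr(3) adjB ij])
    also have "\<dots> = (\<Sum>a<r. C $$ (i, a) * (\<Sum>b<r. adj_mat A $$ (a, b) * B $$ (b, j)))"
      using index_mult_mat_sum[OF adj(1) carr(2) _ ij(2)] by (intro sum.cong) simp_all
    also have "\<dots> = (\<Sum>a<r. \<Sum>b<r. S (\<beta> i) (\<alpha> a) * adj_entry S r \<alpha> a b * S (\<alpha> b) (\<gamma> j))"
      using ij by (simp add: C_def B_def A_def[symmetric] adj_entry_def sum_distrib_left mult.assoc)
    finally have "(C * (adj_mat A * B)) $$ (i, j)
        = (\<Sum>a<r. \<Sum>b<r. S (\<beta> i) (\<alpha> a) * adj_entry S r \<alpha> a b * S (\<alpha> b) (\<gamma> j))" .
    moreover have "(D * (det A \<cdot>\<^sub>m 1\<^sub>m k)) $$ (i, j) = det A * S (\<beta> i) (\<gamma> j)"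
    proof -
      have "D * (det A \<cdot>\<^sub>m 1\<^sub>m k) = det A \<cdot>\<^sub>m D"
        using carr by (subst mult_smult_distrib[of _ k k _ k]) auto
      then show ?thesis using ij by (simp add: D_def)
    qed
    ultimately show "(C * - (adj_mat A * B) + D * (det A \<cdot>\<^sub>m 1\<^sub>m k)) $$ (i, j) = E $$ (i, j)"
      using ij carr adjB CB by (simp add: E_def schur_entry_def minor_def A_def[symmetric])
  qed (use carr in auto)
  have "?M * ?N = four_block_mat (A * 1\<^sub>m r + B * 0\<^sub>m k r) (A * - (adj_mat A * B) + B * (det A \<cdot>\<^sub>m 1\<^sub>m k))
      (C * 1\<^sub>m r + D * 0\<^sub>m k r) (C * - (adj_mat A * B) + D * (det A \<cdot>\<^sub>m 1\<^sub>m k))"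
    by (rule mult_four_block_mat[where ?nr1.0 = r and ?n1.0 = r and ?n2.0 = k and ?nr2.0 = k and ?nc1.0 = r and ?nc2.0 = k])
      (use carr adjB in auto)
  moreover have "A * 1\<^sub>m r + B * 0\<^sub>m k r = A" "C * 1\<^sub>m r + D * 0\<^sub>m k r = C" using carr by simp_all
  ultimately have "?M * ?N = four_block_mat A (0\<^sub>m r k) C E" unfolding upper lower by simp
  then have "det ?M * det ?N = det A * det E"
    using det_mult[OF M N] det_four_block_mat_upper_right_zero[OF carr(1) refl carr(3,5)] by simp
  moreover have "det ?N = det A ^ k"
    by (subst det_four_block_mat_lower_left_zero[of _ r _ k]) (use adjB in auto)
  moreover have "?M = mat (r + k) (r + k) (\<lambda>(a, b). S (if a < r then \<alpha> a else \<beta> (a - r))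
      (if b < r then \<alpha> b else \<gamma> (b - r)))"
    by (rule eq_matI) (auto simp: A_def B_def C_def D_def)
  ultimately show ?thesis by (simp add: minor_def A_def E_def)
qed

lemma adj_entry_sym:
  assumes "\<And>i j. S i j = S j i" "a < r" "b < r"
  shows "adj_entry S r \<alpha> a b = adj_entry S r \<alpha> b a"
proof -
  let ?A = "mat r r (\<lambda>(a, b). S (\<alpha> a) (\<alpha> b))"
  have "det (mat_delete ?A b a) = det (mat_delete ?A a b)"
  proof -
    have "mat_delete ?A b a = transpose_mat (mat_delete ?A a b)"
      by (rule eq_matI) (use assms in \<open>auto simp: mat_delete_def\<close>)
    then show ?thesis
      using det_transpose[OF mat_delete_carrier[of ?A r r]] by simp
  qed
  then show ?thesis using assms by (simp add: adj_entry_def adj_mat_def cofactor_def add.commute)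
qed

lemma schur_entry_sym:
  assumes "\<And>i j. S i j = S j i"
  shows "schur_entry S r \<alpha> i j = schur_entry S r \<alpha> j i"
proof -
  have "(\<Sum>a<r. \<Sum>b<r. S i (\<alpha> a) * adj_entry S r \<alpha> a b * S (\<alpha> b) j)
      = (\<Sum>b<r. \<Sum>a<r. S i (\<alpha> a) * adj_entry S r \<alpha> a b * S (\<alpha> b) j)" by (rule sum.swap)
  also have "\<dots> = (\<Sum>b<r. \<Sum>a<r. S j (\<alpha> b) * adj_entry S r \<alpha> b a * S (\<alpha> a) i)"
  proof (intro sum.cong refl)
    fix a b assume "b \<in> {..<r}" "a \<in> {..<r}"
    then have "adj_entry S r \<alpha> a b = adj_entry S r \<alpha> b a" using assms by (intro adj_entry_sym) auto
    then show "S i (\<alpha> a) * adj_entry S r \<alpha> a b * S (\<alpha> b) j = S j (\<alpha> b) * adj_entry S r \<alpha> b a * S (\<alpha> a) i"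
      using assms[of i "\<alpha> a"] assms[of "\<alpha> b" j] by (simp add: mult_ac)
  qed
  finally show ?thesis using assms[of i j] by (simp add: schur_entry_def)
qed

lemma minor_1: "minor S 1 \<alpha> \<beta> = S (\<alpha> 0) (\<beta> 0)"
  unfolding minor_def by (subst det_single) auto

lemma minor_2: "minor S 2 \<alpha> \<beta> = S (\<alpha> 0) (\<beta> 0) * S (\<alpha> 1) (\<beta> 1) - S (\<alpha> 0) (\<beta> 1) * S (\<alpha> 1) (\<beta> 0)"
proof -
  let ?A = "mat 2 2 (\<lambda>(a, b). S (\<alpha> a) (\<beta> b))"
  have "det (mat_delete ?A 0 0) = S (\<alpha> 1) (\<beta> 1)" "det (mat_delete ?A 0 1) = S (\<alpha> 1) (\<beta> 0)"
    by (subst det_single; auto simp: mat_delete_def)+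
  moreover have "det ?A = (\<Sum>j<2. ?A $$ (0, j) * cofactor ?A 0 j)"
    by (rule laplace_expansion_row) auto
  ultimately show ?thesis
    by (simp add: minor_def cofactor_def numeral_2_eq_2 lessThan_Suc)
qed

text \<open>A largest principal minor of size at most \<open>n\<close> outside \<open>Q\<close> has vanishing Schur complement modulo
  \<open>Q\<close>: its diagonal entries and its principal \<open>2 \<times> 2\<close> minors are, up to factors outside
  \<open>Q\<close>, larger principal minors.\<close>

lemma symmetric_rank_factorization:
  fixes S :: "nat \<Rightarrow> nat \<Rightarrow> 'r::idom"
  assumes Q: "ring_prime Q" and sym: "\<And>i j. S i j = S j i"
    and minors: "\<And>\<alpha> \<beta>. (\<And>a. a < n + 1 \<Longrightarrow> \<alpha> a < m \<and> \<beta> a < m) \<Longrightarrow> minor S (n + 1) \<alpha> \<beta> \<in> Q"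
  shows "\<exists>r \<alpha>. r \<le> n \<and> minor S r \<alpha> \<alpha> \<notin> Q \<and> (\<forall>i<m. \<forall>j<m. schur_entry S r \<alpha> i j \<in> Q)"
proof -
  have prime: "a \<in> Q \<or> b \<in> Q" if "a * b \<in> Q" for a b
    using Q that by (auto simp: ring_prime_def)
  have idQ: "ring_ideal Q" using Q by (auto simp: ring_prime_def)
  let ?P = "\<lambda>r. r \<le> n \<and> (\<exists>\<alpha>. (\<forall>a<r. \<alpha> a < m) \<and> minor S r \<alpha> \<alpha> \<notin> Q)"
  have "minor S 0 id id = 1" by (simp add: minor_def)
  then have "?P 0" using Q by (auto simp: ring_prime_def intro!: exI[of _ id])
  define r where "r = (GREATEST r. ?P r)"
  have Pr: "?P r" unfolding r_def by (rule GreatestI_nat[of ?P 0 n]) (use \<open>?P 0\<close> in auto)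
  have max: "r' \<le> r" if "?P r'" for r' unfolding r_def by (rule Greatest_le_nat[of ?P _ n]) (use that in auto)
  obtain \<alpha> where \<alpha>: "\<And>a. a < r \<Longrightarrow> \<alpha> a < m" "minor S r \<alpha> \<alpha> \<notin> Q" using Pr by blast
  have larger: "minor S r' \<beta> \<beta> \<in> Q" if "r < r'" "r' \<le> n + 1" "\<And>a. a < r' \<Longrightarrow> \<beta> a < m" for r' \<beta>
  proof (cases "r' = n + 1")
    case True
    then show ?thesis using minors[of \<beta> \<beta>] that by blast
  next
    case False
    then have "r' \<le> n" using that(2) by simp
    moreover have "\<not> ?P r'"
    proof
      assume "?P r'"
      from max[OF this] show False using that(1) by simp
    qed
    ultimately show ?thesis using that(3) by blast
  qed
  have schur_minor: "minor (schur_entry S r \<alpha>) k \<beta> \<gamma> \<in> Q"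
    if "minor S (r + k) (\<lambda>a. if a < r then \<alpha> a else \<beta> (a - r)) (\<lambda>a. if a < r then \<alpha> a else \<gamma> (a - r)) \<in> Q"
    for k \<beta> \<gamma>
  proof -
    have "minor S r \<alpha> \<alpha> * minor (schur_entry S r \<alpha>) k \<beta> \<gamma> \<in> Q"
      unfolding minor_schur[symmetric] using that by (intro ring_idealD(4)[OF idQ])
    then show ?thesis using prime \<alpha>(2) by blast
  qed
  have principal: "minor (schur_entry S r \<alpha>) k \<beta> \<beta> \<in> Q"
    if "0 < k" "r + k \<le> n + 1" "\<And>a. a < k \<Longrightarrow> \<beta> a < m" for k \<beta>
    by (rule schur_minor, rule larger) (use that \<alpha>(1) in auto)
  have "schur_entry S r \<alpha> i j \<in> Q" if ij: "i < m" "j < m" for i j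
  \<comment> \<open>For \<open>r = n\<close> an entry of the Schur complement comes from an
    arbitrary minor of size \<open>n + 1\<close>, and all of these lie in \<open>Q\<close>. For
    smaller \<open>r\<close> only principal minors are controlled, but
    \<open>r + 2 \<le> n + 1\<close> admits the 2 by 2 ones; together with the diagonal entries and
    symmetry they put the square of each entry into \<open>Q\<close>.\<close>
  proof (cases "r = n")
    case True
    have "minor (schur_entry S r \<alpha>) 1 (\<lambda>_. i) (\<lambda>_. j) \<in> Q"
      by (rule schur_minor) (use minors \<alpha>(1) ij in \<open>simp add: True\<close>)
    then show ?thesis unfolding minor_1 .
  next
    case False
    then have r: "r + 2 \<le> n + 1" using Pr by simp
    let ?E = "schur_entry S r \<alpha>" and ?\<beta> = "\<lambda>a::nat. if a = 0 then i else j"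
    have "minor ?E 1 (\<lambda>_. i) (\<lambda>_. i) \<in> Q" by (rule principal) (use r ij in auto)
    then have "?E i i \<in> Q" unfolding minor_1 .
    moreover have "minor ?E 2 ?\<beta> ?\<beta> \<in> Q" by (rule principal) (use r ij in auto)
    then have "?E i i * ?E j j - ?E i j * ?E j i \<in> Q" by (simp add: minor_2)
    ultimately have "?E i i * ?E j j - (?E i i * ?E j j - ?E i j * ?E j i) \<in> Q"
      by (rule ring_idealD(6)[OF idQ ring_idealD(4)[OF idQ]])
    then have "?E i j * ?E i j \<in> Q" by (simp add: schur_entry_sym[where i = j and j = i, OF sym])
    then show ?thesis using prime by blast
  qed
  then show ?thesis using Pr \<alpha>(2) by blast
qed

subsection \<open>Polynomials vanishing on Gram matrices\<close>

text \<open>Induction on the support of \<open>B\<close>. A nonzero diagonal entry is split off by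
  completing the square. If the diagonal is 0, a nonzero entry \<open>B i j\<close> splits off a
  hyperbolic plane, which over the complex numbers is a sum of two squares.\<close>

lemma symmetric_sum_of_squares:
  fixes B :: "'i \<Rightarrow> 'i \<Rightarrow> complex"
  assumes "finite A" "\<And>k l. B k l = B l k" "\<And>k l. k \<notin> A \<Longrightarrow> B k l = 0"
  shows "\<exists>z. \<forall>k l. B k l = (\<Sum>t<card A. z t k * z t l)"
  using assms
proof (induction "card A" arbitrary: A B rule: less_induct)
  case less
  note sym = less.prems(2) and supp = less.prems(3)
  consider "\<forall>k l. B k l = 0" | i where "B i i \<noteq> 0"
    | i j where "\<forall>i. B i i = 0" "B i j \<noteq> 0" by blast
  then show ?case
  proof cases
    case 1
    then show ?thesis by (intro exI[of _ "\<lambda>_ _. 0"]) simp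
  next
    case (2 i)
    then have i: "i \<in> A" using supp by blast
    let ?A = "A - {i}" and ?B = "\<lambda>k l. B k l - B k i * B l i / B i i"
    have card: "card A = Suc (card ?A)" using card_Suc_Diff1[OF less.prems(1) i] ..
    have "\<exists>z. \<forall>k l. ?B k l = (\<Sum>t<card ?A. z t k * z t l)"
    proof (rule less.hyps)
      fix k l assume "k \<notin> ?A"
      then show "?B k l = 0" using supp[of k] 2 sym[of i l] by (cases "k = i") auto
    next
      show "?B k l = ?B l k" for k l using sym[of k l] by simp
    qed (use card less.prems in auto)
    then obtain z where z: "\<And>k l. ?B k l = (\<Sum>t<card ?A. z t k * z t l)" by blast
    define z' where "z' t k = (if t < card ?A then z t k else B k i / csqrt (B i i))" for t k
    have "B k l = (\<Sum>t<card A. z' t k * z' t l)" for k l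
    proof -
      have "(\<Sum>t<card A. z' t k * z' t l)
          = (\<Sum>t<card ?A. z t k * z t l) + B k i * B l i / (csqrt (B i i) * csqrt (B i i))"
        unfolding card by (simp add: z'_def)
      also have "\<dots> = B k l"
        unfolding z[symmetric] by (simp flip: power2_eq_square)
      finally show ?thesis by simp
    qed
    then show ?thesis by blast
  next
    case (3 i j)
    then have ij: "i \<in> A" "j \<in> A" "i \<noteq> j" using supp[of i j] supp[of j i] sym[of i j] by auto
    \<comment> \<open>As \<open>B i i\<close> and \<open>B j j\<close> are 0, this correction clears
      the rows and columns of \<open>i\<close> and \<open>j\<close> at the same time.\<close>
    let ?A = "A - {i, j}" and ?B = "\<lambda>k l. B k l - (B k i * B l j + B k j * B l i) / B i j"
    have card: "card A = Suc (Suc (card ?A))"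
      using card_Suc_Diff1[OF less.prems(1) ij(1)] card_Suc_Diff1[of "A - {i}" j] ij less.prems(1)
      by (simp add: Diff_insert2[of A i "{j}"])
    have "\<exists>z. \<forall>k l. ?B k l = (\<Sum>t<card ?A. z t k * z t l)"
    proof (rule less.hyps)
      fix k l assume "k \<notin> ?A"
      then consider "k \<notin> A" | "k = i" | "k = j" by blast
      then show "?B k l = 0"
        by cases (use supp[of k] 3 sym[of i l] sym[of j l] sym[of j i] in auto)
    next
      show "?B k l = ?B l k" for k l using sym[of k l] by (simp add: algebra_simps)
    qed (use card less.prems in auto)
    then obtain z where z: "\<And>k l. ?B k l = (\<Sum>t<card ?A. z t k * z t l)" by blast
    define c where "c = csqrt (2 * B i j)"
    have c: "c * c = 2 * B i j" unfolding c_def by (simp flip: power2_eq_square)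
    \<comment> \<open>This comes from \<open>(u + v) * (u' + v') - (u - v) * (u' - v') = 2 * (u * v'
      + v * u')\<close>. The factor \<open>\<i>\<close> absorbs the minus sign and \<open>c\<close>
      the denominator \<open>2 * B i j\<close>.\<close>
    define z' where "z' t k = (if t < card ?A then z t k else if t = card ?A then (B k i + B k j) / c
        else \<i> * (B k i - B k j) / c)" for t k
    have "B k l = (\<Sum>t<card A. z' t k * z' t l)" for k l
    proof -
      have "(\<i> * u) * (\<i> * v) = - (u * v)" for u v :: complex
        by (metis complex_i_mult_minus mult.assoc mult.left_commute)
      then have "(\<Sum>t<card A. z' t k * z' t l) = (\<Sum>t<card ?A. z t k * z t l)
          + (B k i + B k j) * (B l i + B l j) / (c * c) + - ((B k i - B k j) * (B l i - B l j)) / (c * c)"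
        unfolding card by (simp add: z'_def times_divide_times_eq)
      also have "\<dots> = ?B k l + ((B k i + B k j) * (B l i + B l j) - (B k i - B k j) * (B l i - B l j)) / (2 * B i j)"
        unfolding z[symmetric] c by (simp add: diff_divide_distrib)
      also have "(B k i + B k j) * (B l i + B l j) - (B k i - B k j) * (B l i - B l j)
          = 2 * (B k i * B l j + B k j * B l i)" by (simp add: algebra_simps)
      also have "?B k l + \<dots> / (2 * B i j) = B k l" by (simp add: mult_divide_mult_cancel_left del: distrib_left_numeral)
      finally show ?thesis by simp
    qed
    then show ?thesis by blast
  qed
qed

lemma mon_eval_scale: "mon_eval (\<lambda>e. s * g e) \<mu> = s ^ tdeg \<mu> * mon_eval g \<mu>"
  by (simp add: mon_eval_def tdeg_def power_mult_distrib prod.distrib power_sum)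

definition gram_vanishing :: "nat \<Rightarrow> (nat \<times> nat, complex) mpol \<Rightarrow> bool" where
  "gram_vanishing n f \<longleftrightarrow> (\<forall>x. peval (\<lambda>e. peval x (gram_poly n e)) f = 0)"

text \<open>Over the complex numbers every symmetric \<open>r \<times> r\<close> matrix \<open>B\<close> with \<open>r \<le> n\<close> is a Gram matrix of
  vectors in dimension \<open>n\<close>, so \<open>f\<close> vanishes at \<open>c\<^sup>-\<^sup>1 Y\<^sup>T B Y\<close>. Clearing denominators gives a polynomial
  identity, which holds in every commutative \<open>\<complex>\<close>-algebra.\<close>

lemma gram_vanishing_homogenized:
  fixes h :: "complex \<Rightarrow> 'r::comm_ring_1" and Y B :: "nat \<Rightarrow> nat \<Rightarrow> 'r"
  assumes f: "gram_vanishing n f" and r: "r \<le> n" and N: "\<And>\<mu>. \<mu> \<in> keys f \<Longrightarrow> tdeg \<mu> \<le> N"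
    and h: "comm_ring_hom h" and sym: "\<And>a b. a < r \<Longrightarrow> b < r \<Longrightarrow> B a b = B b a"
  shows "(\<Sum>\<mu>\<in>keys f. h (lookup f \<mu>) * c ^ (N - tdeg \<mu>)
    * mon_eval (\<lambda>(i, j). \<Sum>a<r. \<Sum>b<r. Y a i * B a b * Y b j) \<mu>) = 0"
proof -
  \<comment> \<open>The tags 0, 1 and 2 separate the variables for \<open>c\<close>,
    \<open>Y\<close> and \<open>B\<close>; ordering the indices by \<open>min\<close> and
    \<open>max\<close> makes the generic \<open>B\<close> symmetric.\<close>
  let ?c = "(0::nat, 0::nat, 0::nat)" and ?Y = "\<lambda>a i. (1::nat, a::nat, i::nat)"
    and ?B = "\<lambda>a b. (2::nat, min a b :: nat, max a b :: nat)"
  define g :: "nat \<times> nat \<Rightarrow> (nat \<times> nat \<times> nat, complex) mpol" where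
    "g = (\<lambda>(i, j). \<Sum>a<r. \<Sum>b<r. pvar (?Y a i) * pvar (?B a b) * pvar (?Y b j))"
  define P where "P = (\<Sum>\<mu>\<in>keys f. pconst (lookup f \<mu>) * pvar ?c ^ (N - tdeg \<mu>) * mon_eval g \<mu>)"
  have "P = 0"
  proof (rule polynomial_eq_0I)
    \<comment> \<open>Testing only at nonzero coordinates makes the value of the variable for
      \<open>c\<close> invertible.\<close>
    show "infinite (UNIV - {0 :: complex})" by (simp add: infinite_UNIV_char_0)
    fix x :: "nat \<times> nat \<times> nat \<Rightarrow> complex" assume x: "\<And>v. x v \<in> UNIV - {0}"
    define s where "s = inverse (x ?c)"
    have s: "s \<noteq> 0" "x ?c * s = 1" using x[of ?c] by (auto simp: s_def)
    define B' where "B' a b = (if a < r \<and> b < r then s * x (?B a b) else 0)" for a b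
    have "\<exists>z. \<forall>k l. B' k l = (\<Sum>t<card {..<r}. z t k * z t l)"
      by (rule symmetric_sum_of_squares) (auto simp: B'_def min.commute max.commute)
    then obtain z where z: "\<And>k l. B' k l = (\<Sum>t<r. z t k * z t l)" by auto
    \<comment> \<open>The \<open>r\<close> coordinates obtained from the sum of squares are padded
      with zeros up to dimension \<open>n\<close>.\<close>
    define y where "y = (\<lambda>(t, i). if t < r then \<Sum>a<r. z t a * x (?Y a i) else 0)"
    have gram: "s * peval x (g (i, j)) = peval y (gram_poly n (i, j))" for i j
    proof -
      have "peval y (gram_poly n (i, j)) = (\<Sum>t<r. y (t, i) * y (t, j))"
        unfolding peval_gram_poly
        by (rule sum.mono_neutral_right) (use r in \<open>auto simp: y_def\<close>)
      also have "\<dots> = (\<Sum>t<r. \<Sum>a<r. \<Sum>b<r. (z t a * x (?Y a i)) * (z t b * x (?Y b j)))"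
        by (simp add: y_def sum_product)
      also have "\<dots> = (\<Sum>a<r. \<Sum>b<r. \<Sum>t<r. (z t a * x (?Y a i)) * (z t b * x (?Y b j)))"
        by (subst sum.swap, rule sum.cong[OF refl], rule sum.swap)
      also have "\<dots> = (\<Sum>a<r. \<Sum>b<r. x (?Y a i) * B' a b * x (?Y b j))"
        unfolding z by (simp add: sum_distrib_left sum_distrib_right mult_ac)
      also have "\<dots> = s * peval x (g (i, j))"
        by (simp add: g_def B'_def peval_sum peval_mult peval_pvar sum_distrib_left mult_ac)
      finally show ?thesis by simp
    qed
    have "peval x P = (\<Sum>\<mu>\<in>keys f. lookup f \<mu> * x ?c ^ (N - tdeg \<mu>) * mon_eval (\<lambda>e. peval x (g e)) \<mu>)"
      unfolding P_def
      by (simp add: peval_sum peval_mult peval_pconst peval_power peval_pvar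
          comm_ring_hom.hom_mon_eval[OF comm_ring_hom_peval])
    also have "\<dots> = (\<Sum>\<mu>\<in>keys f. x ?c ^ N * (lookup f \<mu> * mon_eval (\<lambda>e. s * peval x (g e)) \<mu>))"
    proof (rule sum.cong[OF refl])
      fix \<mu> assume "\<mu> \<in> keys f"
      then have "x ?c ^ N = x ?c ^ (N - tdeg \<mu>) * x ?c ^ tdeg \<mu>" using N by (simp flip: power_add)
      then have N: "x ?c ^ N * s ^ tdeg \<mu> = x ?c ^ (N - tdeg \<mu>)"
        using s(2) by (simp add: mult.assoc flip: power_mult_distrib)
      show "lookup f \<mu> * x ?c ^ (N - tdeg \<mu>) * mon_eval (\<lambda>e. peval x (g e)) \<mu>
          = x ?c ^ N * (lookup f \<mu> * mon_eval (\<lambda>e. s * peval x (g e)) \<mu>)"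
        unfolding mon_eval_scale by (simp only: mult_ac flip: N)
    qed
    also have "\<dots> = x ?c ^ N * peval (\<lambda>e. s * peval x (g e)) f"
      by (simp add: meval_def sum_distrib_left)
    also have "(\<lambda>e. s * peval x (g e)) = (\<lambda>e. peval y (gram_poly n e))"
      by (rule ext) (metis gram prod.exhaust)
    also have "peval \<dots> f = 0" using f by (simp add: gram_vanishing_def)
    finally show "peval x P = 0" by simp
  qed
  interpret h: comm_ring_hom h by (rule h)
  define a where "a = (\<lambda>(k::nat, u, v). if k = 0 then c else if k = 1 then Y u v else B u v)"
  interpret H: comm_ring_hom "meval h a" by (rule h.comm_ring_hom_meval)
  have g: "meval h a (g (i, j)) = (\<Sum>a<r. \<Sum>b<r. Y a i * B a b * Y b j)" for i j
  proof -
    have "meval h a (g (i, j)) = (\<Sum>k<r. \<Sum>l<r. Y k i * B (min k l) (max k l) * Y l j)"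
      unfolding g_def prod.case H.hom_sum H.hom_mult h.meval_pvar by (simp add: a_def)
    also have "\<dots> = (\<Sum>k<r. \<Sum>l<r. Y k i * B k l * Y l j)"
      by (intro sum.cong refl) (auto simp: min_def max_def sym)
    finally show ?thesis .
  qed
  have "meval h a P = (\<Sum>\<mu>\<in>keys f. h (lookup f \<mu>) * c ^ (N - tdeg \<mu>) * mon_eval (\<lambda>e. meval h a (g e)) \<mu>)"
    unfolding P_def H.hom_sum H.hom_mult H.hom_power h.meval_pvar h.meval_pconst H.hom_mon_eval
    by (simp add: a_def)
  also have "(\<lambda>e. meval h a (g e)) = (\<lambda>(i, j). \<Sum>a<r. \<Sum>b<r. Y a i * B a b * Y b j)"
    by (rule ext) (auto simp: g)
  finally show ?thesis using \<open>P = 0\<close> by (simp add: h.meval_0)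
qed

subsection \<open>The radical of the ideal of minors\<close>

definition sym_vars :: "nat \<Rightarrow> (nat \<times> nat) set" where
  "sym_vars m = {(i, j). i \<le> j \<and> j < m}"

definition sym_entry :: "nat \<Rightarrow> nat \<Rightarrow> (nat \<times> nat, complex) mpol" where
  "sym_entry i j = pvar (min i j, max i j)"

lemma sym_entry_sym: "sym_entry i j = sym_entry j i"
  by (simp add: sym_entry_def min.commute max.commute)

text \<open>Modulo \<open>Q\<close>, each \<open>\<Delta> * pvar e\<close> may be replaced by the
  entry \<open>G e\<close> of the factored matrix. So \<open>\<Delta> ^ N * f\<close> is congruent
  to the homogenization of \<open>f\<close> at \<open>G\<close>, which is 0 by
  \<open>gram_vanishing_homogenized\<close>, and \<open>\<Delta>\<close> is outside the prime
  \<open>Q\<close>.\<close>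

lemma prime_contains_gram_vanishing:
  fixes f :: "(nat \<times> nat, complex) mpol"
  assumes Q: "ring_prime Q" and f: "f \<in> polys (sym_vars m)" "gram_vanishing n f"
    and minors: "\<And>\<alpha> \<beta>. (\<And>a. a < n + 1 \<Longrightarrow> \<alpha> a < m \<and> \<beta> a < m) \<Longrightarrow> minor sym_entry (n + 1) \<alpha> \<beta> \<in> Q"
  shows "f \<in> Q"
proof -
  have idQ: "ring_ideal Q" using Q by (simp add: ring_prime_def)
  obtain r \<alpha> where r: "r \<le> n" and \<Delta>: "minor sym_entry r \<alpha> \<alpha> \<notin> Q"
    and schur: "\<forall>i<m. \<forall>j<m. schur_entry sym_entry r \<alpha> i j \<in> Q"
    using symmetric_rank_factorization[OF Q sym_entry_sym minors] by blast
  define \<Delta> where "\<Delta> = minor sym_entry r \<alpha> \<alpha>"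
  define B where "B = adj_entry sym_entry r \<alpha>"
  define Y where "Y a i = sym_entry (\<alpha> a) i" for a i
  define G where "G = (\<lambda>(i, j). \<Sum>a<r. \<Sum>b<r. Y a i * B a b * Y b j)"
  define N where "N = (\<Sum>\<mu>\<in>keys f. tdeg \<mu>)"
  have N: "tdeg \<mu> \<le> N" if "\<mu> \<in> keys f" for \<mu> unfolding N_def by (rule member_le_sum) (use that in auto)
  have cong: "\<Delta> * pvar e - G e \<in> Q" if e: "e \<in> sym_vars m" for e
  proof -
    obtain i j where ij: "e = (i, j)" "i \<le> j" "j < m" using e by (auto simp: sym_vars_def)
    have "G e = (\<Sum>a<r. \<Sum>b<r. sym_entry i (\<alpha> a) * B a b * sym_entry (\<alpha> b) j)"
      unfolding ij(1) G_def Y_def prod.case by (simp only: sym_entry_sym[of "\<alpha> a" i for a])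
    moreover have "pvar e = sym_entry i j" using ij by (simp add: sym_entry_def)
    ultimately have "\<Delta> * pvar e - G e = schur_entry sym_entry r \<alpha> i j"
      by (simp add: schur_entry_def \<Delta>_def B_def)
    then show ?thesis using schur ij by simp
  qed
  have "\<Delta> ^ N * f = (\<Sum>\<mu>\<in>keys f. pconst (lookup f \<mu>) * \<Delta> ^ (N - tdeg \<mu>) * mon_eval (\<lambda>e. \<Delta> * pvar e) \<mu>)"
  proof -
    have "\<Delta> ^ N * f = (\<Sum>\<mu>\<in>keys f. \<Delta> ^ N * (pconst (lookup f \<mu>) * mon_eval pvar \<mu>))"
      by (subst meval_pconst_pvar[of f, symmetric]) (simp add: meval_def sum_distrib_left)
    also have "\<dots> = (\<Sum>\<mu>\<in>keys f. pconst (lookup f \<mu>) * \<Delta> ^ (N - tdeg \<mu>) * mon_eval (\<lambda>e. \<Delta> * pvar e) \<mu>)"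
    proof (rule sum.cong[OF refl])
      fix \<mu> assume "\<mu> \<in> keys f"
      then have "\<Delta> ^ N = \<Delta> ^ (N - tdeg \<mu>) * \<Delta> ^ tdeg \<mu>" using N by (simp flip: power_add)
      then show "\<Delta> ^ N * (pconst (lookup f \<mu>) * mon_eval pvar \<mu>)
          = pconst (lookup f \<mu>) * \<Delta> ^ (N - tdeg \<mu>) * mon_eval (\<lambda>e. \<Delta> * pvar e) \<mu>"
        unfolding mon_eval_scale by (simp add: mult_ac)
    qed
    finally show ?thesis .
  qed
  moreover have "(\<Sum>\<mu>\<in>keys f. pconst (lookup f \<mu>) * \<Delta> ^ (N - tdeg \<mu>) * mon_eval G \<mu>) = 0"
    unfolding G_def
    by (rule gram_vanishing_homogenized[OF f(2) r N comm_ring_hom_pconst])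
      (auto simp: B_def intro!: adj_entry_sym sym_entry_sym)
  ultimately have "\<Delta> ^ N * f = (\<Sum>\<mu>\<in>keys f. pconst (lookup f \<mu>) * \<Delta> ^ (N - tdeg \<mu>)
      * (mon_eval (\<lambda>e. \<Delta> * pvar e) \<mu> - mon_eval G \<mu>))"
    by (simp add: right_diff_distrib sum_subtractf)
  also have "\<dots> \<in> Q"
  proof (intro ring_ideal_sum[OF idQ] ring_idealD(3)[OF idQ] mon_eval_diff_in_ideal[OF idQ] cong)
    fix \<mu> e assume "\<mu> \<in> keys f" "e \<in> keys \<mu>"
    then show "e \<in> sym_vars m" using f(1) by (auto simp: polys_def)
  qed
  finally have "\<Delta> ^ N * f \<in> Q" .
  moreover have "\<Delta> ^ k \<notin> Q" for k
    by (induction k) (use Q \<Delta> in \<open>auto simp: ring_prime_def \<Delta>_def\<close>)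
  ultimately show ?thesis using Q unfolding ring_prime_def by blast
qed

section \<open>Minors with arbitrary row and column lists versus the generators of the ideal\<close>

lemma minor_permute_rows:
  assumes "\<sigma> permutes {0..<k}"
  shows "minor S k (\<lambda>a. \<alpha> (\<sigma> a)) \<beta> = signof \<sigma> * minor S k \<alpha> \<beta>"
proof -
  let ?A = "mat k k (\<lambda>(a, b). S (\<alpha> a) (\<beta> b))"
  have "mat k k (\<lambda>(a, b). S (\<alpha> (\<sigma> a)) (\<beta> b)) = mat k k (\<lambda>(a, b). ?A $$ (\<sigma> a, b))"
    by (rule eq_matI) (use permutes_in_image[OF assms] in auto)
  then show ?thesis unfolding minor_def using det_permute_rows[of ?A k \<sigma>] assms by simp
qed

lemma minor_transpose:
  assumes "\<And>i j. S i j = S j i"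
  shows "minor S k \<alpha> \<beta> = minor S k \<beta> \<alpha>"
proof -
  have "mat k k (\<lambda>(a, b). S (\<alpha> a) (\<beta> b)) = transpose_mat (mat k k (\<lambda>(a, b). S (\<beta> a) (\<alpha> b)))"
    by (rule eq_matI) (use assms in auto)
  then show ?thesis
    unfolding minor_def using det_transpose[of "mat k k (\<lambda>(a, b). S (\<beta> a) (\<alpha> b))" k] by simp
qed

text \<open>A repeated row makes the determinant 0, and otherwise sorting the rows costs a sign. The
  generators of the ideal of minors have their rows in the increasing order given by
  \<open>pick I\<close>.\<close>

lemma minor_sort_rows:
  assumes "\<And>a. a < k \<Longrightarrow> \<alpha> a < m"
  shows "minor S k \<alpha> \<beta> = 0 \<or> (\<exists>I u. I \<subseteq> {..<m} \<and> card I = k \<and> minor S k \<alpha> \<beta> = u * minor S k (pick I) \<beta>)"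
proof (cases "inj_on \<alpha> {..<k}")
  case False
  then obtain a b where ab: "a < k" "b < k" "a \<noteq> b" "\<alpha> a = \<alpha> b" by (auto simp: inj_on_def)
  have "minor S k \<alpha> \<beta> = 0"
    unfolding minor_def
    by (rule det_identical_rows[of _ k a b]) (use ab in \<open>auto simp: row_def\<close>)
  then show ?thesis by blast
next
  case True
  define I where "I = \<alpha> ` {..<k}"
  have I: "finite I" "card I = k" "I \<subseteq> {..<m}"
    using True assms by (auto simp: I_def card_image)
  \<comment> \<open>The rank of \<open>\<alpha> a\<close> within \<open>I\<close>, extended by the
    identity as \<open>permutes\<close> demands.\<close>
  define \<sigma> where "\<sigma> a = (if a < k then card {x\<in>I. x < \<alpha> a} else a)" for a
  have pick: "pick I (\<sigma> a) = \<alpha> a" if "a < k" for a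
    using that pick_card_in_set[of "\<alpha> a" I] by (auto simp: \<sigma>_def I_def)
  have "\<sigma> a < k" if "a < k" for a
  proof -
    have "{x\<in>I. x < \<alpha> a} \<subset> I" using that by (auto simp: I_def)
    then have "card {x\<in>I. x < \<alpha> a} < card I" using I(1) by (rule psubset_card_mono[rotated])
    then show ?thesis using that I(2) by (simp add: \<sigma>_def)
  qed
  moreover have "inj_on \<sigma> {0..<k}"
  proof (rule inj_onI)
    fix a b assume "a \<in> {0..<k}" "b \<in> {0..<k}" "\<sigma> a = \<sigma> b"
    then have "\<alpha> a = \<alpha> b" using pick[of a] pick[of b] by simp
    then show "a = b" using True \<open>a \<in> {0..<k}\<close> \<open>b \<in> {0..<k}\<close> by (auto dest: inj_onD)
  qed
  ultimately have "bij_betw \<sigma> {0..<k} {0..<k}"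
    unfolding bij_betw_def by (intro conjI endo_inj_surj) auto
  then have "\<sigma> permutes {0..<k}" by (rule bij_imp_permutes) (auto simp: \<sigma>_def)
  moreover have "minor S k \<alpha> \<beta> = minor S k (\<lambda>a. pick I (\<sigma> a)) \<beta>"
    unfolding minor_def by (rule arg_cong[of _ _ det], rule eq_matI) (auto simp: pick)
  ultimately have "minor S k \<alpha> \<beta> = signof \<sigma> * minor S k (pick I) \<beta>"
    by (simp add: minor_permute_rows)
  then show ?thesis using I by blast
qed

lemma sym_ring_eq: "sym_ring m = mpol_ring (sym_vars m)"
  by (simp add: sym_ring_def sym_vars_def)

lemma polys_sym_entry: "i < m \<Longrightarrow> j < m \<Longrightarrow> sym_entry i j \<in> polys (sym_vars m)"
  unfolding sym_entry_def by (intro polys_pvar) (auto simp: sym_vars_def)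

lemma polys_minor:
  assumes "\<And>a. a < k \<Longrightarrow> \<alpha> a < m \<and> \<beta> a < m"
  shows "minor sym_entry k \<alpha> \<beta> \<in> polys (sym_vars m)"
proof -
  let ?A = "mat k k (\<lambda>(a, b). sym_entry (\<alpha> a) (\<beta> b))"
  have "det ?A = (\<Sum>p\<in>{p. p permutes {0..<k}}. signof p * (\<Prod>i = 0..<k. ?A $$ (i, p i)))"
    by (rule det_def') simp
  also have "\<dots> \<in> polys (sym_vars m)"
  proof (intro polys_sum polys_mult polys_prod)
    fix p assume p: "p \<in> {p. p permutes {0..<k}}"
    show "(signof p :: (nat \<times> nat, complex) mpol) \<in> polys (sym_vars m)"
      by (auto simp: sign_def intro: polys_uminus)
    fix i assume "i \<in> {0..<k}"
    moreover from this have "p i \<in> {0..<k}" using p permutes_in_image[of p "{0..<k}" i] by simp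
    ultimately show "?A $$ (i, p i) \<in> polys (sym_vars m)"
      using assms by (auto intro: polys_sym_entry)
  qed
  finally show ?thesis by (simp add: minor_def)
qed

lemma det_submatrix_sym_matrix:
  assumes "I \<subseteq> {..<m}" "J \<subseteq> {..<m}" "card I = k" "card J = k"
  shows "det (submatrix (sym_matrix m) I J) = minor sym_entry k (pick I) (pick J)"
proof -
  have eq: "{i. i < m \<and> i \<in> I} = I" "{j. j < m \<and> j \<in> J} = J" using assms by auto
  have "pick I a < m" "pick J a < m" if "a < k" for a
    using pick_in_set_le[of a I] pick_in_set_le[of a J] that assms by auto
  then have "submatrix (sym_matrix m) I J = mat k k (\<lambda>(a, b). sym_entry (pick I a) (pick J b))"
    by (intro eq_matI) (auto simp: submatrix_def sym_matrix_def eq assms sym_entry_def)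
  then show ?thesis by (simp add: minor_def)
qed

definition minor_gens :: "nat \<Rightarrow> nat \<Rightarrow> (nat \<times> nat, complex) mpol set" where
  "minor_gens m k = {minor sym_entry k (pick I) (pick J) | I J.
     I \<subseteq> {..<m} \<and> J \<subseteq> {..<m} \<and> card I = k \<and> card J = k}"

lemma minor_ideal_eq: "minor_ideal m k = Idl\<^bsub>mpol_ring (sym_vars m)\<^esub> (minor_gens m k)"
proof -
  have "{det (submatrix (sym_matrix m) I J) | I J.
      I \<subseteq> {..<m} \<and> J \<subseteq> {..<m} \<and> card I = k \<and> card J = k} = minor_gens m k"
    unfolding minor_gens_def using det_submatrix_sym_matrix by (intro Collect_cong) metis
  then show ?thesis by (simp add: minor_ideal_def sym_ring_eq)
qed

lemma minor_gens_polys: "minor_gens m k \<subseteq> polys (sym_vars m)"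
proof -
  have "pick I a < m" if "I \<subseteq> {..<m}" "card I = k" "a < k" for I a
    using pick_in_set_le[of a I] that by auto
  then show ?thesis unfolding minor_gens_def by (auto intro!: polys_minor)
qed

lemma ring_mpol_ring: "ring (mpol_ring V :: ('v, 'c::comm_ring_1) mpol ring)"
  using cring_mpol_ring by (rule cring.axioms)

lemma ideal_minor_ideal: "ideal (minor_ideal m k) (mpol_ring (sym_vars m))"
  unfolding minor_ideal_eq using minor_gens_polys by (intro ring.genideal_ideal[OF ring_mpol_ring]) simp

lemma minor_gens_subset: "minor_gens m k \<subseteq> minor_ideal m k"
  unfolding minor_ideal_eq using minor_gens_polys by (intro ring.genideal_self[OF ring_mpol_ring]) simp

lemma minor_ideal_closed:
  shows "0 \<in> minor_ideal m k"
    and "p \<in> minor_ideal m k \<Longrightarrow> q \<in> minor_ideal m k \<Longrightarrow> p + q \<in> minor_ideal m k"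
    and "p \<in> minor_ideal m k \<Longrightarrow> r \<in> polys (sym_vars m) \<Longrightarrow> r * p \<in> minor_ideal m k"
  using additive_subgroup.zero_closed[OF ideal.axioms(1)[OF ideal_minor_ideal[of m k]]]
    additive_subgroup.a_closed[OF ideal.axioms(1)[OF ideal_minor_ideal[of m k]], of p q]
    ideal.I_l_closed[OF ideal_minor_ideal[of m k], of p r]
  by simp_all

text \<open>The preimage of an ideal of \<open>polys V\<close> under this retraction is an ideal of
  the whole type that meets \<open>polys V\<close> in the original ideal.\<close>

definition retract :: "'v set \<Rightarrow> ('v, 'c::comm_ring_1) mpol \<Rightarrow> ('v, 'c) mpol" where
  "retract V = meval pconst (\<lambda>v. if v \<in> V then pvar v else 0)"

lemma comm_ring_hom_retract: "comm_ring_hom (retract V)"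
  unfolding retract_def by (rule comm_ring_hom.comm_ring_hom_meval[OF comm_ring_hom_pconst])

lemma retract_polys: "retract V p \<in> polys V"
  unfolding retract_def
  by (rule polys_meval[of p UNIV]) (auto simp: polys_def[of UNIV] intro: polys_pvar)

lemma retract_id: "p \<in> polys V \<Longrightarrow> retract V p = p"
  unfolding retract_def
  using meval_cong_polys[of p V "\<lambda>v. if v \<in> V then pvar v else 0" pvar pconst]
  by (simp add: meval_pconst_pvar)

text \<open>If no power of \<open>f\<close> were in the ideal, some prime above the pullback of the
  ideal would avoid \<open>f\<close>. That prime contains all minors of size \<open>n + 1\<close>
  and hence \<open>f\<close>, by \<open>prime_contains_gram_vanishing\<close>.\<close>

theorem gram_vanishing_imp_power_in_minor_ideal:
  assumes f: "f \<in> polys (sym_vars m)" "gram_vanishing n f"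
  shows "\<exists>k. f ^ k \<in> minor_ideal m (n + 1)"
proof (rule ccontr)
  assume neg: "\<nexists>k. f ^ k \<in> minor_ideal m (n + 1)"
  let ?I = "minor_ideal m (n + 1)" and ?\<rho> = "retract (sym_vars m)"
  interpret \<rho>: comm_ring_hom ?\<rho> by (rule comm_ring_hom_retract)
  define I where "I = {p. ?\<rho> p \<in> ?I}"
  have idI: "ring_ideal I"
    unfolding ring_ideal_def I_def
    by (auto simp: \<rho>.hom_add \<rho>.hom_mult intro: minor_ideal_closed retract_polys)
  have "f ^ k \<notin> I" for k
    using neg retract_id[OF polys_power[OF f(1)]] by (simp add: I_def)
  with idI obtain Q where Q: "ring_prime Q" "I \<subseteq> Q" "f \<notin> Q" using ex_prime_avoiding by blast
  have idQ: "ring_ideal Q" using Q by (simp add: ring_prime_def)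
  have minors: "minor sym_entry (n + 1) \<alpha> \<beta> \<in> Q" if \<alpha>\<beta>: "\<And>a. a < n + 1 \<Longrightarrow> \<alpha> a < m \<and> \<beta> a < m" for \<alpha> \<beta>
  proof -
    let ?m = "minor sym_entry (n + 1)"
    have gens: "?m (pick K) (pick L) \<in> Q"
      if "K \<subseteq> {..<m}" "L \<subseteq> {..<m}" "card K = n + 1" "card L = n + 1" for K L
    proof -
      have "?m (pick K) (pick L) \<in> minor_gens m (n + 1)" using that unfolding minor_gens_def by blast
      then have "?m (pick K) (pick L) \<in> I"
        using minor_gens_subset minor_gens_polys retract_id unfolding I_def by fastforce
      then show ?thesis using Q(2) by blast
    qed
    \<comment> \<open>This is applied twice, first to the rows and then, after transposing by
      symmetry of the matrix, to the columns.\<close>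
    have sort: "?m \<gamma> \<delta> \<in> Q" if \<gamma>: "\<And>a. a < n + 1 \<Longrightarrow> \<gamma> a < m"
      and \<delta>: "\<And>K. K \<subseteq> {..<m} \<Longrightarrow> card K = n + 1 \<Longrightarrow> ?m (pick K) \<delta> \<in> Q" for \<gamma> \<delta>
    proof -
      have "?m \<gamma> \<delta> = 0 \<or> (\<exists>K u. K \<subseteq> {..<m} \<and> card K = n + 1 \<and> ?m \<gamma> \<delta> = u * ?m (pick K) \<delta>)"
        by (rule minor_sort_rows) (rule \<gamma>)
      then show ?thesis
        using ring_idealD(1)[OF idQ] ring_idealD(3)[OF idQ \<delta>] by auto
    qed
    have comm: "?m \<gamma> \<delta> = ?m \<delta> \<gamma>" for \<gamma> \<delta> by (rule minor_transpose) (rule sym_entry_sym)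
    show ?thesis
    proof (rule sort)
      fix K assume K: "K \<subseteq> {..<m}" "card K = n + 1"
      show "?m (pick K) \<beta> \<in> Q"
        unfolding comm[of "pick K"] by (rule sort) (use \<alpha>\<beta> gens K in auto)
    qed (use \<alpha>\<beta> in auto)
  qed
  have "f \<in> Q" by (rule prime_contains_gram_vanishing[OF Q(1) f]) (rule minors)
  then show False using Q(3) by blast
qed

section \<open>The ideal of minors vanishes on Gram matrices\<close>

lemma minor_gram_eq_0:
  fixes x :: "nat \<times> nat \<Rightarrow> 'c::comm_ring_1"
  shows "minor (\<lambda>i j. \<Sum>k<n. x (k, i) * x (k, j)) (n + 1) \<alpha> \<beta> = 0"
proof -
  \<comment> \<open>The Gram matrix factors through \<open>n\<close> coordinates. Both factors are
    made square; the added column of \<open>?U\<close> is 0, so its determinant vanishes and the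
    added row of \<open>?V\<close> may hold any values.\<close>
  let ?U = "mat (n + 1) (n + 1) (\<lambda>(a, k). if k < n then x (k, \<alpha> a) else 0)"
    and ?V = "mat (n + 1) (n + 1) (\<lambda>(k, b). x (k, \<beta> b))"
  have U: "?U \<in> carrier_mat (n + 1) (n + 1)" and V: "?V \<in> carrier_mat (n + 1) (n + 1)" by auto
  have "det ?U = (\<Sum>i<n + 1. ?U $$ (i, n) * cofactor ?U i n)"
    by (rule laplace_expansion_column[OF U]) simp
  also have "\<dots> = 0" by (rule sum.neutral) simp
  finally have "det (?U * ?V) = 0" using det_mult[OF U V] by simp
  moreover have "?U * ?V = mat (n + 1) (n + 1) (\<lambda>(a, b). \<Sum>k<n. x (k, \<alpha> a) * x (k, \<beta> b))"
  proof (rule eq_matI)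
    fix i j assume "i < dim_row (mat (n + 1) (n + 1) (\<lambda>(a, b). \<Sum>k<n. x (k, \<alpha> a) * x (k, \<beta> b)))"
      "j < dim_col (mat (n + 1) (n + 1) (\<lambda>(a, b). \<Sum>k<n. x (k, \<alpha> a) * x (k, \<beta> b)))"
    then have ij: "i < n + 1" "j < n + 1" by auto
    show "(?U * ?V) $$ (i, j) = mat (n + 1) (n + 1) (\<lambda>(a, b). \<Sum>k<n. x (k, \<alpha> a) * x (k, \<beta> b)) $$ (i, j)"
      unfolding index_mult_mat_sum[OF U V ij] using ij by simp
  qed auto
  ultimately show ?thesis by (simp add: minor_def)
qed

lemma mpol_ring_a_inv:
  fixes p :: "('v, 'c::comm_ring_1) mpol"
  assumes "p \<in> polys V"
  shows "\<ominus>\<^bsub>mpol_ring V\<^esub> p = - p"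
  by (rule abelian_group.minus_equality)
    (use assms ring.is_abelian_group[OF ring_mpol_ring] in \<open>auto intro: polys_uminus\<close>)

lemma ideal_mpol_ringI:
  fixes I :: "('v, 'c::comm_ring_1) mpol set"
  assumes "I \<subseteq> polys V" "0 \<in> I" "\<And>a b. a \<in> I \<Longrightarrow> b \<in> I \<Longrightarrow> a + b \<in> I"
    "\<And>a r. a \<in> I \<Longrightarrow> r \<in> polys V \<Longrightarrow> r * a \<in> I"
  shows "ideal I (mpol_ring V)"
proof (rule idealI[OF ring_mpol_ring])
  have neg: "- a \<in> I" if "a \<in> I" for a
    using assms(4)[OF that, of "- 1"] by (simp add: polys_uminus)
  show "subgroup I (add_monoid (mpol_ring V))"
  proof
    fix a assume "a \<in> I"
    then show "inv\<^bsub>add_monoid (mpol_ring V)\<^esub> a \<in> I"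
      using mpol_ring_a_inv[of a V] neg assms(1) by (auto simp: a_inv_def)
  qed (use assms in auto)
qed (use assms in \<open>auto simp: mult.commute\<close>)

text \<open>The polynomials that vanish on all Gram matrices of vectors in dimension
  \<open>n\<close> form an ideal, and it contains the generators because such matrices have rank at
  most \<open>n\<close>.\<close>

theorem minor_ideal_imp_gram_vanishing:
  assumes "f \<in> minor_ideal m (n + 1)"
  shows "gram_vanishing n f"
proof -
  let ?K = "{f \<in> polys (sym_vars m). gram_vanishing n f}"
  have "ideal ?K (mpol_ring (sym_vars m))"
    by (rule ideal_mpol_ringI)
      (auto simp: gram_vanishing_def peval_0 peval_add peval_mult intro: polys_add polys_mult)
  moreover have "minor_gens m (n + 1) \<subseteq> ?K"
  proof
    fix g assume g: "g \<in> minor_gens m (n + 1)"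
    then obtain I J where IJ: "g = minor sym_entry (n + 1) (pick I) (pick J)"
      unfolding minor_gens_def by blast
    have "peval (\<lambda>e. peval x (gram_poly n e)) g = 0" for x :: "nat \<times> nat \<Rightarrow> complex"
    proof -
      let ?y = "\<lambda>e. peval x (gram_poly n e)"
      interpret comm_ring_hom "peval ?y" by (rule comm_ring_hom_peval)
      have *: "peval ?y (sym_entry i j) = (\<Sum>k<n. x (k, i) * x (k, j))" for i j
        unfolding sym_entry_def peval_pvar peval_gram_poly
        by (auto simp: min_def max_def mult.commute)
      have "peval ?y g = det (map_mat (peval ?y) (mat (n + 1) (n + 1) (\<lambda>(a, b). sym_entry (pick I a) (pick J b))))"
        unfolding IJ minor_def by (rule hom_det[symmetric])
      also have "map_mat (peval ?y) (mat (n + 1) (n + 1) (\<lambda>(a, b). sym_entry (pick I a) (pick J b)))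
          = mat (n + 1) (n + 1) (\<lambda>(a, b). \<Sum>k<n. x (k, pick I a) * x (k, pick J b))"
        by (rule eq_matI) (simp_all add: *)
      finally show ?thesis using minor_gram_eq_0[where n = n and x = x and \<alpha> = "pick I" and \<beta> = "pick J"] by (simp add: minor_def)
    qed
    then show "g \<in> ?K" using g minor_gens_polys by (auto simp: gram_vanishing_def)
  qed
  ultimately have "minor_ideal m (n + 1) \<subseteq> ?K"
    unfolding minor_ideal_eq by (rule ring.genideal_minimal[OF ring_mpol_ring])
  then show ?thesis using assms by blast
qed

subsection \<open>Total rings of fractions\<close>

context cring
begin

lemma nonzerodivisors_closed: "s \<in> nonzerodivisors R \<Longrightarrow> s \<in> carrier R"
  by (simp add: nonzerodivisors_def)

lemma nonzerodivisors_one: "\<one> \<in> nonzerodivisors R"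
  by (simp add: nonzerodivisors_def)

lemma nonzerodivisorsD: "s \<in> nonzerodivisors R \<Longrightarrow> a \<in> carrier R \<Longrightarrow> s \<otimes> a = \<zero> \<Longrightarrow> a = \<zero>"
  unfolding nonzerodivisors_def by blast

lemma nonzerodivisors_mult:
  assumes s: "s \<in> nonzerodivisors R" and t: "t \<in> nonzerodivisors R"
  shows "s \<otimes> t \<in> nonzerodivisors R"
proof -
  note carr = nonzerodivisors_closed[OF s] nonzerodivisors_closed[OF t]
  have "a = \<zero>" if a: "a \<in> carrier R" "s \<otimes> t \<otimes> a = \<zero>" for a
  proof -
    have "s \<otimes> (t \<otimes> a) = \<zero>" using a carr by (simp add: m_assoc)
    then have "t \<otimes> a = \<zero>" by (rule nonzerodivisorsD[OF s, rotated]) (use a carr in simp)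
    then show ?thesis by (rule nonzerodivisorsD[OF t a(1)])
  qed
  moreover have "s \<otimes> t \<in> carrier R" using carr by simp
  ultimately show ?thesis unfolding nonzerodivisors_def by blast
qed

text \<open>This cancellation takes the place of the absence of zero divisors: it is what makes
  equality of fractions transitive.\<close>

lemma nonzerodivisors_cancel:
  assumes s: "s \<in> nonzerodivisors R" and ab: "a \<in> carrier R" "b \<in> carrier R" and eq: "s \<otimes> a = s \<otimes> b"
  shows "a = b"
proof -
  have sc: "s \<in> carrier R" using s by (rule nonzerodivisors_closed)
  have "s \<otimes> (a \<ominus> b) = s \<otimes> a \<ominus> s \<otimes> b"
    using sc ab by (simp add: a_minus_def r_distr r_minus)
  also have "\<dots> = \<zero>" using sc ab by (simp add: eq a_minus_def r_neg)
  finally have "a \<ominus> b = \<zero>" by (rule nonzerodivisorsD[OF s, rotated]) (use ab in simp)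
  then show ?thesis using ab by simp
qed

lemma total_fraction_mem:
  "(b, t) \<in> fraction R a s \<longleftrightarrow> b \<in> carrier R \<and> t \<in> nonzerodivisors R \<and> a \<otimes> t = b \<otimes> s"
  unfolding fraction_def by auto

lemma total_fraction_eqI:
  assumes as: "a \<in> carrier R" "s \<in> nonzerodivisors R" and bt: "b \<in> carrier R" "t \<in> nonzerodivisors R"
    and eq: "a \<otimes> t = b \<otimes> s"
  shows "fraction R a s = fraction R b t"
proof -
  have "fraction R a s \<subseteq> fraction R b t"
    if as: "a \<in> carrier R" "s \<in> nonzerodivisors R" and bt: "b \<in> carrier R" "t \<in> nonzerodivisors R"
      and eq: "a \<otimes> t = b \<otimes> s" for a s b t
  proof (clarsimp simp: total_fraction_mem)
    fix c u assume cu: "c \<in> carrier R" "u \<in> nonzerodivisors R" "a \<otimes> u = c \<otimes> s"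
    note carr = as(1) bt(1) cu(1) nonzerodivisors_closed[OF as(2)] nonzerodivisors_closed[OF bt(2)]
      nonzerodivisors_closed[OF cu(2)]
    have "s \<otimes> (b \<otimes> u) = (b \<otimes> s) \<otimes> u" using carr by (simp add: m_ac)
    also have "\<dots> = (a \<otimes> t) \<otimes> u" by (simp add: eq)
    also have "\<dots> = (a \<otimes> u) \<otimes> t" using carr by (simp add: m_ac)
    also have "\<dots> = (c \<otimes> s) \<otimes> t" by (simp add: cu)
    also have "\<dots> = s \<otimes> (c \<otimes> t)" using carr by (simp add: m_ac)
    finally have "s \<otimes> (b \<otimes> u) = s \<otimes> (c \<otimes> t)" .
    then show "b \<otimes> u = c \<otimes> t" by (rule nonzerodivisors_cancel[OF as(2), rotated 2]) (use carr in simp_all)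
  qed
  from this[of a s b t] this[of b t a s] show ?thesis using assms by auto
qed

lemma total_fraction_eq_iff:
  assumes "a \<in> carrier R" "s \<in> nonzerodivisors R" "b \<in> carrier R" "t \<in> nonzerodivisors R"
  shows "fraction R a s = fraction R b t \<longleftrightarrow> a \<otimes> t = b \<otimes> s"
proof
  assume eq: "fraction R a s = fraction R b t"
  have "(b, t) \<in> fraction R b t" using assms by (simp add: total_fraction_mem)
  then have "(b, t) \<in> fraction R a s" by (simp only: eq)
  then show "a \<otimes> t = b \<otimes> s" by (simp add: total_fraction_mem)
qed (use assms in \<open>rule total_fraction_eqI\<close>)

lemma total_fraction_UN:
  assumes as: "a \<in> carrier R" "s \<in> nonzerodivisors R"
    and cong: "\<And>a' s'. a' \<in> carrier R \<Longrightarrow> s' \<in> nonzerodivisors R \<Longrightarrow> a \<otimes> s' = a' \<otimes> s \<Longrightarrow> f a' s' = f a s"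
  shows "(\<Union>(a', s')\<in>fraction R a s. f a' s') = f a s"
proof -
  have "(a, s) \<in> fraction R a s" using as by (simp add: total_fraction_mem)
  then have ne: "fraction R a s \<noteq> {}" by blast
  show ?thesis
  proof (rule SUP_eq_const[OF ne])
    fix p assume p: "p \<in> fraction R a s"
    obtain a' s' where p': "p = (a', s')" by (cases p)
    have "f a' s' = f a s" using p unfolding p' total_fraction_mem by (intro cong) blast+
    then show "(case p of (a', s') \<Rightarrow> f a' s') = f a s" unfolding p' by simp
  qed
qed

lemma total_fraction_mult:
  assumes as: "a \<in> carrier R" "s \<in> nonzerodivisors R" and bt: "b \<in> carrier R" "t \<in> nonzerodivisors R"
  shows "fraction R a s \<otimes>\<^bsub>fraction_ring R\<^esub> fraction R b t = fraction R (a \<otimes> b) (s \<otimes> t)"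
proof -
  have eq: "fraction R (a' \<otimes> b') (s' \<otimes> t') = fraction R (a \<otimes> b) (s \<otimes> t)"
    if a's': "a' \<in> carrier R" "s' \<in> nonzerodivisors R" "a \<otimes> s' = a' \<otimes> s"
      and b't': "b' \<in> carrier R" "t' \<in> nonzerodivisors R" "b \<otimes> t' = b' \<otimes> t" for a' s' b' t'
  proof (rule total_fraction_eqI)
    note carr = as(1) bt(1) a's'(1) b't'(1) nonzerodivisors_closed[OF as(2)] nonzerodivisors_closed[OF bt(2)]
      nonzerodivisors_closed[OF a's'(2)] nonzerodivisors_closed[OF b't'(2)]
    have "(a' \<otimes> b') \<otimes> (s \<otimes> t) = (a' \<otimes> s) \<otimes> (b' \<otimes> t)" using carr by (simp add: m_ac)
    also have "\<dots> = (a \<otimes> s') \<otimes> (b \<otimes> t')" by (simp only: a's'(3) b't'(3))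
    also have "\<dots> = (a \<otimes> b) \<otimes> (s' \<otimes> t')" using carr by (simp add: m_ac)
    finally show "(a' \<otimes> b') \<otimes> (s \<otimes> t) = (a \<otimes> b) \<otimes> (s' \<otimes> t')" .
  qed (use as bt a's' b't' in \<open>auto intro: nonzerodivisors_mult\<close>)
  have "fraction R a s \<otimes>\<^bsub>fraction_ring R\<^esub> fraction R b t
      = (\<Union>(a', s')\<in>fraction R a s. \<Union>(b', t')\<in>fraction R b t. fraction R (a' \<otimes> b') (s' \<otimes> t'))"
    by (simp add: fraction_ring_def)
  also have "\<dots> = (\<Union>(b', t')\<in>fraction R b t. fraction R (a \<otimes> b') (s \<otimes> t'))"
  proof (rule total_fraction_UN[OF as])
    fix a' s' assume a's': "a' \<in> carrier R" "s' \<in> nonzerodivisors R" "a \<otimes> s' = a' \<otimes> s"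
    show "(\<Union>(b', t')\<in>fraction R b t. fraction R (a' \<otimes> b') (s' \<otimes> t'))
      = (\<Union>(b', t')\<in>fraction R b t. fraction R (a \<otimes> b') (s \<otimes> t'))"
    proof (rule SUP_cong[OF refl])
      fix p assume p: "p \<in> fraction R b t"
      obtain b' t' where p': "p = (b', t')" by (cases p)
      have b't': "b' \<in> carrier R" "t' \<in> nonzerodivisors R" "b \<otimes> t' = b' \<otimes> t"
        using p unfolding p' total_fraction_mem by auto
      show "(case p of (b', t') \<Rightarrow> fraction R (a' \<otimes> b') (s' \<otimes> t'))
          = (case p of (b', t') \<Rightarrow> fraction R (a \<otimes> b') (s \<otimes> t'))"
        unfolding p' prod.case using eq[OF a's' b't'] eq[OF as refl b't'] by simp
    qed
  qed
  also have "\<dots> = fraction R (a \<otimes> b) (s \<otimes> t)"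
    by (rule total_fraction_UN[OF bt]) (rule eq[OF as refl])
  finally show ?thesis .
qed

lemma total_fraction_add:
  assumes as: "a \<in> carrier R" "s \<in> nonzerodivisors R" and bt: "b \<in> carrier R" "t \<in> nonzerodivisors R"
  shows "fraction R a s \<oplus>\<^bsub>fraction_ring R\<^esub> fraction R b t = fraction R (a \<otimes> t \<oplus> b \<otimes> s) (s \<otimes> t)"
proof -
  have eq: "fraction R (a' \<otimes> t' \<oplus> b' \<otimes> s') (s' \<otimes> t') = fraction R (a \<otimes> t \<oplus> b \<otimes> s) (s \<otimes> t)"
    if a's': "a' \<in> carrier R" "s' \<in> nonzerodivisors R" "a \<otimes> s' = a' \<otimes> s"
      and b't': "b' \<in> carrier R" "t' \<in> nonzerodivisors R" "b \<otimes> t' = b' \<otimes> t" for a' s' b' t'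
  proof (rule total_fraction_eqI)
    note carr = as(1) bt(1) a's'(1) b't'(1) nonzerodivisors_closed[OF as(2)] nonzerodivisors_closed[OF bt(2)]
      nonzerodivisors_closed[OF a's'(2)] nonzerodivisors_closed[OF b't'(2)]
    have "(a' \<otimes> t' \<oplus> b' \<otimes> s') \<otimes> (s \<otimes> t) = (t' \<otimes> t) \<otimes> (a' \<otimes> s) \<oplus> (s' \<otimes> s) \<otimes> (b' \<otimes> t)"
      using carr by (simp add: m_ac l_distr r_distr)
    also have "\<dots> = (t' \<otimes> t) \<otimes> (a \<otimes> s') \<oplus> (s' \<otimes> s) \<otimes> (b \<otimes> t')" by (simp only: a's'(3) b't'(3))
    also have "\<dots> = (a \<otimes> t \<oplus> b \<otimes> s) \<otimes> (s' \<otimes> t')" using carr by (simp add: m_ac l_distr r_distr)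
    finally show "(a' \<otimes> t' \<oplus> b' \<otimes> s') \<otimes> (s \<otimes> t) = (a \<otimes> t \<oplus> b \<otimes> s) \<otimes> (s' \<otimes> t')" .
  qed (use as bt a's' b't' in \<open>auto intro: nonzerodivisors_mult nonzerodivisors_closed\<close>)
  have "fraction R a s \<oplus>\<^bsub>fraction_ring R\<^esub> fraction R b t
      = (\<Union>(a', s')\<in>fraction R a s. \<Union>(b', t')\<in>fraction R b t. fraction R (a' \<otimes> t' \<oplus> b' \<otimes> s') (s' \<otimes> t'))"
    by (simp add: fraction_ring_def)
  also have "\<dots> = (\<Union>(b', t')\<in>fraction R b t. fraction R (a \<otimes> t' \<oplus> b' \<otimes> s) (s \<otimes> t'))"
  proof (rule total_fraction_UN[OF as])
    fix a' s' assume a's': "a' \<in> carrier R" "s' \<in> nonzerodivisors R" "a \<otimes> s' = a' \<otimes> s"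
    show "(\<Union>(b', t')\<in>fraction R b t. fraction R (a' \<otimes> t' \<oplus> b' \<otimes> s') (s' \<otimes> t'))
      = (\<Union>(b', t')\<in>fraction R b t. fraction R (a \<otimes> t' \<oplus> b' \<otimes> s) (s \<otimes> t'))"
    proof (rule SUP_cong[OF refl])
      fix p assume p: "p \<in> fraction R b t"
      obtain b' t' where p': "p = (b', t')" by (cases p)
      have b't': "b' \<in> carrier R" "t' \<in> nonzerodivisors R" "b \<otimes> t' = b' \<otimes> t"
        using p unfolding p' total_fraction_mem by auto
      show "(case p of (b', t') \<Rightarrow> fraction R (a' \<otimes> t' \<oplus> b' \<otimes> s') (s' \<otimes> t'))
          = (case p of (b', t') \<Rightarrow> fraction R (a \<otimes> t' \<oplus> b' \<otimes> s) (s \<otimes> t'))"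
        unfolding p' prod.case using eq[OF a's' b't'] eq[OF as refl b't'] by simp
    qed
  qed
  also have "\<dots> = fraction R (a \<otimes> t \<oplus> b \<otimes> s) (s \<otimes> t)"
    by (rule total_fraction_UN[OF bt]) (rule eq[OF as refl])
  finally show ?thesis .
qed

lemma total_fraction_carrier: "a \<in> carrier R \<Longrightarrow> s \<in> nonzerodivisors R \<Longrightarrow> fraction R a s \<in> carrier (fraction_ring R)"
  by (auto simp: fraction_ring_def)

lemma total_fraction_cases:
  assumes "x \<in> carrier (fraction_ring R)"
  obtains a s where "x = fraction R a s" "a \<in> carrier R" "s \<in> nonzerodivisors R" "s \<in> carrier R"
proof -
  have "\<exists>a s. x = fraction R a s \<and> a \<in> carrier R \<and> s \<in> nonzerodivisors R"
    using assms by (simp add: fraction_ring_def)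
  then show ?thesis using that nonzerodivisors_closed by blast
qed

lemma fraction_ring_one: "\<one>\<^bsub>fraction_ring R\<^esub> = fraction R \<one> \<one>"
  and fraction_ring_zero: "\<zero>\<^bsub>fraction_ring R\<^esub> = fraction R \<zero> \<one>"
  by (simp_all add: fraction_ring_def)

lemmas total_fraction_simps = total_fraction_mult total_fraction_add fraction_ring_one fraction_ring_zero
  total_fraction_carrier nonzerodivisors_mult nonzerodivisors_one nonzerodivisors_closed

lemma cring_fraction_ring: "cring (fraction_ring R)"
proof (rule cringI)
  show "abelian_group (fraction_ring R)"
  proof (rule abelian_groupI)
    fix x assume "x \<in> carrier (fraction_ring R)"
    then obtain a s where x: "x = fraction R a s" and as: "a \<in> carrier R" "s \<in> nonzerodivisors R" "s \<in> carrier R"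
      by (rule total_fraction_cases)
    have "\<ominus> a \<otimes> s \<oplus> a \<otimes> s = \<zero>" using as by (simp add: l_minus l_neg)
    moreover have "fraction R \<zero> (s \<otimes> s) = fraction R \<zero> \<one>"
      using as by (intro total_fraction_eqI) (simp_all add: total_fraction_simps)
    ultimately have "fraction R (\<ominus> a) s \<oplus>\<^bsub>fraction_ring R\<^esub> x = \<zero>\<^bsub>fraction_ring R\<^esub>"
      unfolding x using as by (simp add: total_fraction_simps)
    then show "\<exists>y\<in>carrier (fraction_ring R). y \<oplus>\<^bsub>fraction_ring R\<^esub> x = \<zero>\<^bsub>fraction_ring R\<^esub>"
      using as by (intro bexI[of _ "fraction R (\<ominus> a) s"]) (simp_all add: total_fraction_carrier)
    show "\<zero>\<^bsub>fraction_ring R\<^esub> \<oplus>\<^bsub>fraction_ring R\<^esub> x = x"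
      unfolding x using as by (simp add: total_fraction_simps)
  next
    fix x y assume xy: "x \<in> carrier (fraction_ring R)" "y \<in> carrier (fraction_ring R)"
    obtain a s where x: "x = fraction R a s" and as: "a \<in> carrier R" "s \<in> nonzerodivisors R" "s \<in> carrier R"
      using xy(1) by (rule total_fraction_cases)
    obtain b t where y: "y = fraction R b t" and bt: "b \<in> carrier R" "t \<in> nonzerodivisors R" "t \<in> carrier R"
      using xy(2) by (rule total_fraction_cases)
    show "x \<oplus>\<^bsub>fraction_ring R\<^esub> y = y \<oplus>\<^bsub>fraction_ring R\<^esub> x"
      unfolding x y using as bt by (simp add: total_fraction_simps m_comm a_comm)
    show "x \<oplus>\<^bsub>fraction_ring R\<^esub> y \<in> carrier (fraction_ring R)"
      unfolding x y using as bt by (simp add: total_fraction_simps)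
    fix z assume "z \<in> carrier (fraction_ring R)"
    then obtain d u where z: "z = fraction R d u" and du: "d \<in> carrier R" "u \<in> nonzerodivisors R" "u \<in> carrier R"
      by (rule total_fraction_cases)
    show "x \<oplus>\<^bsub>fraction_ring R\<^esub> y \<oplus>\<^bsub>fraction_ring R\<^esub> z
      = x \<oplus>\<^bsub>fraction_ring R\<^esub> (y \<oplus>\<^bsub>fraction_ring R\<^esub> z)"
      unfolding x y z using as bt du by (simp add: total_fraction_simps l_distr r_distr m_ac a_ac)
  qed (simp add: total_fraction_simps)
  show "comm_monoid (fraction_ring R)"
  proof (rule comm_monoidI)
    fix x assume "x \<in> carrier (fraction_ring R)"
    then obtain a s where x: "x = fraction R a s" and as: "a \<in> carrier R" "s \<in> nonzerodivisors R" "s \<in> carrier R"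
      by (rule total_fraction_cases)
    show "\<one>\<^bsub>fraction_ring R\<^esub> \<otimes>\<^bsub>fraction_ring R\<^esub> x = x"
      unfolding x using as by (simp add: total_fraction_simps)
    fix y assume "y \<in> carrier (fraction_ring R)"
    then obtain b t where y: "y = fraction R b t" and bt: "b \<in> carrier R" "t \<in> nonzerodivisors R" "t \<in> carrier R"
      by (rule total_fraction_cases)
    show "x \<otimes>\<^bsub>fraction_ring R\<^esub> y = y \<otimes>\<^bsub>fraction_ring R\<^esub> x"
      unfolding x y using as bt by (simp add: total_fraction_simps m_comm)
    show "x \<otimes>\<^bsub>fraction_ring R\<^esub> y \<in> carrier (fraction_ring R)"
      unfolding x y using as bt by (simp add: total_fraction_simps)
    fix z assume "z \<in> carrier (fraction_ring R)"
    then obtain d u where z: "z = fraction R d u" and du: "d \<in> carrier R" "u \<in> nonzerodivisors R" "u \<in> carrier R"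
      by (rule total_fraction_cases)
    show "x \<otimes>\<^bsub>fraction_ring R\<^esub> y \<otimes>\<^bsub>fraction_ring R\<^esub> z
      = x \<otimes>\<^bsub>fraction_ring R\<^esub> (y \<otimes>\<^bsub>fraction_ring R\<^esub> z)"
      unfolding x y z using as bt du by (simp add: total_fraction_simps m_assoc)
  qed (simp add: total_fraction_simps)
next
  fix x y z assume xyz: "x \<in> carrier (fraction_ring R)" "y \<in> carrier (fraction_ring R)"
    "z \<in> carrier (fraction_ring R)"
  obtain a s where x: "x = fraction R a s" and as: "a \<in> carrier R" "s \<in> nonzerodivisors R" "s \<in> carrier R"
    using xyz(1) by (rule total_fraction_cases)
  obtain b t where y: "y = fraction R b t" and bt: "b \<in> carrier R" "t \<in> nonzerodivisors R" "t \<in> carrier R"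
    using xyz(2) by (rule total_fraction_cases)
  obtain d u where z: "z = fraction R d u" and du: "d \<in> carrier R" "u \<in> nonzerodivisors R" "u \<in> carrier R"
    using xyz(3) by (rule total_fraction_cases)
  have "fraction R ((a \<otimes> t \<oplus> b \<otimes> s) \<otimes> d) ((s \<otimes> t) \<otimes> u)
    = fraction R ((a \<otimes> d) \<otimes> (t \<otimes> u) \<oplus> (b \<otimes> d) \<otimes> (s \<otimes> u)) ((s \<otimes> u) \<otimes> (t \<otimes> u))"
    using as bt du by (intro total_fraction_eqI) (simp_all add: total_fraction_simps l_distr r_distr m_ac)
  then show "(x \<oplus>\<^bsub>fraction_ring R\<^esub> y) \<otimes>\<^bsub>fraction_ring R\<^esub> z
    = x \<otimes>\<^bsub>fraction_ring R\<^esub> z \<oplus>\<^bsub>fraction_ring R\<^esub> y \<otimes>\<^bsub>fraction_ring R\<^esub> z"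
    unfolding x y z using as bt du by (simp add: total_fraction_simps)
qed

lemma fraction_ring_hom: "(\<lambda>a. fraction R a \<one>) \<in> Ring.ring_hom R (fraction_ring R)"
  by (rule Ring.ring_hom_memI) (simp_all add: total_fraction_simps)

text \<open>With non-zero-divisors as denominators the ring embeds into its ring of fractions. For
  the quotient by the minors, vanishing among the fractions is therefore still membership in the
  ideal.\<close>

lemma fraction_eq_zero_iff: "a \<in> carrier R \<Longrightarrow> fraction R a \<one> = \<zero>\<^bsub>fraction_ring R\<^esub> \<longleftrightarrow> a = \<zero>"
  by (simp add: fraction_ring_zero total_fraction_eq_iff nonzerodivisors_one)

end

subsection \<open>Separating variables\<close>

definition restrict_mon :: "'v set \<Rightarrow> ('v \<Rightarrow>\<^sub>0 nat) \<Rightarrow> ('v \<Rightarrow>\<^sub>0 nat)" where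
  "restrict_mon V \<mu> = Abs_poly_mapping (\<lambda>v. if v \<in> V then lookup \<mu> v else 0)"

lemma lookup_restrict_mon: "lookup (restrict_mon V \<mu>) v = (if v \<in> V then lookup \<mu> v else 0)"
proof -
  have "finite {v. (if v \<in> V then lookup \<mu> v else 0) \<noteq> 0}"
    by (rule finite_subset[of _ "keys \<mu>"]) (auto simp: in_keys_iff split: if_splits)
  then show ?thesis by (simp add: restrict_mon_def)
qed

lemma keys_restrict_mon: "keys (restrict_mon V \<mu>) \<subseteq> V"
  by (auto simp: in_keys_iff lookup_restrict_mon split: if_splits)

lemma restrict_mon_decompose:
  assumes "keys \<mu> \<subseteq> D \<union> J" "D \<inter> J = {}"
  shows "restrict_mon D \<mu> + restrict_mon J \<mu> = \<mu>"
proof (rule poly_mapping_eqI)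
  fix v
  have "lookup \<mu> v = 0" if "v \<notin> D \<union> J" using assms(1) that by (auto simp: in_keys_iff)
  then show "lookup (restrict_mon D \<mu> + restrict_mon J \<mu>) v = lookup \<mu> v"
    using assms(2) by (auto simp: lookup_add lookup_restrict_mon)
qed

lemma restrict_mon_add:
  assumes "keys \<nu> \<subseteq> D" "keys \<mu> \<subseteq> J" "D \<inter> J = {}"
  shows "restrict_mon J (\<nu> + \<mu>) = \<mu>"
proof (rule poly_mapping_eqI)
  fix v
  have "lookup \<nu> v = 0" if "v \<in> J" using assms(1,3) that by (auto simp: in_keys_iff)
  moreover have "lookup \<mu> v = 0" if "v \<notin> J" using assms(2) that by (auto simp: in_keys_iff)
  ultimately show "lookup (restrict_mon J (\<nu> + \<mu>)) v = lookup \<mu> v"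
    by (simp add: lookup_restrict_mon lookup_add)
qed

text \<open>Brings \<open>f\<close> into the shape used by \<open>alg_independent\<close>: terms are
  grouped by their \<open>J\<close>-part, and the \<open>D\<close>-parts make up the
  coefficients.\<close>

lemma separate_variables:
  fixes f :: "('v, 'c::comm_ring_1) mpol"
  assumes f: "f \<in> polys (D \<union> J)" and "D \<inter> J = {}"
  shows "\<exists>M a. finite M \<and> (\<forall>\<mu>\<in>M. keys \<mu> \<subseteq> J) \<and> (\<forall>\<mu>. a \<mu> \<in> polys D)
    \<and> f = (\<Sum>\<mu>\<in>M. a \<mu> * mon_eval pvar \<mu>)"
proof -
  define a where "a \<mu> = (\<Sum>\<kappa>\<in>{\<kappa>\<in>keys f. restrict_mon J \<kappa> = \<mu>}.
    Poly_Mapping.single (restrict_mon D \<kappa>) (lookup f \<kappa>))" for \<mu>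
  let ?M = "restrict_mon J ` keys f"
  have M: "\<forall>\<mu>\<in>?M. keys \<mu> \<subseteq> J" using keys_restrict_mon[of J] by blast
  have a: "a \<mu> \<in> polys D" for \<mu>
    unfolding a_def by (intro polys_sum polys_single keys_restrict_mon)
  have "f = (\<Sum>\<kappa>\<in>keys f. Poly_Mapping.single \<kappa> (lookup f \<kappa>))" by (rule poly_mapping_sum_single)
  also have "\<dots> = (\<Sum>\<mu>\<in>?M. \<Sum>\<kappa>\<in>{\<kappa>\<in>keys f. restrict_mon J \<kappa> = \<mu>}. Poly_Mapping.single \<kappa> (lookup f \<kappa>))"
    by (rule sum.image_gen) simp
  also have "\<dots> = (\<Sum>\<mu>\<in>?M. a \<mu> * mon_eval pvar \<mu>)"
  proof (rule sum.cong[OF refl])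
    fix \<mu>
    have "a \<mu> * mon_eval pvar \<mu> = (\<Sum>\<kappa>\<in>{\<kappa>\<in>keys f. restrict_mon J \<kappa> = \<mu>}.
        Poly_Mapping.single (restrict_mon D \<kappa> + \<mu>) (lookup f \<kappa>))"
      by (simp add: a_def mon_eval_pvar sum_distrib_right mult_single)
    also have "\<dots> = (\<Sum>\<kappa>\<in>{\<kappa>\<in>keys f. restrict_mon J \<kappa> = \<mu>}. Poly_Mapping.single \<kappa> (lookup f \<kappa>))"
      using f assms(2) by (intro sum.cong refl arg_cong2[of _ _ _ _ Poly_Mapping.single])
        (auto simp: polys_def intro!: restrict_mon_decompose)
    finally show "(\<Sum>\<kappa>\<in>{\<kappa>\<in>keys f. restrict_mon J \<kappa> = \<mu>}. Poly_Mapping.single \<kappa> (lookup f \<kappa>))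
        = a \<mu> * mon_eval pvar \<mu>" by simp
  qed
  finally have "f = (\<Sum>\<mu>\<in>?M. a \<mu> * mon_eval pvar \<mu>)" .
  then show ?thesis using M a by (intro exI[of _ ?M] exI[of _ a] conjI) auto
qed

lemma lookup_mult_monomial: "lookup (p * mon_eval pvar \<mu>) (\<nu> + \<mu>) = lookup p \<nu>"
proof -
  have "p * mon_eval pvar \<mu> = (\<Sum>\<kappa>\<in>keys p. Poly_Mapping.single (\<kappa> + \<mu>) (lookup p \<kappa>))"
    by (subst (1) poly_mapping_sum_single[of p]) (simp add: sum_distrib_right mon_eval_pvar mult_single)
  then show ?thesis
    by (simp add: lookup_sum lookup_single when_def not_in_keys_iff_lookup_eq_zero[symmetric])
qed

text \<open>The \<open>J\<close>-part of a monomial is recovered by \<open>restrict_mon J\<close>,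
  so the summands for different \<open>\<mu>\<close> have no monomial in common and cannot
  cancel.\<close>

lemma separated_eq_0D:
  fixes a :: "('v \<Rightarrow>\<^sub>0 nat) \<Rightarrow> ('v, 'c::comm_ring_1) mpol"
  assumes "finite M" "\<And>\<mu>. \<mu> \<in> M \<Longrightarrow> keys \<mu> \<subseteq> J" "\<And>\<mu>. \<mu> \<in> M \<Longrightarrow> a \<mu> \<in> polys D" "D \<inter> J = {}"
    and 0: "(\<Sum>\<mu>\<in>M. a \<mu> * mon_eval pvar \<mu>) = 0" and \<mu>: "\<mu> \<in> M"
  shows "a \<mu> = 0"
proof (rule ccontr)
  assume "a \<mu> \<noteq> 0"
  then obtain \<nu> where \<nu>: "\<nu> \<in> keys (a \<mu>)" by (metis keys_eq_empty ex_in_conv)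
  have restr: "restrict_mon J (\<nu>' + \<mu>') = \<mu>'" if "\<mu>' \<in> M" "\<nu>' \<in> keys (a \<mu>')" for \<mu>' \<nu>'
    using assms(2,3)[OF that(1)] that(2) assms(4) by (intro restrict_mon_add[of _ D]) (auto simp: polys_def)
  have "lookup (a \<mu>' * mon_eval pvar \<mu>') (\<nu> + \<mu>) = 0" if \<mu>': "\<mu>' \<in> M - {\<mu>}" for \<mu>'
  proof (rule ccontr)
    assume "lookup (a \<mu>' * mon_eval pvar \<mu>') (\<nu> + \<mu>) \<noteq> 0"
    then have "\<nu> + \<mu> \<in> keys (a \<mu>' * mon_eval pvar \<mu>')" by (simp add: in_keys_iff)
    then obtain \<nu>' where "\<nu> + \<mu> = \<nu>' + \<mu>'" "\<nu>' \<in> keys (a \<mu>')"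
      using keys_mult[of "a \<mu>'" "mon_eval pvar \<mu>'"] by (auto simp: mon_eval_pvar split: if_splits)
    then have "\<mu> = \<mu>'" using restr[OF \<mu> \<nu>] restr[of \<mu>' \<nu>'] \<mu>' by auto
    then show False using \<mu>' by simp
  qed
  then have "lookup (\<Sum>\<mu>\<in>M. a \<mu> * mon_eval pvar \<mu>) (\<nu> + \<mu>) = lookup (a \<mu> * mon_eval pvar \<mu>) (\<nu> + \<mu>)"
    unfolding lookup_sum using assms(1) \<mu> by (subst sum.remove[of M \<mu>]) (auto intro!: sum.neutral)
  then show False using 0 \<nu> by (simp add: lookup_mult_monomial in_keys_iff)
qed

subsection \<open>Independence over the field generated by some of the variables\<close>

text \<open>\<open>K\<close> is a commutative ring, as suits a total ring of fractions;
  invertibility of denominators is tracked through \<open>Units K\<close>.\<close>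

locale poly_hom = cring K for K (structure) +
  fixes V :: "'v set" and \<iota> :: "('v, 'c::comm_ring_1) mpol \<Rightarrow> 'a"
  assumes \<iota>: "\<iota> \<in> Ring.ring_hom (mpol_ring V) K"
begin

lemma \<iota>_closed: "p \<in> polys V \<Longrightarrow> \<iota> p \<in> carrier K"
  using Ring.ring_hom_closed[OF \<iota>] by simp

lemma \<iota>_add: "p \<in> polys V \<Longrightarrow> q \<in> polys V \<Longrightarrow> \<iota> (p + q) = \<iota> p \<oplus> \<iota> q"
  using Ring.ring_hom_add[OF \<iota>] by simp

lemma \<iota>_mult: "p \<in> polys V \<Longrightarrow> q \<in> polys V \<Longrightarrow> \<iota> (p * q) = \<iota> p \<otimes> \<iota> q"
  using Ring.ring_hom_mult[OF \<iota>] by simp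

lemma \<iota>_one: "\<iota> 1 = \<one>"
  using Ring.ring_hom_one[OF \<iota>] by simp

lemma \<iota>_zero: "\<iota> 0 = \<zero>"
  using \<iota>_add[of 0 0] \<iota>_closed[of 0] by (simp add: add.r_cancel_one)

lemma \<iota>_uminus: "p \<in> polys V \<Longrightarrow> \<iota> (- p) = \<ominus> \<iota> p"
  using \<iota>_add[of "- p" p] \<iota>_closed[of p] \<iota>_closed[of "- p"]
  by (simp add: polys_uminus \<iota>_zero minus_equality)

lemma \<iota>_sum:
  "finite A \<Longrightarrow> (\<And>x. x \<in> A \<Longrightarrow> f x \<in> polys V) \<Longrightarrow> \<iota> (\<Sum>x\<in>A. f x) = (\<Oplus>x\<in>A. \<iota> (f x))"
proof (induction A rule: finite_induct)
  case (insert x A)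
  then show ?case by (simp add: \<iota>_add polys_sum \<iota>_closed finsum_insert Pi_iff)
qed (simp add: \<iota>_zero)

lemma \<iota>_power: "p \<in> polys V \<Longrightarrow> \<iota> (p ^ k) = \<iota> p [^] k"
  by (induction k) (simp_all add: \<iota>_one \<iota>_mult polys_power \<iota>_closed m_comm)

lemma \<iota>_prod:
  "finite A \<Longrightarrow> (\<And>x. x \<in> A \<Longrightarrow> f x \<in> polys V) \<Longrightarrow> \<iota> (\<Prod>x\<in>A. f x) = (\<Otimes>x\<in>A. \<iota> (f x))"
proof (induction A rule: finite_induct)
  case (insert x A)
  then show ?case by (simp add: \<iota>_mult polys_prod \<iota>_closed finprod_insert Pi_iff)
qed (simp add: \<iota>_one)

lemma \<iota>_mon_eval:
  assumes "keys \<mu> \<subseteq> V"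
  shows "\<iota> (mon_eval pvar \<mu>) = (\<Otimes>e\<in>keys \<mu>. \<iota> (pvar e) [^] lookup \<mu> e)"
proof -
  have *: "(pvar e :: ('v, 'c) mpol) \<in> polys V" if "e \<in> keys \<mu>" for e using that assms by (auto intro: polys_pvar)
  have "\<iota> (mon_eval pvar \<mu>) = (\<Otimes>e\<in>keys \<mu>. \<iota> (pvar e ^ lookup \<mu> e))"
    unfolding mon_eval_def by (rule \<iota>_prod) (auto intro: polys_power *)
  also have "\<dots> = (\<Otimes>e\<in>keys \<mu>. \<iota> (pvar e) [^] lookup \<mu> e)"
    by (rule finprod_cong') (auto simp: \<iota>_power * \<iota>_closed)
  finally show ?thesis .
qed

lemma generate_ring_subset_image:
  assumes "D \<subseteq> V" "x \<in> generate_ring K (range (\<lambda>c. \<iota> (pconst c)) \<union> (\<lambda>e. \<iota> (pvar e)) ` D)"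
  shows "\<exists>p\<in>polys D. x = \<iota> p"
proof -
  have sub: "p \<in> polys V" if "p \<in> polys D" for p :: "('v, 'c) mpol" using polys_mono[OF assms(1)] that by blast
  show ?thesis using assms(2)
  proof (induction rule: generate_ring.induct)
    case one
    show ?case by (rule bexI[of _ 1]) (simp_all add: \<iota>_one)
  next
    case (incl h)
    then show ?case by (auto intro: polys_pvar)
  next
    case (a_inv h)
    then obtain p where "p \<in> polys D" "h = \<iota> p" by blast
    then show ?case by (intro bexI[of _ "- p"]) (simp_all add: \<iota>_uminus sub polys_uminus)
  next
    case (eng_add h1 h2)
    then obtain p q where "p \<in> polys D" "h1 = \<iota> p" "q \<in> polys D" "h2 = \<iota> q" by blast
    then show ?case by (intro bexI[of _ "p + q"]) (simp_all add: \<iota>_add sub polys_add)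
  next
    case (eng_mult h1 h2)
    then obtain p q where "p \<in> polys D" "h1 = \<iota> p" "q \<in> polys D" "h2 = \<iota> q" by blast
    then show ?case by (intro bexI[of _ "p * q"]) (simp_all add: \<iota>_mult sub polys_mult)
  qed
qed

lemma image_subset_generate_ring:
  assumes "D \<subseteq> V" "p \<in> polys D"
  shows "\<iota> p \<in> generate_ring K (range (\<lambda>c. \<iota> (pconst c)) \<union> (\<lambda>e. \<iota> (pvar e)) ` D)" (is "_ \<in> ?G")
proof -
  define S where "S = {p \<in> polys V. \<iota> p \<in> ?G}"
  have S1: "1 \<in> S" using generate_ring.one by (simp add: S_def \<iota>_one)
  have S0: "0 \<in> S"
  proof -
    have "\<iota> (pconst 0) \<in> ?G" by (rule generate_ring.incl) blast
    then show ?thesis by (simp add: S_def pconst_def)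
  qed
  have add: "q + r \<in> S" if "q \<in> S" "r \<in> S" for q r
    using that generate_ring.eng_add by (auto simp: S_def \<iota>_add polys_add)
  have mult: "q * r \<in> S" if "q \<in> S" "r \<in> S" for q r
    using that generate_ring.eng_mult by (auto simp: S_def \<iota>_mult polys_mult)
  have sum: "(\<Sum>x\<in>A. g x) \<in> S" if "\<And>x. x \<in> A \<Longrightarrow> g x \<in> S" for A :: "('v \<Rightarrow>\<^sub>0 nat) set" and g
    using that by (induction A rule: infinite_finite_induct) (simp_all add: S0 add)
  have prod: "(\<Prod>x\<in>A. g x) \<in> S" if "\<And>x. x \<in> A \<Longrightarrow> g x \<in> S" for A :: "'v set" and g
    using that by (induction A rule: infinite_finite_induct) (simp_all add: S1 mult)
  have pow: "q ^ k \<in> S" if "q \<in> S" for q k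
    using that by (induction k) (simp_all add: S1 mult)
  have const: "pconst c \<in> S" for c by (auto simp: S_def intro: generate_ring.incl)
  have var: "pvar e \<in> S" if "e \<in> D" for e
    using that assms(1) by (auto simp: S_def intro: generate_ring.incl polys_pvar)
  have "p = (\<Sum>\<mu>\<in>keys p. pconst (lookup p \<mu>) * (\<Prod>v\<in>keys \<mu>. pvar v ^ lookup \<mu> v))"
    by (subst meval_pconst_pvar[of p, symmetric]) (simp add: meval_def mon_eval_def)
  also have "\<dots> \<in> S"
  proof (rule sum)
    fix \<mu> assume "\<mu> \<in> keys p"
    then have "keys \<mu> \<subseteq> D" using assms(2) by (auto simp: polys_def)
    then show "pconst (lookup p \<mu>) * (\<Prod>v\<in>keys \<mu>. pvar v ^ lookup \<mu> v) \<in> S"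
      by (intro mult const prod pow var) auto
  qed
  finally show ?thesis by (simp add: S_def)
qed

text \<open>The denominators of the finitely many coefficients are multiplied up; the product stays
  a unit of \<open>K\<close> and stays in the image of \<open>polys D\<close>.\<close>

lemma common_denominator:
  assumes D: "D \<subseteq> V" and "finite M"
    and "c \<in> M \<rightarrow> fractions_in K (range (\<lambda>c. \<iota> (pconst c)) \<union> (\<lambda>e. \<iota> (pvar e)) ` D)"
  shows "\<exists>b a. b \<in> polys D \<and> \<iota> b \<in> Units K \<and> (\<forall>\<mu>\<in>M. a \<mu> \<in> polys D \<and> c \<mu> \<in> carrier K \<and> \<iota> b \<otimes> c \<mu> = \<iota> (a \<mu>))"
  using assms(2,3)
proof (induction M rule: finite_induct)
  case empty
  show ?case by (rule exI[of _ 1]) (simp add: \<iota>_one)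
next
  case (insert \<mu> M)
  have sub: "p \<in> polys V" if "p \<in> polys D" for p :: "('v, 'c) mpol" using polys_mono[OF D] that by blast
  from insert obtain b a where b: "b \<in> polys D" "\<iota> b \<in> Units K"
    and a: "\<And>\<nu>. \<nu> \<in> M \<Longrightarrow> a \<nu> \<in> polys D \<and> c \<nu> \<in> carrier K \<and> \<iota> b \<otimes> c \<nu> = \<iota> (a \<nu>)" by auto
  from insert.prems obtain u v where uv: "c \<mu> = u \<otimes> inv v" "v \<in> Units K"
      "u \<in> generate_ring K (range (\<lambda>c. \<iota> (pconst c)) \<union> (\<lambda>e. \<iota> (pvar e)) ` D)"
      "v \<in> generate_ring K (range (\<lambda>c. \<iota> (pconst c)) \<union> (\<lambda>e. \<iota> (pvar e)) ` D)"
    by (auto simp: fractions_in_def)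
  obtain p q where pq: "p \<in> polys D" "u = \<iota> p" "q \<in> polys D" "v = \<iota> q"
    using generate_ring_subset_image[OF D] uv(3,4) by metis
  note carr = \<iota>_closed[OF sub[OF b(1)]] \<iota>_closed[OF sub[OF pq(1)]] \<iota>_closed[OF sub[OF pq(3)]]
  have inv: "inv \<iota> q \<in> carrier K" "\<iota> q \<otimes> inv \<iota> q = \<one>" using uv(2) pq(4) by auto
  let ?a = "\<lambda>\<nu>. if \<nu> = \<mu> then b * p else q * a \<nu>"
  have "\<iota> (b * q) \<in> Units K"
    using b(2) uv(2) pq(4) by (simp add: \<iota>_mult sub b(1) pq(3))
  moreover have "?a \<nu> \<in> polys D \<and> c \<nu> \<in> carrier K \<and> \<iota> (b * q) \<otimes> c \<nu> = \<iota> (?a \<nu>)" if \<nu>: "\<nu> \<in> insert \<mu> M" for \<nu>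
  proof (cases "\<nu> = \<mu>")
    case True
    have "\<iota> (b * q) \<otimes> c \<mu> = \<iota> b \<otimes> \<iota> p \<otimes> (\<iota> q \<otimes> inv \<iota> q)"
      unfolding uv(1) pq using carr inv(1) by (simp add: \<iota>_mult sub b(1) pq(3) m_ac)
    then have "\<iota> (b * q) \<otimes> c \<mu> = \<iota> (b * p)"
      unfolding inv(2) using carr by (simp add: \<iota>_mult sub b(1) pq(1))
    moreover have "c \<mu> \<in> carrier K" unfolding uv(1) pq using carr inv(1) by simp
    ultimately show ?thesis using True b(1) pq(1) by (simp add: polys_mult)
  next
    case False
    then have \<nu>: "a \<nu> \<in> polys D" "c \<nu> \<in> carrier K" "\<iota> b \<otimes> c \<nu> = \<iota> (a \<nu>)" using a \<nu> by auto
    have "\<iota> (b * q) \<otimes> c \<nu> = \<iota> q \<otimes> (\<iota> b \<otimes> c \<nu>)"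
      using carr \<nu>(2) by (simp add: \<iota>_mult sub b(1) pq(3) m_ac)
    also have "\<dots> = \<iota> (q * a \<nu>)" unfolding \<nu>(3) by (simp add: \<iota>_mult sub \<nu>(1) pq(3))
    finally show ?thesis using False \<nu> pq(3) by (simp add: polys_mult)
  qed
  ultimately show ?case using b(1) pq(3) by (intro exI[of _ "b * q"] exI[of _ ?a]) (simp add: polys_mult)
qed

text \<open>Multiplication by a common denominator, a unit, turns a relation over the fractions into
  a polynomial in \<open>D \<union> J\<close> killed by \<open>\<iota>\<close>. Injectivity of
  \<open>\<iota>\<close> on \<open>polys D\<close> ensures that a coefficient polynomial is 0 as
  soon as its image is.\<close>

theorem alg_independent_over_fractions:
  assumes D: "D \<subseteq> V" and J: "J \<subseteq> V" and disj: "D \<inter> J = {}"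
    and ker: "\<And>p. p \<in> polys D \<Longrightarrow> \<iota> p = \<zero> \<Longrightarrow> p = 0"
  shows "alg_independent K (fractions_in K (range (\<lambda>c. \<iota> (pconst c)) \<union> (\<lambda>e. \<iota> (pvar e)) ` D)) (\<lambda>e. \<iota> (pvar e)) J
    \<longleftrightarrow> (\<forall>f\<in>polys (D \<union> J). \<iota> f = \<zero> \<longrightarrow> f = 0)" (is "alg_independent K ?F _ J \<longleftrightarrow> ?R")
proof -
  have subD: "p \<in> polys V" if "p \<in> polys D" for p :: "('v, 'c) mpol" using polys_mono[OF D] that by blast
  have mon: "(mon_eval pvar \<mu> :: ('v, 'c) mpol) \<in> polys V" if "keys \<mu> \<subseteq> J" for \<mu>
    using that J by (intro polys_mon_eval polys_pvar) auto
  have \<iota>_sep: "\<iota> (\<Sum>\<mu>\<in>M. a \<mu> * mon_eval pvar \<mu>)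
      = (\<Oplus>\<mu>\<in>M. \<iota> (a \<mu>) \<otimes> (\<Otimes>e\<in>keys \<mu>. \<iota> (pvar e) [^] lookup \<mu> e))"
    if M: "finite M" "\<And>\<mu>. \<mu> \<in> M \<Longrightarrow> keys \<mu> \<subseteq> J" and a: "\<And>\<mu>. \<mu> \<in> M \<Longrightarrow> a \<mu> \<in> polys D" for M a
  proof -
    have "\<iota> (\<Sum>\<mu>\<in>M. a \<mu> * mon_eval pvar \<mu>) = (\<Oplus>\<mu>\<in>M. \<iota> (a \<mu> * mon_eval pvar \<mu>))"
      using M a by (intro \<iota>_sum polys_mult subD mon) auto
    also have "\<dots> = (\<Oplus>\<mu>\<in>M. \<iota> (a \<mu>) \<otimes> \<iota> (mon_eval pvar \<mu>))"
      using M a by (intro finsum_cong') (auto simp: \<iota>_mult subD mon \<iota>_closed)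
    also have "\<dots> = (\<Oplus>\<mu>\<in>M. \<iota> (a \<mu>) \<otimes> (\<Otimes>e\<in>keys \<mu>. \<iota> (pvar e) [^] lookup \<mu> e))"
    proof (rule finsum_cong'[OF refl])
      fix \<mu> assume \<mu>: "\<mu> \<in> M"
      then have "\<iota> (mon_eval pvar \<mu>) = (\<Otimes>e\<in>keys \<mu>. \<iota> (pvar e) [^] lookup \<mu> e)"
        using M(2)[OF \<mu>] J by (intro \<iota>_mon_eval) auto
      then show "\<iota> (a \<mu>) \<otimes> \<iota> (mon_eval pvar \<mu>) = \<iota> (a \<mu>) \<otimes> (\<Otimes>e\<in>keys \<mu>. \<iota> (pvar e) [^] lookup \<mu> e)"
        by simp
    next
      show "(\<lambda>\<mu>. \<iota> (a \<mu>) \<otimes> (\<Otimes>e\<in>keys \<mu>. \<iota> (pvar e) [^] lookup \<mu> e)) \<in> M \<rightarrow> carrier K"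
      proof
        fix \<mu> assume \<mu>: "\<mu> \<in> M"
        have "\<iota> (pvar e) \<in> carrier K" if "e \<in> keys \<mu>" for e
          using M(2)[OF \<mu>] J that by (intro \<iota>_closed polys_pvar) auto
        then show "\<iota> (a \<mu>) \<otimes> (\<Otimes>e\<in>keys \<mu>. \<iota> (pvar e) [^] lookup \<mu> e) \<in> carrier K"
          using a[OF \<mu>] by (intro m_closed finprod_closed) (auto simp: \<iota>_closed subD)
      qed
    qed
    finally show ?thesis .
  qed
  show ?thesis
  proof
    assume ind: "alg_independent K ?F (\<lambda>e. \<iota> (pvar e)) J"
    show ?R
    proof (intro ballI impI)
      fix f assume f: "f \<in> polys (D \<union> J)" "\<iota> f = \<zero>"
      obtain M a where M: "finite M" "\<And>\<mu>. \<mu> \<in> M \<Longrightarrow> keys \<mu> \<subseteq> J" and a: "\<And>\<mu>. a \<mu> \<in> polys D"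
        and eq: "f = (\<Sum>\<mu>\<in>M. a \<mu> * mon_eval pvar \<mu>)"
        using separate_variables[OF f(1) disj] by blast
      have inF: "\<iota> p \<in> ?F" if p: "p \<in> polys D" for p
      proof -
        have "\<iota> p = \<iota> p \<otimes> inv \<one>" using \<iota>_closed[OF subD[OF p]] by simp
        then show ?thesis
          unfolding fractions_in_def
          using image_subset_generate_ring[OF D p] generate_ring.one[of K] Units_one_closed by blast
      qed
      have "finite M \<and> (\<forall>\<mu>\<in>M. keys \<mu> \<subseteq> J) \<and> (\<lambda>\<mu>. \<iota> (a \<mu>)) \<in> M \<rightarrow> ?F \<and>
        (\<Oplus>\<mu>\<in>M. \<iota> (a \<mu>) \<otimes> (\<Otimes>e\<in>keys \<mu>. \<iota> (pvar e) [^] lookup \<mu> e)) = \<zero>"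
        using M a inF f(2) \<iota>_sep[OF M a] by (auto simp: eq)
      from mp[OF spec[OF spec[OF ind[unfolded alg_independent_def]]] this]
      have "a \<mu> = 0" if "\<mu> \<in> M" for \<mu> using that ker[OF a] by blast
      then show "f = 0" unfolding eq by (intro sum.neutral) simp
    qed
  next
    assume R: ?R
    show "alg_independent K ?F (\<lambda>e. \<iota> (pvar e)) J"
      unfolding alg_independent_def
    proof (intro allI impI, elim conjE)
      fix M :: "('v \<Rightarrow>\<^sub>0 nat) set" and c
      assume M: "finite M" "\<forall>\<mu>\<in>M. keys \<mu> \<subseteq> J" and c: "c \<in> M \<rightarrow> ?F"
        and 0: "(\<Oplus>\<mu>\<in>M. c \<mu> \<otimes> (\<Otimes>e\<in>keys \<mu>. \<iota> (pvar e) [^] lookup \<mu> e)) = \<zero>"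
      have M': "keys \<mu> \<subseteq> J" if "\<mu> \<in> M" for \<mu> using M(2) that by blast
      obtain b a where b: "b \<in> polys D" "\<iota> b \<in> Units K"
        and a: "\<forall>\<mu>\<in>M. a \<mu> \<in> polys D \<and> c \<mu> \<in> carrier K \<and> \<iota> b \<otimes> c \<mu> = \<iota> (a \<mu>)"
        using common_denominator[OF D M(1) c] by blast
      then have aD: "a \<mu> \<in> polys D" and cK: "c \<mu> \<in> carrier K" and bc: "\<iota> b \<otimes> c \<mu> = \<iota> (a \<mu>)"
        if "\<mu> \<in> M" for \<mu> using that by auto
      define f where "f = (\<Sum>\<mu>\<in>M. a \<mu> * mon_eval pvar \<mu>)"
      have bK: "\<iota> b \<in> carrier K" using b(2) by auto
      let ?x = "\<lambda>\<mu>. \<Otimes>e\<in>keys \<mu>. \<iota> (pvar e) [^] lookup \<mu> e"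
      have x: "?x \<mu> \<in> carrier K" if "\<mu> \<in> M" for \<mu>
        using M'[OF that] J by (intro finprod_closed) (auto intro!: \<iota>_closed polys_pvar)
      have "\<iota> f = (\<Oplus>\<mu>\<in>M. \<iota> (a \<mu>) \<otimes> ?x \<mu>)" unfolding f_def by (rule \<iota>_sep[OF M(1) M' aD])
      also have "\<dots> = (\<Oplus>\<mu>\<in>M. \<iota> b \<otimes> (c \<mu> \<otimes> ?x \<mu>))"
      proof (rule finsum_cong'[OF refl])
        fix \<mu> assume "\<mu> \<in> M"
        then show "\<iota> (a \<mu>) \<otimes> ?x \<mu> = \<iota> b \<otimes> (c \<mu> \<otimes> ?x \<mu>)"
          unfolding bc[OF \<open>\<mu> \<in> M\<close>, symmetric] using bK cK x by (simp add: m_assoc)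
      qed (use bK cK x in auto)
      also have "\<dots> = \<iota> b \<otimes> (\<Oplus>\<mu>\<in>M. c \<mu> \<otimes> ?x \<mu>)"
        by (rule finsum_rdistr[symmetric]) (use M(1) bK cK x in auto)
      also have "\<dots> = \<zero>" unfolding 0 using bK by simp
      finally have "\<iota> f = \<zero>" .
      moreover have "f \<in> polys (D \<union> J)"
        unfolding f_def
      proof (intro polys_sum polys_mult)
        fix \<mu> assume \<mu>: "\<mu> \<in> M"
        show "a \<mu> \<in> polys (D \<union> J)" using aD[OF \<mu>] polys_mono[of D "D \<union> J"] by blast
        show "mon_eval pvar \<mu> \<in> polys (D \<union> J)"
          using M'[OF \<mu>] by (intro polys_mon_eval polys_pvar) auto
      qed
      ultimately have "f = 0" using R by blast
      have "a \<mu> = 0" if \<mu>: "\<mu> \<in> M" for \<mu>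
        by (rule separated_eq_0D[OF M(1) M' aD disj \<open>f = 0\<close>[unfolded f_def] \<mu>])
      then show "\<forall>\<mu>\<in>M. c \<mu> = \<zero>"
      proof (intro ballI)
        fix \<mu> assume \<mu>: "\<mu> \<in> M"
        then have "\<iota> b \<otimes> c \<mu> = \<iota> b \<otimes> \<zero>" using bc[OF \<mu>] \<open>\<And>\<mu>. \<mu> \<in> M \<Longrightarrow> a \<mu> = 0\<close> bK by (simp add: \<iota>_zero)
        then show "c \<mu> = \<zero>" using b(2) cK[OF \<mu>] by (simp only: Units_l_cancel zero_closed)
      qed
    qed
  qed
qed

end

subsection \<open>The two matroids\<close>

lemma lookup_map_pm: "\<phi> 0 = 0 \<Longrightarrow> lookup (Poly_Mapping.map \<phi> p) \<mu> = \<phi> (lookup p \<mu>)"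
  by (simp add: Poly_Mapping.map.rep_eq when_def)

lemma keys_map_pm: "\<phi> 0 = 0 \<Longrightarrow> keys (Poly_Mapping.map \<phi> p) \<subseteq> keys p"
  by (auto simp: in_keys_iff lookup_map_pm)

lemma polys_map_pm: "\<phi> 0 = 0 \<Longrightarrow> p \<in> polys V \<Longrightarrow> Poly_Mapping.map \<phi> p \<in> polys V"
  unfolding polys_def using keys_map_pm[of \<phi> p] by blast

lemma of_real_mon_eval: "mon_eval (\<lambda>e. complex_of_real (y e)) \<mu> = complex_of_real (mon_eval y \<mu>)"
  by (simp add: mon_eval_def)

text \<open>The functional \<open>\<phi>\<close> is abstract so that the real and the imaginary part
  are treated at once.\<close>

lemma peval_real_part:
  fixes \<phi> :: "complex \<Rightarrow> real"
  assumes \<phi>: "\<phi> 0 = 0" "\<And>a b. \<phi> (a + b) = \<phi> a + \<phi> b" "\<And>a r. \<phi> (a * complex_of_real r) = \<phi> a * r"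
  shows "\<phi> (peval (\<lambda>e. complex_of_real (y e)) f) = peval y (Poly_Mapping.map \<phi> f)"
proof -
  have "\<phi> (sum g A) = (\<Sum>x\<in>A. \<phi> (g x))" for g :: "('a \<Rightarrow>\<^sub>0 nat) \<Rightarrow> complex" and A
    by (induction A rule: infinite_finite_induct) (simp_all add: \<phi>)
  then have "\<phi> (peval (\<lambda>e. complex_of_real (y e)) f) = (\<Sum>\<mu>\<in>keys f. \<phi> (lookup f \<mu>) * mon_eval y \<mu>)"
    by (simp add: meval_def of_real_mon_eval \<phi>)
  also have "\<dots> = peval y (Poly_Mapping.map \<phi> f)"
    by (subst comm_ring_hom.meval_superset[OF comm_ring_hom_ident finite_keys keys_map_pm[of \<phi> f]])
      (simp_all add: lookup_map_pm \<phi>)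
  finally show ?thesis .
qed

lemma peval_gram_of_real:
  "peval (\<lambda>v. complex_of_real (x v)) (gram_poly n e) = complex_of_real (peval x (gram_poly n e))"
  by (cases e) (simp add: peval_gram_poly)

text \<open>At real points the Gram polynomials have real values. Hence the real and imaginary parts
  of a complex relation are real relations, and a real relation holds at all real points, which
  suffices for the complex polynomial identity.\<close>

lemma poly_indep_gram_complex_iff_real:
  "poly_indep (gram_poly n :: _ \<Rightarrow> (nat \<times> nat, complex) mpol) J
    \<longleftrightarrow> poly_indep (gram_poly n :: _ \<Rightarrow> (nat \<times> nat, real) mpol) J"
proof
  assume ind: "poly_indep (gram_poly n :: _ \<Rightarrow> (nat \<times> nat, complex) mpol) J"
  show "poly_indep (gram_poly n :: _ \<Rightarrow> (nat \<times> nat, real) mpol) J"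
    unfolding poly_indep_def
  proof (intro ballI impI)
    fix f :: "(nat \<times> nat, real) mpol"
    assume f: "f \<in> polys J" "meval pconst (gram_poly n :: _ \<Rightarrow> (nat \<times> nat, real) mpol) f = 0"
    let ?f = "Poly_Mapping.map complex_of_real f"
    have "meval pconst (gram_poly n) ?f = 0"
    proof (rule polynomial_eq_0I)
      show "infinite (range complex_of_real)"
        by (simp add: infinite_UNIV_char_0 finite_image_iff inj_of_real)
      fix z :: "nat \<times> nat \<Rightarrow> complex" assume "\<And>v. z v \<in> range complex_of_real"
      then have "\<exists>x. \<forall>v. z v = complex_of_real (x v)" by (intro choice) blast
      then obtain x where x: "z = (\<lambda>v. complex_of_real (x v))" by blast
      have "peval z (meval pconst (gram_poly n) ?f)
          = (\<Sum>\<mu>\<in>keys f. complex_of_real (lookup f \<mu>) * mon_eval (\<lambda>e. peval z (gram_poly n e)) \<mu>)"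
        unfolding peval_meval
        by (subst comm_ring_hom.meval_superset[OF comm_ring_hom_ident finite_keys keys_map_pm[of complex_of_real f]])
          (simp_all add: lookup_map_pm)
      also have "\<dots> = complex_of_real (peval (\<lambda>e. peval x (gram_poly n e)) f)"
        unfolding x peval_gram_of_real of_real_mon_eval by (simp add: meval_def)
      also have "\<dots> = 0" using f(2) by (simp add: meval_eq_0_iff)
      finally show "peval z (meval pconst (gram_poly n) ?f) = 0" .
    qed
    moreover have "?f \<in> polys J" by (rule polys_map_pm[of complex_of_real, OF _ f(1)]) simp
    ultimately have "?f = 0" using ind unfolding poly_indep_def by blast
    then have "lookup f \<mu> = 0" for \<mu> by (metis lookup_map_pm lookup_zero of_real_0 of_real_eq_0_iff)
    then show "f = 0" by (intro poly_mapping_eqI) simp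
  qed
next
  assume ind: "poly_indep (gram_poly n :: _ \<Rightarrow> (nat \<times> nat, real) mpol) J"
  show "poly_indep (gram_poly n :: _ \<Rightarrow> (nat \<times> nat, complex) mpol) J"
    unfolding poly_indep_def
  proof (intro ballI impI)
    fix f :: "(nat \<times> nat, complex) mpol"
    assume f: "f \<in> polys J" "meval pconst (gram_poly n :: _ \<Rightarrow> (nat \<times> nat, complex) mpol) f = 0"
    have 0: "peval (\<lambda>e. complex_of_real (peval x (gram_poly n e))) f = 0" for x
      using f(2)[unfolded meval_eq_0_iff, THEN spec, of "\<lambda>v. complex_of_real (x v)"]
      by (simp only: peval_gram_of_real)
    have part: "Poly_Mapping.map \<phi> f = 0"
      if \<phi>: "\<phi> 0 = 0" "\<And>a b. \<phi> (a + b) = \<phi> a + \<phi> b" "\<And>a r. \<phi> (a * complex_of_real r) = \<phi> a * r"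
      for \<phi> :: "complex \<Rightarrow> real"
    proof -
      have "meval pconst (gram_poly n) (Poly_Mapping.map \<phi> f) = (0 :: (nat \<times> nat, real) mpol)"
        unfolding meval_eq_0_iff peval_real_part[OF \<phi>, symmetric] 0 using \<phi>(1) by simp
      moreover have "Poly_Mapping.map \<phi> f \<in> polys J" by (rule polys_map_pm[of \<phi>, OF \<phi>(1) f(1)])
      ultimately show ?thesis using ind unfolding poly_indep_def by blast
    qed
    have "Re (lookup f \<mu>) = 0" "Im (lookup f \<mu>) = 0" for \<mu>
      using part[of Re] part[of Im] lookup_map_pm[of Re f \<mu>] lookup_map_pm[of Im f \<mu>] by simp_all
    then show "f = 0" by (intro poly_mapping_eqI) (simp add: complex_eq_iff)
  qed
qed

text \<open>Vectors on a single axis, with complex square roots of the prescribed numbers as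
  coordinates, realize every diagonal; \<open>n \<ge> 1\<close> supplies the axis.\<close>

lemma gram_vanishing_diag_eq_0:
  assumes "n \<ge> 1" "f \<in> polys (diag m)" "gram_vanishing n f"
  shows "f = 0"
proof (rule polynomial_eq_0I[of UNIV])
  show "infinite (UNIV :: complex set)" by (rule infinite_UNIV_char_0)
  fix a :: "nat \<times> nat \<Rightarrow> complex"
  let ?x = "\<lambda>(k, i). if k = 0 then csqrt (a (i, i)) else 0"
  have "peval ?x (gram_poly n (i, i)) = a (i, i)" for i
  proof -
    have "peval ?x (gram_poly n (i, i)) = (\<Sum>k<n. if k = 0 then csqrt (a (i, i)) * csqrt (a (i, i)) else 0)"
      unfolding peval_gram_poly by (rule sum.cong) auto
    also have "\<dots> = a (i, i)" using assms(1) by (simp flip: power2_eq_square)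
    finally show ?thesis .
  qed
  then have "peval a f = peval (\<lambda>e. peval ?x (gram_poly n e)) f"
    by (intro meval_cong_polys[OF assms(2)]) (auto simp: diag_def)
  also have "\<dots> = 0" using assms(3) by (simp add: gram_vanishing_def)
  finally show "peval a f = 0" .
qed

lemma cring_sym_quotient: "cring (sym_quotient m n)"
  unfolding sym_quotient_def sym_ring_eq
  by (rule ideal.quotient_is_cring[OF ideal_minor_ideal cring_mpol_ring])

lemma to_sym_field_hom: "to_sym_field m n \<in> Ring.ring_hom (mpol_ring (sym_vars m)) (sym_field m n)"
proof -
  have "(\<lambda>p. minor_ideal m (n + 1) +>\<^bsub>sym_ring m\<^esub> p) \<in> Ring.ring_hom (mpol_ring (sym_vars m)) (sym_quotient m n)"
    unfolding sym_quotient_def sym_ring_eq by (rule ideal.rcos_ring_hom[OF ideal_minor_ideal])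
  from ring_hom_trans[OF this cring.fraction_ring_hom[OF cring_sym_quotient]]
  show ?thesis by (simp add: to_sym_field_def[abs_def] sym_field_def comp_def)
qed

lemma to_sym_field_eq_0_iff:
  assumes "p \<in> polys (sym_vars m)"
  shows "to_sym_field m n p = \<zero>\<^bsub>sym_field m n\<^esub> \<longleftrightarrow> p \<in> minor_ideal m (n + 1)"
proof -
  let ?I = "minor_ideal m (n + 1)" and ?R = "mpol_ring (sym_vars m) :: (nat \<times> nat, complex) mpol ring"
  have p: "p \<in> carrier ?R" using assms by simp
  have "?I +>\<^bsub>?R\<^esub> p \<in> carrier (sym_quotient m n)"
    unfolding sym_quotient_def sym_ring_eq
    by (rule Ring.ring_hom_closed[OF ideal.rcos_ring_hom[OF ideal_minor_ideal] p])
  then have "to_sym_field m n p = \<zero>\<^bsub>sym_field m n\<^esub> \<longleftrightarrow> ?I +>\<^bsub>?R\<^esub> p = \<zero>\<^bsub>sym_quotient m n\<^esub>"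
    unfolding to_sym_field_def sym_field_def sym_ring_eq
    by (rule cring.fraction_eq_zero_iff[OF cring_sym_quotient])
  also have "\<zero>\<^bsub>sym_quotient m n\<^esub> = ?I" by (simp add: sym_quotient_def FactRing_def)
  also have "?I +>\<^bsub>?R\<^esub> p = ?I \<longleftrightarrow> p \<in> ?I"
    using ideal.rcos_const_imp_mem[OF ideal_minor_ideal p] ring.a_rcos_zero[OF ring_mpol_ring ideal_minor_ideal]
    by blast
  finally show ?thesis .
qed

text \<open>Membership in the ideal and vanishing on Gram matrices are interchangeable in this
  criterion: for a vanishing \<open>f\<close> a power \<open>f ^ k\<close> lies in the ideal, it
  uses the same variables, and \<open>f ^ k = 0\<close> forces \<open>f = 0\<close>.\<close>

lemma sym_minor_independent_iff:
  assumes n: "n \<ge> 1" and J: "J \<subseteq> {(i, j). i < j \<and> j < m}"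
  shows "alg_independent (sym_field m n) (diag_subfield m n) (\<lambda>e. to_sym_field m n (pvar e)) J
    \<longleftrightarrow> poly_indep (gram_poly n :: _ \<Rightarrow> (nat \<times> nat, complex) mpol) (diag m \<union> J)"
proof -
  let ?I = "minor_ideal m (n + 1)"
  interpret poly_hom "sym_field m n" "sym_vars m" "to_sym_field m n"
    by (intro poly_hom.intro poly_hom_axioms.intro to_sym_field_hom)
      (simp add: sym_field_def cring.cring_fraction_ring[OF cring_sym_quotient])
  have sub: "diag m \<subseteq> sym_vars m" "J \<subseteq> sym_vars m" and disj: "diag m \<inter> J = {}"
    using J by (auto simp: diag_def sym_vars_def)
  have subp: "polys (diag m \<union> J) \<subseteq> (polys (sym_vars m) :: (nat \<times> nat, complex) mpol set)"
    using sub by (intro polys_mono) simp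
  have subd: "polys (diag m) \<subseteq> (polys (sym_vars m) :: (nat \<times> nat, complex) mpol set)"
    using sub by (intro polys_mono) simp
  have F: "diag_subfield m n = fractions_in (sym_field m n)
      (range (\<lambda>c. to_sym_field m n (pconst c)) \<union> (\<lambda>e. to_sym_field m n (pvar e)) ` diag m)"
    by (simp add: diag_subfield_def diag_def image_image)
  have "alg_independent (sym_field m n) (diag_subfield m n) (\<lambda>e. to_sym_field m n (pvar e)) J
      \<longleftrightarrow> (\<forall>f\<in>polys (diag m \<union> J). to_sym_field m n f = \<zero>\<^bsub>sym_field m n\<^esub> \<longrightarrow> f = 0)"
    unfolding F
  proof (rule alg_independent_over_fractions[OF sub disj])
    fix p assume p: "p \<in> polys (diag m)" "to_sym_field m n p = \<zero>\<^bsub>sym_field m n\<^esub>"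
    then have "p \<in> ?I" using to_sym_field_eq_0_iff subd by blast
    then show "p = 0" using gram_vanishing_diag_eq_0[OF n p(1)] minor_ideal_imp_gram_vanishing by blast
  qed
  also have "\<dots> \<longleftrightarrow> (\<forall>f\<in>polys (diag m \<union> J). f \<in> ?I \<longrightarrow> f = 0)"
    using to_sym_field_eq_0_iff[of _ m n] subp by blast
  also have "\<dots> \<longleftrightarrow> (\<forall>f\<in>polys (diag m \<union> J). gram_vanishing n f \<longrightarrow> f = 0)"
  proof
    assume I: "\<forall>f\<in>polys (diag m \<union> J). f \<in> ?I \<longrightarrow> f = 0"
    show "\<forall>f\<in>polys (diag m \<union> J). gram_vanishing n f \<longrightarrow> f = 0"
    proof (intro ballI impI)
      fix f :: "(nat \<times> nat, complex) mpol" assume f: "f \<in> polys (diag m \<union> J)" "gram_vanishing n f"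
      then obtain k where "f ^ k \<in> ?I" using gram_vanishing_imp_power_in_minor_ideal subp by blast
      then have "f ^ k = 0" using I polys_power[OF f(1)] by blast
      then show "f = 0" by simp
    qed
  qed (use minor_ideal_imp_gram_vanishing in blast)
  also have "\<dots> \<longleftrightarrow> poly_indep (gram_poly n :: _ \<Rightarrow> (nat \<times> nat, complex) mpol) (diag m \<union> J)"
    by (simp add: poly_indep_def gram_vanishing_def meval_eq_0_iff)
  finally show ?thesis .
qed

lemma rigidity_independent_iff:
  assumes J: "J \<subseteq> {(i, j). i < j \<and> j < m}"
  shows "alg_independent (mpol_ring ({..<d} \<times> {..<m})) (range pconst) (sq_dist_poly d) J
    \<longleftrightarrow> poly_indep (sq_dist_poly d) J"
proof (rule alg_independent_mpol_ring)
  fix e assume "e \<in> J"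
  then obtain i j where "e = (i, j)" "i < m" "j < m" using J by (cases e) fastforce
  then show "sq_dist_poly d e \<in> polys ({..<d} \<times> {..<m})" by (simp add: polys_sq_dist_poly)
qed

theorem theorem2p5:
  fixes m n :: nat
  assumes "m \<ge> 1" and "n \<ge> 1"
  shows "matroid_isomorphic (sym_minor_matroid_mod_diag m n) (rigidity_matroid (n - 1) m)"
proof -
  let ?E = "{(i, j). i < j \<and> j < m}"
  have "alg_independent (sym_field m n) (diag_subfield m n) (\<lambda>e. to_sym_field m n (pvar e)) J
      \<longleftrightarrow> alg_independent (mpol_ring ({..<n - 1} \<times> {..<m})) (range pconst) (sq_dist_poly (n - 1)) J"
    if J: "J \<subseteq> ?E" for J
    using sym_minor_independent_iff[OF assms(2) J] rigidity_independent_iff[OF J, of "n - 1"]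
      poly_indep_gram_complex_iff_real[of n "diag m \<union> J"] poly_indep_gram_iff_sq_dist[OF J, of "n - 1"]
      assms(2)
    by simp
  then show ?thesis
    unfolding matroid_isomorphic_def sym_minor_matroid_mod_diag_def rigidity_matroid_def algebraic_matroid_def
    \<comment> \<open>Both ground sets consist of the same index pairs, so the identity is an
      isomorphism.\<close>
    by (intro exI[of _ id]) auto
qed

end
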